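(* Let $f_0:\mathbb{R}^n\to\mathbb{R}$ and $F:\mathbb{R}^n\to\mathbb{R}^m$ be twice continuously differentiable, $g:\mathbb{R}^m\to\overline{\mathbb{R}}$ lower semicontinuous proper convex, and $f:=f_0+g\circ F$. Let $\bar x\in\operatorname{dom}(g\circ F)$ be a tilt-stable local minimizer of $f$ with modulus $\kappa>0$ satisfying the KKT conditions (there is $\mu\in\partial g(F(\bar x))$ with $\nabla_xL(\bar x,\mu)=0$). Assume: (1) there is a neighborhood of $\bar x$ such that for every $x$ in it and every $\mu\in\partial g(F(x))$, $g$ is parabolically regular at $F(x)$ for $\mu$ and parabolically epi-differentiable at $F(x)$ for every $d$ with $dg(F(x))(d)=\langle\mu,d\rangle$; (2) $g$ is locally Lipschitz around $F(\bar x)$ relative to $\operatorname{dom}g$ with constant $\ell\ge0$, and there are $\kappa_0>0$ and a neighborhood $\mathcal{U}$ of $\bar x$ with $\operatorname{dist}(x',\operatorname{dom}(g\circ F))\le\kappa_0\operatorname{dist}(F(x'),\operatorname{dom}g)$ for all $x'\in\mathcal{U}$; (3) for every $\mu\in\partial g(F(\bar x))$ there exists $\overline{W}=\overline W_\mu\in\partial_B\operatorname{Prox}_g(F(\bar x)+\mu)$ with $\bigcup_{V\in\mathcal{J}\operatorname{Prox}_g(F(\bar x)+\mu)}\operatorname{rge}V=\operatorname{rge}\overline{W}$ such that every $y$ in this union satisfies $y=\overline{W}\bar z$ for some $\bar z$ with $\min_{z\in\mathbb{R}^m,\,y=Vz,\,V\in\mathcal{J}\operatorname{Prox}_g(F(\bar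 x)+\mu)}\langle y,z-y\rangle=\langle y,\bar z-y\rangle=\langle y,(\overline{W}^\dagger-I)y\rangle$; (4) for any nonzero $w\in\mathcal{K}(\bar x,-\nabla f_0(\bar x))$, any $\mu\in\Lambda(\bar x,-\nabla f_0(\bar x);w)\cap\tau(\bar x,-\nabla f_0(\bar x))\mathbb{B}_{\mathbb{R}^m}$ and any $v$ with $\nabla F(\bar x)v\in\operatorname{dom}\Gamma_g(F(\bar x),\mu)$, there exist $(x^k,\mu^k)\to(\bar x,\mu)$ with $\mu^k\in\partial g(F(x^k))$, $z^k\to(\overline{W}_\mu^\dagger-I)\nabla F(\bar x)v$ and $v^k\to v$ such that $(z^k,-\nabla F(x^k)v^k)\in\widehat{\mathcal{N}}_{\operatorname{gph}\partial g}(F(x^k),\mu^k)$ and $\Lambda(x^k,\nabla F(x^k)^T\mu^k)$ is a singleton. Then $$\langle v,\nabla^2_{xx}L(\bar x,\mu)v\rangle+\Gamma_g(F(\bar x),\mu)(\nabla F(\bar x)v)\ge\frac1\kappa\|v\|^2\quad\text{for all } v\neq0 \text{ with } \nabla F(\bar x)v\in\bigcup_{V\in\mathcal{J}\operatorname{Prox}_g(F(\bar x)+\mu)}\operatorname{rge}V$$ for every $\mu\in\bigcup_{0\neq w\in\mathcal{K}(\bar x,-\nabla f_0(\bar x))}\Lambda(\bar x,-\nabla f_0(\bar x);w)\cap\tau(\bar x,-\nabla f_0(\bar x))\mathbb{B}_{\mathbb{R}^m}$.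
   Context: $L(x,\mu):=f_0(x)+\langle F(x),\mu\rangle$. $dg(y)(d):=\liminf_{t\downarrow0,\,d'\to d}\frac{g(y+td')-g(y)}{t}$; $d^{2}g(y,\mu)(d):=\liminf_{\tau\downarrow0,\,d'\to d}\frac{g(y+\tau d')-g(y)-\tau\langle \mu,d'\rangle}{\tau^2/2}$; for $d$ with $dg(y)(d)$ finite, $d^{2}g(y)(d,w):=\liminf_{t\downarrow0,\,w'\to w}\frac{g(y+td+\frac12t^2w')-g(y)-t\,dg(y)(d)}{t^2/2}$. Parabolic epi-differentiability at $y$ for $d$: $\operatorname{dom}d^2g(y)(d,\cdot)\neq\emptyset$ and for every $w$, $t_k\downarrow0$ there are $w_k\to w$ with $d^2g(y)(d,w)=\lim_k\frac{g(y+t_kd+\frac12t_k^2w_k)-g(y)-t_k\,dg(y)(d)}{t_k^2/2}$; parabolic regularity at $y$ for $\mu$: $\inf_w\{d^2g(y)(d,w)-\langle\mu,w\rangle\}=d^2g(y,\mu)(d)$ for all $d$. $\widehat{\mathcal{N}}_C$ is the Fréchet regular normal cone. $\operatorname{Prox}_g(y):=\operatorname{argmin}_z\{g(z)+\frac12\|z-y\|^2\}$; $\partial_B$ B-subdifferential, $\mathcal{J}:=\operatorname{conv}\partial_B$; $\operatorname{rge}V$ range, $V^\dagger$ Moore–Penrose inverse. SOVF: $\Gamma_g(y,\mu)(v):=\min_{d,\,v=Vd,\,V\in\mathcal{J}\operatorname{Prox}_g(y+\mu)}\langle v,d-v\rangle$ if $v\in\bigcup_{V\in\mathcal{J}\operatorname{Prox}_g(y+\mu)}\operatorname{rge}V$,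 $\infty$ otherwise; its domain is where it is finite. For $x^*\in\nabla F(x)^T\partial g(F(x))$: $\Lambda(x,x^* ):=\{\mu\in\partial g(F(x))\mid x^*=\nabla F(x)^T\mu\}$; $\mathcal{K}(x,x^* ):=\{d\mid dg(F(x))(\nabla F(x)d)=\langle x^*,d\rangle\}$; for $v\in\mathcal{K}(x,x^* )$, $\Lambda(x,x^*;v):=\operatorname{argmax}_{\mu\in\Lambda(x,x^* )}(\langle\mu,\nabla^2F(x)(v,v)\rangle+d^2g(F(x),\mu)(\nabla F(x)v))$ with $\nabla^2F(x)(v,v)_i=v^T\nabla^2F_i(x)v$; $\tau(x,x^* ):=\kappa_0\ell\|\nabla F(x)\|+\kappa_0\|x^*\|+\ell$. $\bar x$ is a tilt-stable local minimizer of $f$ with modulus $\kappa$ if for some $\delta>0$ the map $M_\delta(u):=\operatorname{argmin}_{\|x'-\bar x\|\le\delta}\{f(x')-f(\bar x)-\langle u,x'-\bar x\rangle\}$ is single-valued and Lipschitz with modulus $\kappa$ on a neighborhood of $u=0$ and $M_\delta(0)=\{\bar x\}$. *)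

theory Defs
  imports "HOL-Analysis.Analysis"
begin

definition jac :: "(real^'n \<Rightarrow> real^'m) \<Rightarrow> real^'n \<Rightarrow> real^'n^'m" where
  "jac F x = matrix (frechet_derivative F (at x))"

definition grad :: "(real^'n \<Rightarrow> real) \<Rightarrow> real^'n \<Rightarrow> real^'n" where
  "grad f x = (\<chi> i. frechet_derivative f (at x) (axis i 1))"

definition C2_fun :: "(real^'n \<Rightarrow> real) \<Rightarrow> bool" where
  "C2_fun f \<longleftrightarrow> (\<forall>x. f differentiable (at x)) \<and> (\<forall>x. grad f differentiable (at x)) \<and>
     (\<forall>h. continuous_on UNIV (\<lambda>x. frechet_derivative (grad f) (at x) h))"

definition C2_map :: "(real^'n \<Rightarrow> real^'m) \<Rightarrow> bool" where
  "C2_map F \<longleftrightarrow> (\<forall>x. F differentiable (at x)) \<and> (\<forall>x. jac F differentiable (at x)) \<and>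
     (\<forall>h. continuous_on UNIV (\<lambda>x. frechet_derivative (jac F) (at x) h))"

definition hessq :: "(real^'n \<Rightarrow> real) \<Rightarrow> real^'n \<Rightarrow> real^'n \<Rightarrow> real" where
  "hessq f x v = frechet_derivative (grad f) (at x) v \<bullet> v"

text \<open>\<open>\<nabla>\<^sup>2F(x)(v,v)\<close>, with i-th component \<open>v\<^sup>T \<nabla>\<^sup>2F\<^sub>i(x) v\<close>.\<close>
definition d2F :: "(real^'n \<Rightarrow> real^'m) \<Rightarrow> real^'n \<Rightarrow> real^'n \<Rightarrow> real^'m" where
  "d2F F x v = frechet_derivative (jac F) (at x) v *v v"

definition edom :: "('a \<Rightarrow> ereal) \<Rightarrow> 'a set" where
  "edom g = {y. g y < \<infinity>}"

definition lsc :: "('a::topological_space \<Rightarrow> ereal) \<Rightarrow> bool" where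
  "lsc g \<longleftrightarrow> (\<forall>y. g y \<le> Liminf (at y) g)"

definition proper :: "('a \<Rightarrow> ereal) \<Rightarrow> bool" where
  "proper g \<longleftrightarrow> (\<forall>y. g y \<noteq> -\<infinity>) \<and> edom g \<noteq> {}"

definition econvex :: "('a::real_vector \<Rightarrow> ereal) \<Rightarrow> bool" where
  "econvex g \<longleftrightarrow> convex {(y, t::real). g y \<le> ereal t}"

definition subdiff :: "('a::real_inner \<Rightarrow> ereal) \<Rightarrow> 'a \<Rightarrow> 'a set" where
  "subdiff g y = {\<mu>. \<bar>g y\<bar> \<noteq> \<infinity> \<and> (\<forall>z. g y + ereal (\<mu> \<bullet> (z - y)) \<le> g z)}"

definition gph_subdiff :: "('a::real_inner \<Rightarrow> ereal) \<Rightarrow> ('a \<times> 'a) set" where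
  "gph_subdiff g = {(y, \<mu>). \<mu> \<in> subdiff g y}"

definition subderiv :: "('a::real_normed_vector \<Rightarrow> ereal) \<Rightarrow> 'a \<Rightarrow> 'a \<Rightarrow> ereal" where
  "subderiv g y d = Liminf (at_right 0 \<times>\<^sub>F nhds d)
     (\<lambda>(t, d'). (g (y + t *\<^sub>R d') - g y) / ereal t)"

definition subderiv2 :: "('a::real_inner \<Rightarrow> ereal) \<Rightarrow> 'a \<Rightarrow> 'a \<Rightarrow> 'a \<Rightarrow> ereal" where
  "subderiv2 g y \<mu> d = Liminf (at_right 0 \<times>\<^sub>F nhds d)
     (\<lambda>(t, d'). (g (y + t *\<^sub>R d') - g y - ereal (t * (\<mu> \<bullet> d'))) / ereal (t\<^sup>2 / 2))"

text \<open>Parabolic difference quotient and parabolic subderivative \<open>d\<^sup>2g(y)(d,w)\<close>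
  (meaningful when \<open>dg(y)(d)\<close> is finite).\<close>
definition parab_quot :: "('a::real_normed_vector \<Rightarrow> ereal) \<Rightarrow> 'a \<Rightarrow> 'a \<Rightarrow> real \<Rightarrow> 'a \<Rightarrow> ereal" where
  "parab_quot g y d t w' = (g (y + t *\<^sub>R d + (t\<^sup>2 / 2) *\<^sub>R w') - g y - ereal t * subderiv g y d)
      / ereal (t\<^sup>2 / 2)"

definition parab_subderiv :: "('a::real_normed_vector \<Rightarrow> ereal) \<Rightarrow> 'a \<Rightarrow> 'a \<Rightarrow> 'a \<Rightarrow> ereal" where
  "parab_subderiv g y d w = Liminf (at_right 0 \<times>\<^sub>F nhds w) (\<lambda>(t, w'). parab_quot g y d t w')"

definition parab_epi_diff :: "('a::real_normed_vector \<Rightarrow> ereal) \<Rightarrow> 'a \<Rightarrow> 'a \<Rightarrow> bool" where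
  "parab_epi_diff g y d \<longleftrightarrow> \<bar>subderiv g y d\<bar> \<noteq> \<infinity> \<and>
     (\<exists>w. parab_subderiv g y d w < \<infinity>) \<and>
     (\<forall>w t. (\<forall>k. t k > 0) \<and> t \<longlonglongrightarrow> 0 \<longrightarrow>
        (\<exists>wk. wk \<longlonglongrightarrow> w \<and> (\<lambda>k. parab_quot g y d (t k) (wk k)) \<longlonglongrightarrow> parab_subderiv g y d w))"

definition parab_regular :: "('a::real_inner \<Rightarrow> ereal) \<Rightarrow> 'a \<Rightarrow> 'a \<Rightarrow> bool" where
  "parab_regular g y \<mu> \<longleftrightarrow> (\<forall>d. subderiv2 g y \<mu> d < \<infinity> \<longrightarrow>
     (INF w. parab_subderiv g y d w - ereal (\<mu> \<bullet> w)) = subderiv2 g y \<mu> d)"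

definition frechet_normal :: "'a::real_inner set \<Rightarrow> 'a \<Rightarrow> 'a set" where
  "frechet_normal C p = {v. \<forall>\<epsilon>>0. \<exists>\<delta>>0. \<forall>p'\<in>C. norm (p' - p) < \<delta> \<longrightarrow>
      v \<bullet> (p' - p) \<le> \<epsilon> * norm (p' - p)}"

definition prox :: "(real^'m \<Rightarrow> ereal) \<Rightarrow> real^'m \<Rightarrow> real^'m" where
  "prox g y = (THE z. \<forall>z'. g z + ereal ((norm (z - y))\<^sup>2 / 2) \<le> g z' + ereal ((norm (z' - y))\<^sup>2 / 2))"

definition Bsubdiff :: "(real^'m \<Rightarrow> real^'m) \<Rightarrow> real^'m \<Rightarrow> (real^'m^'m) set" where
  "Bsubdiff P y = {V. \<exists>yk. yk \<longlonglongrightarrow> y \<and> (\<forall>k. P differentiable (at (yk k))) \<and>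
      (\<lambda>k. jac P (yk k)) \<longlonglongrightarrow> V}"

definition Clarke_jac :: "(real^'m \<Rightarrow> real^'m) \<Rightarrow> real^'m \<Rightarrow> (real^'m^'m) set" where
  "Clarke_jac P y = convex hull (Bsubdiff P y)"

definition rge :: "real^'m^'k \<Rightarrow> (real^'k) set" where
  "rge V = range (\<lambda>z. V *v z)"

definition pinv :: "real^'m^'k \<Rightarrow> real^'k^'m" where
  "pinv V = (THE X. V ** X ** V = V \<and> X ** V ** X = X \<and>
      transpose (V ** X) = V ** X \<and> transpose (X ** V) = X ** V)"

definition SOVF :: "(real^'m \<Rightarrow> ereal) \<Rightarrow> real^'m \<Rightarrow> real^'m \<Rightarrow> real^'m \<Rightarrow> ereal" where
  "SOVF g y \<mu> v = (if v \<in> (\<Union>V\<in>Clarke_jac (prox g) (y + \<mu>). rge V)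
     then (INF dV \<in> {(d, V). V \<in> Clarke_jac (prox g) (y + \<mu>) \<and> v = V *v d}.
             ereal (v \<bullet> (fst dV - v)))
     else \<infinity>)"

definition Lambda :: "(real^'m \<Rightarrow> ereal) \<Rightarrow> (real^'n \<Rightarrow> real^'m) \<Rightarrow> real^'n \<Rightarrow> real^'n \<Rightarrow> (real^'m) set" where
  "Lambda g F x xs = {\<mu>\<in>subdiff g (F x). xs = transpose (jac F x) *v \<mu>}"

definition crit_cone :: "(real^'m \<Rightarrow> ereal) \<Rightarrow> (real^'n \<Rightarrow> real^'m) \<Rightarrow> real^'n \<Rightarrow> real^'n \<Rightarrow> (real^'n) set" where
  "crit_cone g F x xs = {d. subderiv g (F x) (jac F x *v d) = ereal (xs \<bullet> d)}"

definition Lambda_dir :: "(real^'m \<Rightarrow> ereal) \<Rightarrow> (real^'n \<Rightarrow> real^'m) \<Rightarrow> real^'n \<Rightarrow> real^'n \<Rightarrow> real^'n \<Rightarrow> (real^'m) set" where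
  "Lambda_dir g F x xs v = {\<mu>\<in>Lambda g F x xs. \<forall>\<mu>'\<in>Lambda g F x xs.
      ereal (\<mu>' \<bullet> d2F F x v) + subderiv2 g (F x) \<mu>' (jac F x *v v)
        \<le> ereal (\<mu> \<bullet> d2F F x v) + subderiv2 g (F x) \<mu> (jac F x *v v)}"

definition tau :: "real \<Rightarrow> real \<Rightarrow> (real^'n \<Rightarrow> real^'m) \<Rightarrow> real^'n \<Rightarrow> real^'n \<Rightarrow> real" where
  "tau \<kappa>0 ell F x xs = \<kappa>0 * ell * onorm (\<lambda>v. jac F x *v v) + \<kappa>0 * norm xs + ell"

definition tilt_M :: "(real^'n \<Rightarrow> ereal) \<Rightarrow> real^'n \<Rightarrow> real \<Rightarrow> real^'n \<Rightarrow> (real^'n) set" where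
  "tilt_M f xb \<delta> u = {x\<in>cball xb \<delta>. \<forall>x'\<in>cball xb \<delta>.
      f x - f xb - ereal (u \<bullet> (x - xb)) \<le> f x' - f xb - ereal (u \<bullet> (x' - xb))}"

definition tilt_stable :: "(real^'n \<Rightarrow> ereal) \<Rightarrow> real^'n \<Rightarrow> real \<Rightarrow> bool" where
  "tilt_stable f xb \<kappa> \<longleftrightarrow> (\<exists>\<delta>>0. \<exists>\<epsilon>>0.
      (\<forall>u\<in>ball 0 \<epsilon>. \<exists>x. tilt_M f xb \<delta> u = {x}) \<and>
      (\<forall>u\<in>ball 0 \<epsilon>. \<forall>u'\<in>ball 0 \<epsilon>. \<forall>x x'. tilt_M f xb \<delta> u = {x} \<and> tilt_M f xb \<delta> u' = {x'}
          \<longrightarrow> dist x x' \<le> \<kappa> * dist u u') \<and>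
      tilt_M f xb \<delta> 0 = {xb})"

end

theory Submission
  imports Defs
begin

text \<open>
  The inequality is proved at the points \<open>(x\<^sup>k, \<mu>\<^sup>k, z\<^sup>k, v\<^sup>k)\<close> of assumption (4) and then passed to the
  limit. At such a point two bounds on the second subderivative of \<open>g\<close> at \<open>F x\<^sup>k\<close> for \<open>\<mu>\<^sup>k\<close> in the
  direction \<open>- \<nabla>F(x\<^sup>k) v\<^sup>k\<close> are combined.

  Upper bound \<open>\<langle>z\<^sup>k, \<nabla>F(x\<^sup>k) v\<^sup>k\<rangle>\<close>: test the regular normal against the difference quotients of the
  graph of \<open>\<partial>g\<close> along a resolvent, and let the resolvent parameter tend to zero.

  Lower bound \<open>\<parallel>v\<^sup>k\<parallel>\<^sup>2 / \<kappa> - \<langle>v\<^sup>k, \<nabla>\<^sup>2\<^sub>x\<^sub>x L(x\<^sup>k, \<mu>\<^sup>k) v\<^sup>k\<rangle>\<close>: tilt stability yields quadratic growth of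
  \<open>f\<close> at every KKT pair near \<open>(xb, 0)\<close>. Inserting parabolic arcs, corrected back into the domain by
  metric subregularity, gives a penalized inequality for the convex parabolic subderivative. Convex
  separation turns the penalty into a multiplier \<open>\<eta>\<close>, which belongs to \<open>\<Lambda>(x\<^sup>k, \<nabla>F(x\<^sup>k)\<^sup>T \<mu>\<^sup>k)\<close>; since
  this set is a singleton, \<open>\<eta> = \<mu>\<^sup>k\<close>, and parabolic regularity concludes.
\<close>

section \<open>Lower limits over shrinking steps and directions\<close>

text \<open>The obstacle in the upper bound is that a direction in the graph of the subdifferential
  cannot be prescribed by its first component: points near \<open>y\<close> on a given ray need not
  carry subgradients near \<open>\<mu>\<close>. What can be prescribed, as in Minty's theorem, is
  the sum \<open>a + \<rho> *\<^sub>R b\<close>; it is set to \<open>- u\<close>, and monotonicity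
  with the normal inequality bounds \<open>\<rho> * (norm b)\<^sup>2\<close>, which forces
  \<open>a\<close> towards \<open>- u\<close> as \<open>\<rho>\<close> vanishes. In the lower bound,
  a parabola fitting the domain of \<open>g\<close> need not be the image under \<open>F\<close> of
  a parabola; the residual is what the metric and Lipschitz estimates price. Separation only places
  the multiplier in the set \<Lambda>. At \<open>xb\<close> this set may contain more than the given
  \<open>\<mu>\<close>, hence the passage through nearby points. In the limit, assumption (3)
  identifies the limit of the upper bounds with the value of \<Gamma>. The constant 1/\<kappa>
  arises because a Lipschitz modulus \<kappa> dualizes to growth 1/(2\<kappa>), and second-order
  quotients divide by half the squared step. The minus sign in the direction is harmless because the
  second-order terms are even.\<close>

lemma eventually_at_right_nhdsD:
  fixes d :: "'a::metric_space"
  assumes "eventually P (at_right (0::real) \<times>\<^sub>F nhds d)"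
  shows "\<exists>e>0. \<forall>t d'. 0 < t \<and> t < e \<and> dist d' d < e \<longrightarrow> P (t, d')"
proof -
  obtain Pt Pd where Pt: "eventually Pt (at_right 0)" and Pd: "eventually Pd (nhds d)"
    and P: "\<And>x y. Pt x \<Longrightarrow> Pd y \<Longrightarrow> P (x, y)"
    using assms by (auto simp: eventually_prod_filter)
  obtain b where b: "b > 0" "\<And>t. 0 < t \<Longrightarrow> t < b \<Longrightarrow> Pt t"
    using Pt by (auto simp: eventually_at_right_field)
  obtain r where r: "r > 0" "\<And>d'. dist d' d < r \<Longrightarrow> Pd d'"
    using Pd by (auto simp: eventually_nhds_metric)
  show ?thesis
    using b r P by (intro exI[of _ "min b r"]) auto
qed

lemma eventually_at_right_nhdsI:
  fixes d :: "'a::metric_space"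
  assumes "e > 0" "\<And>t d'. 0 < t \<Longrightarrow> t < e \<Longrightarrow> dist d' d < e \<Longrightarrow> P (t, d')"
  shows "eventually P (at_right (0::real) \<times>\<^sub>F nhds d)"
  unfolding eventually_prod_filter
proof (intro exI conjI)
  show "eventually (\<lambda>t. 0 < t \<and> t < e) (at_right 0)"
    using assms(1) by (auto simp: eventually_at_right_field)
  show "eventually (\<lambda>d'. dist d' d < e) (nhds d)"
    using assms(1) by (auto simp: eventually_nhds_metric)
qed (use assms(2) in auto)

text \<open>If \<open>h\<close> stayed above \<open>C\<close> on one box around
  \<open>(0, d)\<close>, so would the lower limit; boxes of size \<open>1 / real (Suc k)\<close>
  therefore supply the sequences. Together with \<open>Liminf_le_seq\<close> this replaces the
  product filter by sequences throughout.\<close>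

lemma Liminf_less_seq:
  fixes d :: "'a::metric_space" and h :: "real \<times> 'a \<Rightarrow> ereal"
  assumes "Liminf (at_right 0 \<times>\<^sub>F nhds d) h < C"
  shows "\<exists>t dk. (\<forall>k. t k > 0) \<and> t \<longlonglongrightarrow> 0 \<and> dk \<longlonglongrightarrow> d \<and> (\<forall>k. h (t k, dk k) < C)"
proof -
  have "\<exists>t d'. 0 < t \<and> t < e \<and> dist d' d < e \<and> h (t, d') < C" if "e > 0" for e
  proof (rule ccontr)
    assume n: "\<not> ?thesis"
    have "C \<le> h (t, d')" if "0 < t" "t < e" "dist d' d < e" for t d'
      using n that by (meson not_le)
    then have "eventually (\<lambda>p. C \<le> h p) (at_right 0 \<times>\<^sub>F nhds d)"
      using that by (intro eventually_at_right_nhdsI[of e])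
    then show False
      using Liminf_bounded[of C h] assms leD by blast
  qed
  then have "\<forall>k. \<exists>t d'. 0 < t \<and> t < 1 / real (Suc k) \<and> dist d' d < 1 / real (Suc k) \<and> h (t, d') < C"
    by auto
  then obtain t dk where tk: "\<And>k. 0 < t k" "\<And>k. t k < 1 / real (Suc k)"
      "\<And>k. dist (dk k) d < 1 / real (Suc k)" "\<And>k. h (t k, dk k) < C"
    by metis
  have lim: "(\<lambda>k. 1 / real (Suc k)) \<longlonglongrightarrow> 0"
    using LIMSEQ_inverse_real_of_nat by (simp add: inverse_eq_divide)
  have "t \<longlonglongrightarrow> 0"
    by (rule tendsto_sandwich[OF _ _ tendsto_const lim])
      (auto intro!: always_eventually less_imp_le tk simp del: of_nat_Suc)
  moreover have "(\<lambda>k. dist (dk k) d) \<longlonglongrightarrow> 0"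
    by (rule tendsto_sandwich[OF _ _ tendsto_const lim])
      (auto intro!: always_eventually less_imp_le[OF tk(3)] simp del: of_nat_Suc)
  then have "dk \<longlonglongrightarrow> d"
    using tendsto_dist_iff by blast
  ultimately show ?thesis
    using tk(1,4) by blast
qed

lemma Liminf_le_seq:
  fixes d :: "'a::metric_space" and h :: "real \<times> 'a \<Rightarrow> ereal"
  assumes t: "\<And>k. t k > 0" "t \<longlonglongrightarrow> 0" and dk: "dk \<longlonglongrightarrow> d"
    and le: "eventually (\<lambda>k. h (t k, dk k) \<le> ereal (c k)) sequentially" and c: "c \<longlonglongrightarrow> c0"
  shows "Liminf (at_right 0 \<times>\<^sub>F nhds d) h \<le> ereal c0"
proof (rule ccontr)
  assume "\<not> ?thesis"
  then have "ereal c0 < Liminf (at_right 0 \<times>\<^sub>F nhds d) h" by simp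
  then obtain r where r: "c0 < r" "ereal r < Liminf (at_right 0 \<times>\<^sub>F nhds d) h"
    by (metis ereal_dense2 less_ereal.simps(1))
  obtain e where e: "e > 0" "\<And>t d'. 0 < t \<Longrightarrow> t < e \<Longrightarrow> dist d' d < e \<Longrightarrow> ereal r < h (t, d')"
    using eventually_at_right_nhdsD[OF less_LiminfD[OF r(2)]] by auto
  have "eventually (\<lambda>k. t k < e) sequentially"
    using order_tendstoD(2)[OF t(2)] e(1) by auto
  moreover have "eventually (\<lambda>k. dist (dk k) d < e) sequentially"
    using tendstoD[OF dk e(1)] .
  moreover have "eventually (\<lambda>k. c k < r) sequentially"
    using order_tendstoD(2)[OF c r(1)] .
  ultimately have "eventually (\<lambda>k::nat. False) sequentially"
    using le
  proof eventually_elim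
    case (elim k)
    then have "ereal r < h (t k, dk k)" using e(2) t(1) by auto
    also have "\<dots> \<le> ereal (c k)" using elim by auto
    finally show ?case using elim by auto
  qed
  then show False by auto
qed

text \<open>Lower semicontinuity in the base direction: a box around \<open>a\<close> contains a box
  of half its size around every nearby \<open>ak k\<close>. It carries the bound at the resolvent
  directions over to their limit.\<close>

lemma Liminf_nhds_lsc:
  fixes a :: "'a::metric_space" and h :: "real \<times> 'a \<Rightarrow> ereal"
  assumes a: "ak \<longlonglongrightarrow> a"
    and le: "\<And>k. Liminf (at_right 0 \<times>\<^sub>F nhds (ak k)) h \<le> ereal (c k)" and c: "c \<longlonglongrightarrow> c0"
  shows "Liminf (at_right 0 \<times>\<^sub>F nhds a) h \<le> ereal c0"
proof (rule ccontr)
  assume "\<not> ?thesis"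
  then have "ereal c0 < Liminf (at_right 0 \<times>\<^sub>F nhds a) h" by simp
  then obtain r where r: "c0 < r" "ereal r < Liminf (at_right 0 \<times>\<^sub>F nhds a) h"
    by (metis ereal_dense2 less_ereal.simps(1))
  obtain e where e: "e > 0" "\<And>t d'. 0 < t \<Longrightarrow> t < e \<Longrightarrow> dist d' a < e \<Longrightarrow> ereal r < h (t, d')"
    using eventually_at_right_nhdsD[OF less_LiminfD[OF r(2)]] by auto
  have "eventually (\<lambda>k. dist (ak k) a < e / 2) sequentially"
    using tendstoD[OF a, of "e / 2"] e(1) by simp
  moreover have "eventually (\<lambda>k. c k < r) sequentially"
    using order_tendstoD(2)[OF c r(1)] .
  ultimately have "eventually (\<lambda>k. dist (ak k) a < e / 2 \<and> c k < r) sequentially"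
    by (rule eventually_conj)
  then obtain k where k: "dist (ak k) a < e / 2" "c k < r"
    using eventually_happens'[OF sequentially_bot] by blast
  have "eventually (\<lambda>p. ereal r \<le> h p) (at_right 0 \<times>\<^sub>F nhds (ak k))"
  proof (rule eventually_at_right_nhdsI[of "e / 2"])
    fix t :: real and d'
    assume t: "0 < t" "t < e / 2" and d': "dist d' (ak k) < e / 2"
    have "dist d' a \<le> dist d' (ak k) + dist (ak k) a" by (rule dist_triangle)
    then have "dist d' a < e" using d' k(1) by linarith
    then show "ereal r \<le> h (t, d')"
      using e t by (intro less_imp_le e(2)) auto
  qed (use e in auto)
  from order_trans[OF Liminf_bounded[OF this] le] have "ereal r \<le> ereal (c k)" .
  then show False using k(2) by simp
qed

text \<open>The second-order quotients become bounds of a single value of \<open>g\<close> by a real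
  number. Only \<open>a\<close> may be infinite, and both infinite cases are consistent, so no
  finiteness of \<open>g\<close> has to be checked at the varying point.\<close>

lemma ereal_quot_le_iff:
  assumes "s > 0"
  shows "(a - ereal b - ereal c) / ereal s \<le> ereal \<gamma> \<longleftrightarrow> a \<le> ereal (b + c + s * \<gamma>)"
    and "(a - ereal b - ereal c) / ereal s < ereal \<gamma> \<longleftrightarrow> a < ereal (b + c + s * \<gamma>)"
  using assms by (cases a; auto simp: field_simps)+

lemma ereal_quot1_le_iff:
  assumes "s > 0"
  shows "(a - ereal b) / ereal s \<le> ereal \<gamma> \<longleftrightarrow> a \<le> ereal (b + s * \<gamma>)"
  using assms by (cases a; auto simp: field_simps)

section \<open>Lower semicontinuity, convexity and subgradients of extended-real functions\<close>

lemma lsc_seq_le: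
  assumes "lsc g" and x: "xk \<longlonglongrightarrow> x" and le: "\<And>k. g (xk k) \<le> ereal (c k)" and c: "c \<longlonglongrightarrow> c0"
  shows "g x \<le> ereal c0"
proof (rule ccontr)
  assume "\<not> ?thesis"
  then have "ereal c0 < g x" by simp
  then obtain r where r: "c0 < r" "ereal r < g x"
    by (metis ereal_dense2 less_ereal.simps(1))
  have "ereal r < Liminf (at x) g"
    using r(2) assms(1) unfolding lsc_def by (metis less_le_trans)
  \<comment> \<open>\<open>lsc\<close> speaks of the punctured filter \<open>at x\<close>; the point
    \<open>x\<close> itself is covered by \<open>ereal r < g x\<close>.\<close>
  from less_LiminfD[OF this] have "eventually (\<lambda>z. ereal r < g z) (nhds x)"
    using r(2) by (auto simp: eventually_at_filter elim: eventually_mono)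
  then have "eventually (\<lambda>k. ereal r < g (xk k)) sequentially"
    using x by (rule eventually_compose_filterlim)
  moreover have "eventually (\<lambda>k. c k < r) sequentially"
    using order_tendstoD(2)[OF c r(1)] .
  ultimately have "eventually (\<lambda>k::nat. False) sequentially"
  proof eventually_elim
    case (elim k)
    then show ?case using le[of k] by (metis less_ereal.simps(1) less_le_trans not_less_iff_gr_or_eq)
  qed
  then show False by auto
qed

lemma econvexD:
  assumes "econvex g" "g a \<le> ereal \<alpha>" "g b \<le> ereal \<beta>" "0 \<le> u" "u \<le> 1"
  shows "g ((1 - u) *\<^sub>R a + u *\<^sub>R b) \<le> ereal ((1 - u) * \<alpha> + u * \<beta>)"
proof -
  have "(1 - u) *\<^sub>R (a, \<alpha>) + u *\<^sub>R (b, \<beta>) \<in> {(y, t::real). g y \<le> ereal t}"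
    using assms unfolding econvex_def by (intro convexD_alt) auto
  then show ?thesis by simp
qed

lemma subdiffE:
  assumes "\<mu> \<in> subdiff g y"
  obtains gy where "g y = ereal gy" "\<And>z. ereal (gy + \<mu> \<bullet> (z - y)) \<le> g z"
  using assms unfolding subdiff_def by (cases "g y") auto

lemma subdiffI:
  assumes "g y = ereal gy" "\<And>z r. g z \<le> ereal r \<Longrightarrow> gy + \<mu> \<bullet> (z - y) \<le> r" "\<And>z. g z \<noteq> -\<infinity>"
  shows "\<mu> \<in> subdiff g y"
  unfolding subdiff_def
proof (intro CollectI conjI allI)
  fix z show "g y + ereal (\<mu> \<bullet> (z - y)) \<le> g z"
    using assms(1) assms(2)[of z] assms(3)[of z] by (cases "g z") auto
qed (use assms in auto)

lemma subdiff_monotone: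
  assumes "\<mu> \<in> subdiff g y" "\<mu>' \<in> subdiff g y'"
  shows "(\<mu>' - \<mu>) \<bullet> (y' - y) \<ge> 0"
proof -
  obtain a where a: "g y = ereal a" "\<And>z. ereal (a + \<mu> \<bullet> (z - y)) \<le> g z"
    by (rule subdiffE[OF assms(1)]) blast
  obtain b where b: "g y' = ereal b" "\<And>z. ereal (b + \<mu>' \<bullet> (z - y')) \<le> g z"
    by (rule subdiffE[OF assms(2)]) blast
  have "a + \<mu> \<bullet> (y' - y) \<le> b" "b + \<mu>' \<bullet> (y - y') \<le> a"
    using a(2)[of y'] b(2)[of y] a(1) b(1) by auto
  then show ?thesis by (simp add: inner_diff_left inner_diff_right)
qed

section \<open>Second subderivatives and twice epi-differentiability\<close>

lemma subderiv_ge: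
  assumes "\<mu> \<in> subdiff g y"
  shows "ereal (\<mu> \<bullet> d) \<le> subderiv g y d"
proof (rule ccontr)
  assume "\<not> ?thesis"
  then have "subderiv g y d < ereal (\<mu> \<bullet> d)" by simp
  then obtain r where r: "subderiv g y d < ereal r" "r < \<mu> \<bullet> d"
    by (metis ereal_dense2 less_ereal.simps(1))
  obtain t dk where t: "\<And>k. t k > 0" "dk \<longlonglongrightarrow> d"
    and lt: "\<And>k. (g (y + t k *\<^sub>R dk k) - g y) / ereal (t k) < ereal r"
    using Liminf_less_seq[OF r(1)[unfolded subderiv_def]] by auto
  obtain gy where gy: "g y = ereal gy" "\<And>z. ereal (gy + \<mu> \<bullet> (z - y)) \<le> g z"
    by (rule subdiffE[OF assms]) blast
  have "\<mu> \<bullet> dk k \<le> r" for k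
  proof -
    have "g (y + t k *\<^sub>R dk k) \<le> ereal (gy + t k * r)"
      using lt[of k] ereal_quot1_le_iff[OF t(1)] gy(1) less_imp_le by metis
    from order_trans[OF gy(2) this] have "t k * (\<mu> \<bullet> dk k) \<le> t k * r" by simp
    then show ?thesis using t(1) by simp
  qed
  moreover have "(\<lambda>k. \<mu> \<bullet> dk k) \<longlonglongrightarrow> \<mu> \<bullet> d" by (intro tendsto_intros t)
  ultimately have "\<mu> \<bullet> d \<le> r" using LIMSEQ_le_const2 by blast
  then show False using r by simp
qed

lemma subderiv2_less_seq:
  assumes gy: "g y = ereal gy" and "subderiv2 g y \<mu> d < ereal \<gamma>"
  shows "\<exists>t dk. (\<forall>k. t k > 0) \<and> t \<longlonglongrightarrow> 0 \<and> dk \<longlonglongrightarrow> d \<and>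
    (\<forall>k. g (y + t k *\<^sub>R dk k) < ereal (gy + t k * (\<mu> \<bullet> dk k) + (t k)\<^sup>2 / 2 * \<gamma>))"
proof -
  obtain t dk where t: "\<And>k. t k > 0" "t \<longlonglongrightarrow> 0" "dk \<longlonglongrightarrow> d"
    and lt: "\<And>k. (g (y + t k *\<^sub>R dk k) - g y - ereal (t k * (\<mu> \<bullet> dk k))) / ereal ((t k)\<^sup>2 / 2) < ereal \<gamma>"
    using Liminf_less_seq[OF assms(2)[unfolded subderiv2_def]] by auto
  have "g (y + t k *\<^sub>R dk k) < ereal (gy + t k * (\<mu> \<bullet> dk k) + (t k)\<^sup>2 / 2 * \<gamma>)" for k
    using lt[of k] ereal_quot_le_iff(2)[of "(t k)\<^sup>2 / 2"] t(1)[of k] gy by simp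
  then show ?thesis using t by blast
qed

lemma subderiv2_le_seq:
  assumes gy: "g y = ereal gy" and t: "\<And>k. t k > 0" "t \<longlonglongrightarrow> 0" and dk: "dk \<longlonglongrightarrow> d"
    and le: "eventually (\<lambda>k. g (y + t k *\<^sub>R dk k) \<le> ereal (gy + t k * (\<mu> \<bullet> dk k) + (t k)\<^sup>2 / 2 * c k)) sequentially"
    and c: "c \<longlonglongrightarrow> c0"
  shows "subderiv2 g y \<mu> d \<le> ereal c0"
  unfolding subderiv2_def
proof (rule Liminf_le_seq[OF t dk _ c])
  show "\<forall>\<^sub>F k in sequentially. (case (t k, dk k) of (t, d') \<Rightarrow>
      (g (y + t *\<^sub>R d') - g y - ereal (t * (\<mu> \<bullet> d'))) / ereal (t\<^sup>2 / 2)) \<le> ereal (c k)"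
    using le
  proof eventually_elim
    case (elim k)
    then show ?case
      using ereal_quot_le_iff(1)[of "(t k)\<^sup>2 / 2"] t(1)[of k] gy by simp
  qed
qed

lemma subderiv2_nonneg:
  assumes "\<mu> \<in> subdiff g y"
  shows "0 \<le> subderiv2 g y \<mu> d"
proof (rule ccontr)
  assume "\<not> ?thesis"
  then have "subderiv2 g y \<mu> d < 0" by simp
  then have lt: "subderiv2 g y \<mu> d < ereal 0" by (simp add: zero_ereal_def)
  obtain gy where gy: "g y = ereal gy" "\<And>z. ereal (gy + \<mu> \<bullet> (z - y)) \<le> g z"
    by (rule subdiffE[OF assms]) blast
  obtain t :: "nat \<Rightarrow> real" and dk
    where t: "\<And>k. g (y + t k *\<^sub>R dk k) < ereal (gy + t k * (\<mu> \<bullet> dk k) + (t k)\<^sup>2 / 2 * 0)"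
    using subderiv2_less_seq[of g, OF gy(1) lt] by blast
  show False using le_less_trans[OF gy(2) t(1)[of 0]] by simp
qed

text \<open>A second-order quotient below \<gamma> keeps the first-order quotient below
  \<open>\<mu> \<bullet> dk k + t k / 2 * \<gamma>\<close>, whose last term vanishes. Such a
  direction is therefore critical, which is the condition under which parabolic
  epi-differentiability is assumed.\<close>

lemma subderiv2_finite_imp_subderiv:
  assumes "\<mu> \<in> subdiff g y" "subderiv2 g y \<mu> d < \<infinity>"
  shows "subderiv g y d = ereal (\<mu> \<bullet> d)"
proof (rule antisym)
  obtain gy where gy: "g y = ereal gy" "\<And>z. ereal (gy + \<mu> \<bullet> (z - y)) \<le> g z"
    by (rule subdiffE[OF assms(1)]) blast
  obtain \<gamma> where "subderiv2 g y \<mu> d < ereal \<gamma>"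
    using assms(2) ereal_dense2 by blast
  then obtain t dk where t: "\<And>k. t k > 0" "t \<longlonglongrightarrow> 0" "dk \<longlonglongrightarrow> d"
    and lt: "\<And>k. g (y + t k *\<^sub>R dk k) < ereal (gy + t k * (\<mu> \<bullet> dk k) + (t k)\<^sup>2 / 2 * \<gamma>)"
    using subderiv2_less_seq[of g, OF gy(1)] by blast
  show "subderiv g y d \<le> ereal (\<mu> \<bullet> d)"
    unfolding subderiv_def
  proof (rule Liminf_le_seq[OF t])
    have "(\<lambda>k. \<mu> \<bullet> dk k + t k / 2 * \<gamma>) \<longlonglongrightarrow> \<mu> \<bullet> d + 0 / 2 * \<gamma>"
      by (intro tendsto_intros t) simp
    then show "(\<lambda>k. \<mu> \<bullet> dk k + t k / 2 * \<gamma>) \<longlonglongrightarrow> \<mu> \<bullet> d" by simp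
    show "\<forall>\<^sub>F k in sequentially. (case (t k, dk k) of (t, d') \<Rightarrow> (g (y + t *\<^sub>R d') - g y) / ereal t)
        \<le> ereal (\<mu> \<bullet> dk k + t k / 2 * \<gamma>)"
    proof (intro always_eventually allI)
      fix k
      have "g (y + t k *\<^sub>R dk k) \<le> ereal (gy + t k * (\<mu> \<bullet> dk k + t k / 2 * \<gamma>))"
        using less_imp_le[OF lt[of k]] by (simp add: algebra_simps power2_eq_square)
      then show "(case (t k, dk k) of (t, d') \<Rightarrow> (g (y + t *\<^sub>R d') - g y) / ereal t)
          \<le> ereal (\<mu> \<bullet> dk k + t k / 2 * \<gamma>)"
        using ereal_quot1_le_iff[OF t(1)[of k]] gy(1) by simp
    qed
  qed
qed (rule subderiv_ge[OF assms(1)])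

lemma parab_quot_le_iff:
  assumes "g y = ereal gy" "subderiv g y d = ereal D" "t > 0"
  shows "parab_quot g y d t w \<le> ereal \<gamma> \<longleftrightarrow>
      g (y + t *\<^sub>R d + (t\<^sup>2 / 2) *\<^sub>R w) \<le> ereal (gy + t * D + t\<^sup>2 / 2 * \<gamma>)"
    and "parab_quot g y d t w < ereal \<gamma> \<longleftrightarrow>
      g (y + t *\<^sub>R d + (t\<^sup>2 / 2) *\<^sub>R w) < ereal (gy + t * D + t\<^sup>2 / 2 * \<gamma>)"
  unfolding parab_quot_def using assms ereal_quot_le_iff[of "t\<^sup>2 / 2"] by simp_all

text \<open>This is twice epi-differentiability. The recovery points are \<open>a + \<onehalf> t w\<close>, with \<open>w\<close> almost optimal
  in the infimum of parabolic regularity.\<close>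
lemma twice_epi_recovery:
  assumes mu: "\<mu> \<in> subdiff g y" and gy: "g y = ereal gy" and reg: "parab_regular g y \<mu>"
    and epi: "\<And>d. subderiv g y d = ereal (\<mu> \<bullet> d) \<Longrightarrow> parab_epi_diff g y d"
    and a: "subderiv2 g y \<mu> a < ereal \<gamma>" and t: "\<And>k. t k > 0" "t \<longlonglongrightarrow> 0"
  shows "\<exists>c. c \<longlonglongrightarrow> a \<and> (\<forall>\<^sub>F k in sequentially.
      g (y + t k *\<^sub>R c k) \<le> ereal (gy + t k * (\<mu> \<bullet> c k) + (t k)\<^sup>2 / 2 * \<gamma>))"
proof -
  have fin: "subderiv2 g y \<mu> a < \<infinity>" using a by (rule less_trans) simp
  have sd: "subderiv g y a = ereal (\<mu> \<bullet> a)" using subderiv2_finite_imp_subderiv[OF mu fin] .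
  have "(INF w. parab_subderiv g y a w - ereal (\<mu> \<bullet> w)) < ereal \<gamma>"
    using reg fin a unfolding parab_regular_def by auto
  then obtain w where w: "parab_subderiv g y a w - ereal (\<mu> \<bullet> w) < ereal \<gamma>"
    by (auto simp: INF_less_iff)
  then have "parab_subderiv g y a w < ereal (\<gamma> + \<mu> \<bullet> w)"
    by (cases "parab_subderiv g y a w") auto
  then obtain r where r: "parab_subderiv g y a w < ereal r" "r < \<gamma> + \<mu> \<bullet> w"
    by (metis ereal_dense2 less_ereal.simps(1))
  obtain wk where wk: "wk \<longlonglongrightarrow> w"
      "(\<lambda>k. parab_quot g y a (t k) (wk k)) \<longlonglongrightarrow> parab_subderiv g y a w"
    using epi[OF sd] t unfolding parab_epi_diff_def by blast
  define c where "c k = a + (t k / 2) *\<^sub>R wk k" for k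
  have "c \<longlonglongrightarrow> a + (0 / 2) *\<^sub>R w" unfolding c_def by (intro tendsto_intros t wk) simp
  then have "c \<longlonglongrightarrow> a" by simp
  have "\<forall>\<^sub>F k in sequentially. parab_quot g y a (t k) (wk k) < ereal r"
    using order_tendstoD(2)[OF wk(2) r(1)] .
  moreover have "(\<lambda>k. \<gamma> + \<mu> \<bullet> wk k) \<longlonglongrightarrow> \<gamma> + \<mu> \<bullet> w" by (intro tendsto_intros wk)
  then have "\<forall>\<^sub>F k in sequentially. r < \<gamma> + \<mu> \<bullet> wk k"
    using order_tendstoD(1) r(2) by blast
  ultimately have "\<forall>\<^sub>F k in sequentially.
      g (y + t k *\<^sub>R c k) \<le> ereal (gy + t k * (\<mu> \<bullet> c k) + (t k)\<^sup>2 / 2 * \<gamma>)"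
  proof eventually_elim
    case (elim k)
    have "y + t k *\<^sub>R c k = y + t k *\<^sub>R a + ((t k)\<^sup>2 / 2) *\<^sub>R wk k"
      by (simp add: c_def algebra_simps power2_eq_square)
    then have "g (y + t k *\<^sub>R c k) \<le> ereal (gy + t k * (\<mu> \<bullet> a) + (t k)\<^sup>2 / 2 * r)"
      using elim(1) parab_quot_le_iff(2)[OF gy sd t(1)] by (simp add: less_imp_le add.assoc)
    also have "\<dots> \<le> ereal (gy + t k * (\<mu> \<bullet> a) + (t k)\<^sup>2 / 2 * (\<gamma> + \<mu> \<bullet> wk k))"
      using elim(2) by (simp add: mult_left_mono)
    also have "\<dots> = ereal (gy + t k * (\<mu> \<bullet> c k) + (t k)\<^sup>2 / 2 * \<gamma>)"
      by (simp add: c_def algebra_simps inner_add_right power2_eq_square)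
    finally show ?case .
  qed
  then show ?thesis using \<open>c \<longlonglongrightarrow> a\<close> by blast
qed

section \<open>Regular normals to the graph of the subdifferential\<close>

text \<open>The point \<open>y'\<close> is the minimizer of
  \<open>g + \<parallel>\<cdot> - p\<parallel>\<^sup>2 / (2\<rho>)\<close>.\<close>
lemma resolvent_exists:
  fixes g :: "'a::euclidean_space \<Rightarrow> ereal"
  assumes lsc: "lsc g" and ppr: "proper g" and conv: "econvex g"
    and mu: "\<mu> \<in> subdiff g y" and lam: "\<rho> > 0"
  shows "\<exists>y' \<mu>'. \<mu>' \<in> subdiff g y' \<and> y' + \<rho> *\<^sub>R \<mu>' = p"
proof -
  obtain gy where gy: "g y = ereal gy" "\<And>z. ereal (gy + \<mu> \<bullet> (z - y)) \<le> g z"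
    by (rule subdiffE[OF mu]) blast
  define q where "q z = (norm (z - p))\<^sup>2 / (2 * \<rho>)" for z
  define S where "S = {r + q z | r z. g z \<le> ereal r}"
  \<comment> \<open>Half of the penalty absorbs the linear term of the affine minorant by completing
    a square; \<open>K\<close> is the constant left over. The other half of the penalty keeps
    minimizing sequences bounded.\<close>
  define K where "K = gy + \<mu> \<bullet> (p - y) - \<rho> * (norm \<mu>)\<^sup>2"
  have low: "K + (norm (z - p))\<^sup>2 / (4 * \<rho>) \<le> r + q z" if "g z \<le> ereal r" for r z
  proof -
    have "gy + \<mu> \<bullet> (z - y) \<le> r" using order_trans[OF gy(2) that] by simp
    moreover have "\<mu> \<bullet> (z - y) = \<mu> \<bullet> (p - y) + \<mu> \<bullet> (z - p)" by (simp add: inner_diff_right)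
    moreover have "- (\<mu> \<bullet> (z - p)) \<le> \<rho> * (norm \<mu>)\<^sup>2 + (norm (z - p))\<^sup>2 / (4 * \<rho>)"
    proof -
      have "0 \<le> (norm ((2 * \<rho>) *\<^sub>R \<mu> + (z - p)))\<^sup>2 / (4 * \<rho>)" using lam by simp
      also have "\<dots> = \<rho> * (norm \<mu>)\<^sup>2 + \<mu> \<bullet> (z - p) + (norm (z - p))\<^sup>2 / (4 * \<rho>)"
      proof -
        have "(norm ((2 * \<rho>) *\<^sub>R \<mu> + (z - p)))\<^sup>2 =
            4 * \<rho>\<^sup>2 * (norm \<mu>)\<^sup>2 + 4 * \<rho> * (\<mu> \<bullet> (z - p)) + (norm (z - p))\<^sup>2"
          unfolding power2_norm_eq_inner
          by (simp only: inner_add_left inner_add_right inner_scaleR_left inner_scaleR_right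
              inner_commute[of "z - p" \<mu>] power2_eq_square) (simp add: algebra_simps)
        then show ?thesis using lam by (simp add: field_simps power2_eq_square)
      qed
      finally show ?thesis by simp
    qed
    moreover have "q z = (norm (z - p))\<^sup>2 / (4 * \<rho>) + (norm (z - p))\<^sup>2 / (4 * \<rho>)"
      using lam by (simp add: q_def field_simps)
    ultimately show ?thesis unfolding K_def by linarith
  qed
  have bdd: "bdd_below S"
  proof (rule bdd_belowI[of _ K])
    fix s assume "s \<in> S"
    then obtain r z where "s = r + q z" "g z \<le> ereal r" unfolding S_def by auto
    moreover have "0 \<le> (norm (z - p))\<^sup>2 / (4 * \<rho>)" using lam by simp
    ultimately show "K \<le> s" using low by fastforce
  qed
  have ne: "S \<noteq> {}" unfolding S_def using gy(1) by (auto intro!: exI[of _ gy] exI[of _ y])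
  define m where "m = Inf S"
  have mle: "m \<le> r + q z" if "g z \<le> ereal r" for r z
    unfolding m_def by (rule cInf_lower[OF _ bdd]) (use that in \<open>auto simp: S_def\<close>)
  have "\<exists>r z. g z \<le> ereal r \<and> r + q z < m + 1 / real (Suc k)" for k
  proof -
    have "Inf S < m + 1 / real (Suc k)" unfolding m_def by simp
    then show ?thesis using cInf_lessD[OF ne] unfolding S_def by fastforce
  qed
  then obtain r z where rz: "\<And>k. g (z k) \<le> ereal (r k)" "\<And>k. r k + q (z k) < m + 1 / real (Suc k)"
    by metis
  have "norm (z k - p) \<le> sqrt (4 * \<rho> * (m + 1 - K))" for k
  proof (rule real_le_rsqrt)
    have "1 / real (Suc k) \<le> 1" by simp
    then have "K + (norm (z k - p))\<^sup>2 / (4 * \<rho>) \<le> m + 1" using low[OF rz(1)[of k]] rz(2)[of k] by linarith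
    then show "(norm (z k - p))\<^sup>2 \<le> 4 * \<rho> * (m + 1 - K)" using lam by (simp add: field_simps)
  qed
  then have "range z \<subseteq> cball p (sqrt (4 * \<rho> * (m + 1 - K)))"
    by (auto simp: dist_norm norm_minus_commute)
  then have "bounded (range z)" using bounded_subset bounded_cball by blast
  then obtain l \<phi> where \<phi>: "strict_mono (\<phi> :: nat \<Rightarrow> nat)" "(z \<circ> \<phi>) \<longlonglongrightarrow> l"
    using bounded_imp_convergent_subsequence by blast
  have lim: "(\<lambda>k. 1 / real (Suc k)) \<longlonglongrightarrow> 0"
    using LIMSEQ_inverse_real_of_nat by (simp add: inverse_eq_divide)
  have "g l \<le> ereal (m + 0 - q l)"
  proof (rule lsc_seq_le[OF lsc \<phi>(2)])
    show "(\<lambda>k. m + 1 / real (Suc (\<phi> k)) - q ((z \<circ> \<phi>) k)) \<longlonglongrightarrow> m + 0 - q l"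
      unfolding q_def using LIMSEQ_subseq_LIMSEQ[OF lim \<phi>(1)] lam
      by (intro tendsto_intros \<phi>(2)) (auto simp: o_def)
    fix k
    have "ereal (r (\<phi> k)) \<le> ereal (m + 1 / real (Suc (\<phi> k)) - q ((z \<circ> \<phi>) k))"
      using rz(2)[of "\<phi> k"] by simp
    then show "g ((z \<circ> \<phi>) k) \<le> ereal (m + 1 / real (Suc (\<phi> k)) - q ((z \<circ> \<phi>) k))"
      using rz(1)[of "\<phi> k"] order_trans by fastforce
  qed
  then have gl_le: "g l \<le> ereal (m - q l)" by simp
  have nm: "\<And>z. g z \<noteq> -\<infinity>" using ppr by (auto simp: proper_def)
  obtain gl where gl: "g l = ereal gl" using gl_le nm[of l] by (cases "g l") auto
  have glm: "gl + q l \<le> m" using gl_le gl by simp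
  define \<nu> where "\<nu> = (1 / \<rho>) *\<^sub>R (p - l)"
  have "\<nu> \<in> subdiff g l"
  proof (rule subdiffI[of g, OF gl _ nm])
    fix x s assume xs: "g x \<le> ereal s"
    \<comment> \<open>Optimality of \<open>l\<close> is tested at points of the segment towards
      \<open>x\<close>. Convexity makes the gain linear in \<open>u\<close> while the error is
      quadratic, so after division by \<open>u\<close> the error vanishes as \<open>u\<close> tends
      to 0.\<close>
    have ineq: "\<nu> \<bullet> (x - l) - (s - gl) \<le> u * ((norm (x - l))\<^sup>2 / (2 * \<rho>))" if u: "0 < u" "u \<le> 1" for u
    proof -
      have "g ((1 - u) *\<^sub>R l + u *\<^sub>R x) \<le> ereal ((1 - u) * gl + u * s)"
        using econvexD[OF conv _ xs, of l gl u] gl u by simp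
      from mle[OF this] glm have "gl + q l \<le> (1 - u) * gl + u * s + q ((1 - u) *\<^sub>R l + u *\<^sub>R x)"
        by linarith
      moreover have "q ((1 - u) *\<^sub>R l + u *\<^sub>R x) = q l - u * (\<nu> \<bullet> (x - l)) + u * (u * ((norm (x - l))\<^sup>2 / (2 * \<rho>)))"
      proof -
        have e: "(1 - u) *\<^sub>R l + u *\<^sub>R x - p = (l - p) + u *\<^sub>R (x - l)" by (simp add: algebra_simps)
        have n: "(norm ((l - p) + u *\<^sub>R (x - l)))\<^sup>2 = (norm (l - p))\<^sup>2 + 2 * u * ((l - p) \<bullet> (x - l)) + u\<^sup>2 * (norm (x - l))\<^sup>2"
          unfolding power2_norm_eq_inner
          by (simp only: inner_add_left inner_add_right inner_scaleR_left inner_scaleR_right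
              inner_commute[of "x - l" "l - p"] power2_eq_square) (simp add: algebra_simps)
        have v: "(l - p) \<bullet> (x - l) = - (\<rho> * (\<nu> \<bullet> (x - l)))"
          unfolding \<nu>_def using lam by (simp add: inner_diff_left)
        show ?thesis unfolding q_def e n v using lam by (simp add: field_simps power2_eq_square)
      qed
      ultimately have "u * (\<nu> \<bullet> (x - l) - (s - gl)) \<le> u * (u * ((norm (x - l))\<^sup>2 / (2 * \<rho>)))"
        by (simp add: algebra_simps)
      then show ?thesis using u(1) mult_le_cancel_left_pos by blast
    qed
    have "((\<lambda>u. u * ((norm (x - l))\<^sup>2 / (2 * \<rho>))) \<longlongrightarrow> 0 * ((norm (x - l))\<^sup>2 / (2 * \<rho>))) (at_right 0)"
      by (intro tendsto_intros)
    then have "((\<lambda>u. u * ((norm (x - l))\<^sup>2 / (2 * \<rho>))) \<longlongrightarrow> 0) (at_right 0)" by simp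
    moreover have "\<forall>\<^sub>F u in at_right 0. \<nu> \<bullet> (x - l) - (s - gl) \<le> u * ((norm (x - l))\<^sup>2 / (2 * \<rho>))"
      unfolding eventually_at_right_field using ineq by (intro exI[of _ 1]) auto
    ultimately have "\<nu> \<bullet> (x - l) - (s - gl) \<le> 0"
      by (rule tendsto_lowerbound) simp
    then show "gl + \<nu> \<bullet> (x - l) \<le> s" by simp
  qed
  moreover have "l + \<rho> *\<^sub>R \<nu> = p" unfolding \<nu>_def using lam by simp
  ultimately show ?thesis by blast
qed

text \<open>The pair \<open>(a, b)\<close> is a limit of difference quotients of the graph of \<open>\<partial>g\<close>, taken along the
  resolvent with parameter \<open>\<rho>\<close>. Twice epi-differentiability makes \<open>2 b\<close> a subgradient at \<open>a\<close> of the
  second subderivative along the ray through \<open>a\<close>, and degree-two homogeneity then yields the bound.\<close>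
lemma resolvent_limit_direction:
  fixes g :: "'a::euclidean_space \<Rightarrow> ereal"
  assumes lsc: "lsc g" and ppr: "proper g" and conv: "econvex g"
    and mu: "\<mu> \<in> subdiff g y" and reg: "parab_regular g y \<mu>"
    and epi: "\<And>d. subderiv g y d = ereal (\<mu> \<bullet> d) \<Longrightarrow> parab_epi_diff g y d"
    and N: "(z, - u) \<in> frechet_normal (gph_subdiff g) (y, \<mu>)"
    and rho: "\<rho> > 0"
  shows "\<exists>a b. a + \<rho> *\<^sub>R b = - u \<and> z \<bullet> a \<le> u \<bullet> b \<and> norm a \<le> norm u \<and> subderiv2 g y \<mu> a \<le> ereal (a \<bullet> b)"
proof -
  obtain gy where gy: "g y = ereal gy" "\<And>z. ereal (gy + \<mu> \<bullet> (z - y)) \<le> g z"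
    by (rule subdiffE[OF mu]) blast
  define t where "t k = 1 / real (Suc k)" for k
  have t: "\<And>k. t k > 0" "t \<longlonglongrightarrow> 0"
    unfolding t_def using LIMSEQ_inverse_real_of_nat by (auto simp: inverse_eq_divide)
  have "\<exists>a b. \<mu> + t k *\<^sub>R b \<in> subdiff g (y + t k *\<^sub>R a) \<and> a + \<rho> *\<^sub>R b = - u" for k
  proof -
    \<comment> \<open>The resolvent recovers \<open>(y, \<mu>)\<close> from
      \<open>y + \<rho> *\<^sub>R \<mu>\<close>. Shifting this point by exactly
      \<open>- t k *\<^sub>R u\<close> makes the difference quotients satisfy
      \<open>a + \<rho> *\<^sub>R b = - u\<close> for every \<open>k\<close>, not just in the
      limit.\<close>
    obtain y' \<mu>' where *: "\<mu>' \<in> subdiff g y'" "y' + \<rho> *\<^sub>R \<mu>' = y - t k *\<^sub>R u + \<rho> *\<^sub>R \<mu>"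
      using resolvent_exists[OF lsc ppr conv mu rho] by blast
    define a where "a = (1 / t k) *\<^sub>R (y' - y)"
    define b where "b = (1 / t k) *\<^sub>R (\<mu>' - \<mu>)"
    have ab: "t k *\<^sub>R a = y' - y" "t k *\<^sub>R b = \<mu>' - \<mu>" using t(1)[of k] by (auto simp: a_def b_def)
    have "t k *\<^sub>R (a + \<rho> *\<^sub>R b) = (t k *\<^sub>R a) + \<rho> *\<^sub>R (t k *\<^sub>R b)" by (simp add: algebra_simps)
    also have "\<dots> = (y' + \<rho> *\<^sub>R \<mu>') - y - \<rho> *\<^sub>R \<mu>" unfolding ab by (simp add: algebra_simps)
    also have "\<dots> = t k *\<^sub>R (- u)" unfolding *(2) by simp
    finally have "a + \<rho> *\<^sub>R b = - u" using t(1)[of k] by (metis less_irrefl scaleR_left_imp_eq)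
    then show ?thesis using *(1) ab by (intro exI[of _ a] exI[of _ b]) simp
  qed
  then obtain a b where ab: "\<And>k. \<mu> + t k *\<^sub>R b k \<in> subdiff g (y + t k *\<^sub>R a k)"
      "\<And>k. a k + \<rho> *\<^sub>R b k = - u" by metis
  have mono: "a k \<bullet> b k \<ge> 0" for k
  proof -
    have "(\<mu> + t k *\<^sub>R b k - \<mu>) \<bullet> (y + t k *\<^sub>R a k - y) \<ge> 0" by (rule subdiff_monotone[OF mu ab(1)])
    then have "(t k * t k) * (a k \<bullet> b k) \<ge> 0" by (simp add: inner_commute ac_simps)
    moreover have "t k * t k > 0" using t(1)[of k] by simp
    ultimately show ?thesis using zero_le_mult_iff not_less by (metis less_le_not_le)
  qed
  \<comment> \<open>In the expansion of the squared norm of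
    \<open>a k + \<rho> *\<^sub>R b k\<close> the cross term is nonnegative by monotonicity. This is
    nonexpansiveness of the resolvent; since \<open>b k\<close> is determined by \<open>a k\<close>,
    both have a common convergent subsequence.\<close>
  have na: "norm (a k) \<le> norm u" for k
  proof -
    have "(norm u)\<^sup>2 = (norm (a k + \<rho> *\<^sub>R b k))\<^sup>2" by (simp add: ab(2))
    also have "\<dots> = (norm (a k))\<^sup>2 + 2 * \<rho> * (a k \<bullet> b k) + \<rho>\<^sup>2 * (norm (b k))\<^sup>2"
      unfolding power2_norm_eq_inner
      by (simp only: inner_add_left inner_add_right inner_scaleR_left inner_scaleR_right
              inner_commute[of "b k" "a k"] power2_eq_square) (simp add: algebra_simps)
    finally have "(norm (a k))\<^sup>2 \<le> (norm u)\<^sup>2" using mono[of k] rho by simp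
    then show ?thesis by (simp add: abs_le_square_iff[symmetric])
  qed
  have "bounded (range a)" using na by (intro boundedI[of _ "norm u"]) auto
  then obtain a0 \<phi> where \<phi>: "strict_mono (\<phi> :: nat \<Rightarrow> nat)" "(a \<circ> \<phi>) \<longlonglongrightarrow> a0"
    using bounded_imp_convergent_subsequence by blast
  define b0 where "b0 = (1 / \<rho>) *\<^sub>R (- u - a0)"
  define t' where "t' = t \<circ> \<phi>"
  have t': "\<And>k. t' k > 0" "t' \<longlonglongrightarrow> 0"
    using t(1) LIMSEQ_subseq_LIMSEQ[OF t(2) \<phi>(1)] by (auto simp: t'_def)
  define a' where "a' = a \<circ> \<phi>"
  define b' where "b' = b \<circ> \<phi>"
  have a': "a' \<longlonglongrightarrow> a0" using \<phi>(2) by (simp add: a'_def)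
  have ab': "\<And>k. \<mu> + t' k *\<^sub>R b' k \<in> subdiff g (y + t' k *\<^sub>R a' k)" "\<And>k. a' k + \<rho> *\<^sub>R b' k = - u"
    using ab by (auto simp: a'_def b'_def t'_def)
  have b'eq: "b' k = (1 / \<rho>) *\<^sub>R (- u - a' k)" for k
    unfolding ab'(2)[of k, symmetric] using rho by simp
  have b': "b' \<longlonglongrightarrow> b0"
    unfolding b'eq[abs_def] b0_def by (intro tendsto_intros a')
  have sub: "gl \<ge> ga + (\<mu> + t' k *\<^sub>R b' k) \<bullet> (c - (y + t' k *\<^sub>R a' k))"
    if "g (y + t' k *\<^sub>R a' k) = ereal ga" "g c \<le> ereal gl" for k ga gl c
  proof -
    obtain s where s: "g (y + t' k *\<^sub>R a' k) = ereal s"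
        "\<And>z. ereal (s + (\<mu> + t' k *\<^sub>R b' k) \<bullet> (z - (y + t' k *\<^sub>R a' k))) \<le> g z"
      by (rule subdiffE[OF ab'(1)[of k]]) blast
    show ?thesis using order_trans[OF s(2) that(2)] that(1) s(1) by simp
  qed
  have "\<exists>h. g (y + t' k *\<^sub>R a' k) = ereal h" for k
    by (rule subdiffE[OF ab'(1)[of k]]) blast
  then obtain h where h: "\<And>k. g (y + t' k *\<^sub>R a' k) = ereal (h k)" by metis
  \<comment> \<open>The displacement in the graph is \<open>t' k\<close> times a vector of norm at
    most \<open>B\<close>. With tolerance \<open>e / B\<close> in the definition of the regular
    normal, the factor \<open>t' k\<close> cancels and an error of at most \<open>e\<close>
    remains.\<close>
  have normal: "z \<bullet> a0 \<le> u \<bullet> b0"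
  proof (rule field_le_epsilon)
    fix e :: real assume "e > 0"
    have "bounded (range (\<lambda>k. (a' k, b' k)))"
      using convergent_imp_bounded[OF tendsto_Pair[OF a' b']] .
    then obtain B where B: "B > 0" "\<And>k. norm (a' k, b' k) \<le> B" by (auto simp: bounded_pos)
    have "e / B > 0" using \<open>e > 0\<close> B by simp
    then obtain \<delta> where \<delta>: "\<delta> > 0" "\<And>p'. p' \<in> gph_subdiff g \<Longrightarrow> norm (p' - (y, \<mu>)) < \<delta> \<Longrightarrow>
        (z, - u) \<bullet> (p' - (y, \<mu>)) \<le> e / B * norm (p' - (y, \<mu>))"
      using N unfolding frechet_normal_def by blast
    have "(\<lambda>k. t' k * B) \<longlonglongrightarrow> 0 * B" by (intro tendsto_intros t')
    then have "\<forall>\<^sub>F k in sequentially. t' k * B < \<delta>" using order_tendstoD(2) \<delta>(1) by fastforce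
    then have "\<forall>\<^sub>F k in sequentially. z \<bullet> a' k - u \<bullet> b' k \<le> e"
    proof eventually_elim
      case (elim k)
      let ?p = "(y + t' k *\<^sub>R a' k, \<mu> + t' k *\<^sub>R b' k)"
      have p: "?p - (y, \<mu>) = t' k *\<^sub>R (a' k, b' k)" by simp
      have np: "norm (?p - (y, \<mu>)) = t' k * norm (a' k, b' k)" unfolding p norm_scaleR using t'(1)[of k] by simp
      have "norm (?p - (y, \<mu>)) \<le> t' k * B" unfolding np using B(2)[of k] t'(1)[of k] by (intro mult_left_mono) auto
      then have lt: "norm (?p - (y, \<mu>)) < \<delta>" using elim by linarith
      have "?p \<in> gph_subdiff g" using ab'(1)[of k] by (simp add: gph_subdiff_def)
      from \<delta>(2)[OF this lt] have "(z, - u) \<bullet> (t' k *\<^sub>R (a' k, b' k)) \<le> e / B * (t' k * norm (a' k, b' k))"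
        unfolding np unfolding p .
      also have "\<dots> \<le> e / B * (t' k * B)"
        using B t'(1)[of k] \<open>e > 0\<close> by (intro mult_left_mono) auto
      also have "\<dots> = t' k * e" using B by simp
      finally have "t' k * (z \<bullet> a' k - u \<bullet> b' k) \<le> t' k * e" by (simp add: algebra_simps)
      then show ?case using t'(1)[of k] by simp
    qed
    moreover have "(\<lambda>k. z \<bullet> a' k - u \<bullet> b' k) \<longlonglongrightarrow> z \<bullet> a0 - u \<bullet> b0" by (intro tendsto_intros a' b')
    ultimately have "z \<bullet> a0 - u \<bullet> b0 \<le> e" using tendsto_upperbound sequentially_bot by blast
    then show "z \<bullet> a0 \<le> u \<bullet> b0 + e" by simp
  qed
  \<comment> \<open>The subgradient \<open>\<mu> + t' k *\<^sub>R b' k\<close> compares the value at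
    \<open>y + t' k *\<^sub>R a' k\<close> with that at any competitor
    \<open>y + t' k *\<^sub>R c k\<close>. Its part \<open>t' k *\<^sub>R b' k\<close> contributes
    at order \<open>(t' k)\<^sup>2\<close>, and dividing by half of that square produces the factor
    2.\<close>
  have key: "subderiv2 g y \<mu> a0 \<le> ereal (\<gamma> - 2 * (b0 \<bullet> (c0 - a0)))"
    if c: "c \<longlonglongrightarrow> c0" and le: "\<forall>\<^sub>F k in sequentially.
      g (y + t' k *\<^sub>R c k) \<le> ereal (gy + t' k * (\<mu> \<bullet> c k) + (t' k)\<^sup>2 / 2 * \<gamma>)" for c c0 \<gamma>
  proof (rule subderiv2_le_seq[of g, OF gy(1) t' a'])
    show "(\<lambda>k. \<gamma> - 2 * (b' k \<bullet> (c k - a' k))) \<longlonglongrightarrow> \<gamma> - 2 * (b0 \<bullet> (c0 - a0))"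
      by (intro tendsto_intros a' b' c)
    show "\<forall>\<^sub>F k in sequentially. g (y + t' k *\<^sub>R a' k)
       \<le> ereal (gy + t' k * (\<mu> \<bullet> a' k) + (t' k)\<^sup>2 / 2 * (\<gamma> - 2 * (b' k \<bullet> (c k - a' k))))"
      using le
    proof eventually_elim
      case (elim k)
      have "h k + (\<mu> + t' k *\<^sub>R b' k) \<bullet> (y + t' k *\<^sub>R c k - (y + t' k *\<^sub>R a' k))
          \<le> gy + t' k * (\<mu> \<bullet> c k) + (t' k)\<^sup>2 / 2 * \<gamma>"
        by (rule sub[OF h elim])
      then show ?case unfolding h
        by (simp add: inner_add_left inner_diff_right algebra_simps power2_eq_square)
    qed
  qed
  \<comment> \<open>The base point as competitor gives finiteness, but as a bound it is twice too
    large. The sharp bound comes from competitors near \<open>a0\<close> itself.\<close>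
  have "subderiv2 g y \<mu> a0 \<le> ereal (0 - 2 * (b0 \<bullet> (0 - a0)))"
    by (rule key[of "\<lambda>k. 0"]) (auto simp: gy(1))
  then have fin: "subderiv2 g y \<mu> a0 < \<infinity>" using le_less_trans by fastforce
  then obtain s where s: "subderiv2 g y \<mu> a0 = ereal s"
    using subderiv2_nonneg[OF mu, of a0] by (cases "subderiv2 g y \<mu> a0") auto
  \<comment> \<open>Competitors in direction \<open>r *\<^sub>R a0\<close>, recovered with steps
    \<open>r * t' k\<close>, have second-order value about \<open>r\<^sup>2 * s\<close>. Dividing by
    \<open>1 - r\<close> and letting \<open>r\<close> tend to 1 differentiates the inequality at
    \<open>a0\<close> and removes the excess factor.\<close>
  have ineq: "(1 + r) * s \<le> 2 * (a0 \<bullet> b0)" if r: "0 < r" "r < 1" for r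
  proof -
    have "s \<le> r\<^sup>2 * s - 2 * ((r - 1) * (a0 \<bullet> b0)) + e" if "e > 0" for e
    proof -
      \<comment> \<open>Recovery needs a level strictly above \<open>s\<close>; the excess becomes
        exactly \<open>e\<close> after multiplication by \<open>r\<^sup>2\<close>.\<close>
      define \<gamma> where "\<gamma> = s + e / r\<^sup>2"
      have lt: "subderiv2 g y \<mu> a0 < ereal \<gamma>" using \<open>e > 0\<close> r s by (simp add: \<gamma>_def)
      have rt: "\<And>k. r * t' k > 0" "(\<lambda>k. r * t' k) \<longlonglongrightarrow> 0"
        using r t' tendsto_mult_right_zero by auto
      obtain c where c: "c \<longlonglongrightarrow> a0" "\<forall>\<^sub>F k in sequentially.
          g (y + (r * t' k) *\<^sub>R c k) \<le> ereal (gy + (r * t' k) * (\<mu> \<bullet> c k) + (r * t' k)\<^sup>2 / 2 * \<gamma>)"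
        using twice_epi_recovery[of \<mu> g, OF mu gy(1) reg epi lt rt] by blast
      have "subderiv2 g y \<mu> a0 \<le> ereal (r\<^sup>2 * \<gamma> - 2 * (b0 \<bullet> (r *\<^sub>R a0 - a0)))"
      proof (rule key[of "\<lambda>k. r *\<^sub>R c k"])
        show "(\<lambda>k. r *\<^sub>R c k) \<longlonglongrightarrow> r *\<^sub>R a0" by (intro tendsto_intros c)
        show "\<forall>\<^sub>F k in sequentially. g (y + t' k *\<^sub>R (r *\<^sub>R c k))
           \<le> ereal (gy + t' k * (\<mu> \<bullet> r *\<^sub>R c k) + (t' k)\<^sup>2 / 2 * (r\<^sup>2 * \<gamma>))"
          using c(2) by eventually_elim (simp add: power_mult_distrib ac_simps)
      qed
      then have "s \<le> r\<^sup>2 * \<gamma> - 2 * (b0 \<bullet> (r *\<^sub>R a0 - a0))" using s by simp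
      also have "r\<^sup>2 * \<gamma> = r\<^sup>2 * s + e" unfolding \<gamma>_def using r by (simp add: field_simps)
      also have "b0 \<bullet> (r *\<^sub>R a0 - a0) = (r - 1) * (a0 \<bullet> b0)"
        by (simp add: inner_diff_right inner_commute algebra_simps)
      finally show ?thesis by simp
    qed
    then have "s \<le> r\<^sup>2 * s - 2 * ((r - 1) * (a0 \<bullet> b0))" by (rule field_le_epsilon)
    then have "(1 - r) * ((1 + r) * s) \<le> (1 - r) * (2 * (a0 \<bullet> b0))"
      by (simp add: algebra_simps power2_eq_square)
    then show ?thesis using r by simp
  qed
  have "((\<lambda>r. (1 + r) * s) \<longlongrightarrow> (1 + 1) * s) (at_left 1)" by (intro tendsto_intros)
  moreover have "\<forall>\<^sub>F r in at_left 1. (1 + r) * s \<le> 2 * (a0 \<bullet> b0)"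
    unfolding eventually_at_left_field using ineq by (intro exI[of _ 0]) auto
  ultimately have "(1 + 1) * s \<le> 2 * (a0 \<bullet> b0)"
    by (rule tendsto_upperbound) simp
  then have "subderiv2 g y \<mu> a0 \<le> ereal (a0 \<bullet> b0)" using s by simp
  moreover have "a0 + \<rho> *\<^sub>R b0 = - u" unfolding b0_def using rho by simp
  moreover have "norm a0 \<le> norm u"
    using tendsto_upperbound[OF tendsto_norm[OF a'], of "norm u"] na by (auto simp: a'_def)
  ultimately show ?thesis using normal by blast
qed

text \<open>For fixed \<open>\<rho>\<close> the limit direction \<open>a\<close> only satisfies
  \<open>a + \<rho> *\<^sub>R b = - u\<close>. Along parameters tending to 0 the squared distance
  from \<open>a k\<close> to \<open>- u\<close> is at most \<open>r k * (norm z * norm u)\<close>,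
  so \<open>a k\<close> tends to \<open>- u\<close>, and lower semicontinuity of the second
  subderivative in its direction finishes.\<close>

lemma frechet_normal_subderiv2_le:
  fixes g :: "'a::euclidean_space \<Rightarrow> ereal"
  assumes lsc: "lsc g" and ppr: "proper g" and conv: "econvex g"
    and mu: "\<mu> \<in> subdiff g y" and reg: "parab_regular g y \<mu>"
    and epi: "\<And>d. subderiv g y d = ereal (\<mu> \<bullet> d) \<Longrightarrow> parab_epi_diff g y d"
    and N: "(z, - u) \<in> frechet_normal (gph_subdiff g) (y, \<mu>)"
  shows "subderiv2 g y \<mu> (- u) \<le> ereal (z \<bullet> u)"
proof -
  define r where "r k = 1 / real (Suc k)" for k
  have r: "\<And>k. r k > 0" "r \<longlonglongrightarrow> 0"
    unfolding r_def using LIMSEQ_inverse_real_of_nat by (auto simp: inverse_eq_divide)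
  have "\<forall>k. \<exists>a b. a + r k *\<^sub>R b = - u \<and> z \<bullet> a \<le> u \<bullet> b \<and> norm a \<le> norm u \<and>
      subderiv2 g y \<mu> a \<le> ereal (a \<bullet> b)"
    using resolvent_limit_direction[OF lsc ppr conv mu reg epi N r(1)] by blast
  then obtain a b where ab: "\<And>k. a k + r k *\<^sub>R b k = - u" "\<And>k. z \<bullet> a k \<le> u \<bullet> b k"
      "\<And>k. norm (a k) \<le> norm u" "\<And>k. subderiv2 g y \<mu> (a k) \<le> ereal (a k \<bullet> b k)" by metis
  \<comment> \<open>Substituting \<open>u = - (a k + r k *\<^sub>R b k)\<close> into the normal
    inequality controls two nonnegative quantities at once: one bounds the second subderivative, the
    other the distance to \<open>- u\<close>.\<close>
  have bound: "a k \<bullet> b k + r k * (norm (b k))\<^sup>2 \<le> - (z \<bullet> a k)" for k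
  proof -
    have "u = - (a k + r k *\<^sub>R b k)" using ab(1)[of k] by simp
    then have "u \<bullet> b k = - (a k \<bullet> b k) - r k * (norm (b k))\<^sup>2"
      by (simp add: inner_add_left inner_minus_left inner_diff_left power2_norm_eq_inner)
    then show ?thesis using ab(2)[of k] by simp
  qed
  have pos: "a k \<bullet> b k \<ge> 0" for k
    using order_trans[OF subderiv2_nonneg[OF mu] ab(4)[of k]] by simp
  have "(norm (a k + u))\<^sup>2 \<le> r k * (norm z * norm u)" for k
  proof -
    have "a k + u = - (r k *\<^sub>R b k)" using ab(1)[of k] by (simp add: eq_neg_iff_add_eq_0 ac_simps)
    then have "(norm (a k + u))\<^sup>2 = r k * (r k * (norm (b k))\<^sup>2)"
      by (simp add: power_mult_distrib power2_eq_square)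
    also have "\<dots> \<le> r k * (norm z * norm u)"
    proof (rule mult_left_mono)
      have "r k * (norm (b k))\<^sup>2 \<le> - (z \<bullet> a k)" using bound[of k] pos[of k] by linarith
      also have "\<dots> \<le> norm z * norm (a k)"
        using Cauchy_Schwarz_ineq2[of z "a k"] by linarith
      also have "\<dots> \<le> norm z * norm u" using ab(3)[of k] by (intro mult_left_mono) auto
      finally show "r k * (norm (b k))\<^sup>2 \<le> norm z * norm u" .
    qed (use r(1)[of k] in auto)
    finally show ?thesis .
  qed
  then have "\<forall>\<^sub>F k in sequentially. norm ((norm (a k + u))\<^sup>2) \<le> r k * (norm z * norm u)" by simp
  from Lim_null_comparison[OF this tendsto_mult_left_zero[OF r(2)]]
  have "(\<lambda>k. (norm (a k + u))\<^sup>2) \<longlonglongrightarrow> 0" .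
  from tendsto_real_sqrt[OF this] have "(\<lambda>k. norm (a k + u)) \<longlonglongrightarrow> 0" by simp
  then have lim: "a \<longlonglongrightarrow> - u"
    using LIM_zero_iff[of a "- u" sequentially] tendsto_norm_zero_iff[of "\<lambda>k. a k + u"] by simp
  show ?thesis
    unfolding subderiv2_def
  proof (rule Liminf_nhds_lsc[OF lim])
    have "(\<lambda>k. - (z \<bullet> a k)) \<longlonglongrightarrow> - (z \<bullet> - u)" by (intro tendsto_intros lim)
    then show "(\<lambda>k. - (z \<bullet> a k)) \<longlonglongrightarrow> z \<bullet> u" by simp
    fix k
    have "0 \<le> r k * (norm (b k))\<^sup>2" using r(1)[of k] by simp
    then have "ereal (a k \<bullet> b k) \<le> ereal (- (z \<bullet> a k))" using bound[of k] by simp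
    from order_trans[OF ab(4) this]
    show "Liminf (at_right 0 \<times>\<^sub>F nhds (a k)) (\<lambda>(t, d'). (g (y + t *\<^sub>R d') - g y - ereal (t * (\<mu> \<bullet> d'))) / ereal (t\<^sup>2 / 2))
        \<le> ereal (- (z \<bullet> a k))" unfolding subderiv2_def .
  qed
qed

section \<open>Taylor expansions\<close>

text \<open>\<open>C2_fun\<close> and \<open>C2_map\<close> state continuity of the derivative
  separately for each direction. The expansion over the finite basis turns this into local
  boundedness and joint continuity in point and direction.\<close>

lemma frechet_derivative_basis_sum:
  fixes G :: "'a::euclidean_space \<Rightarrow> 'b::real_normed_vector"
  assumes "G differentiable (at x)"
  shows "frechet_derivative G (at x) h = (\<Sum>b\<in>Basis. (h \<bullet> b) *\<^sub>R frechet_derivative G (at x) b)"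
proof -
  have lin: "linear (frechet_derivative G (at x))"
    using assms by (rule linear_frechet_derivative)
  have "frechet_derivative G (at x) h = frechet_derivative G (at x) (\<Sum>b\<in>Basis. (h \<bullet> b) *\<^sub>R b)"
    by (simp add: euclidean_representation)
  also have "\<dots> = (\<Sum>b\<in>Basis. (h \<bullet> b) *\<^sub>R frechet_derivative G (at x) b)"
    by (simp add: linear_sum[OF lin] linear_scale[OF lin])
  finally show ?thesis .
qed

lemma lipschitz_on_cball_of_continuous_derivative:
  fixes G :: "'a::euclidean_space \<Rightarrow> 'b::real_normed_vector"
  assumes diff: "\<And>x. G differentiable (at x)"
    and cont: "\<And>h. continuous_on UNIV (\<lambda>x. frechet_derivative G (at x) h)"
  shows "\<exists>K\<ge>0. \<forall>x\<in>cball c r. \<forall>x'\<in>cball c r. norm (G x' - G x) \<le> K * norm (x' - x)"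
proof -
  have "\<exists>M. \<forall>x\<in>cball c r. norm (frechet_derivative G (at x) b) \<le> M" for b
  proof -
    have "compact ((\<lambda>x. frechet_derivative G (at x) b) ` cball c r)"
      by (intro compact_continuous_image continuous_on_subset[OF cont]) auto
    from compact_imp_bounded[OF this] show ?thesis unfolding bounded_iff by auto
  qed
  then obtain M where M: "\<And>b x. x \<in> cball c r \<Longrightarrow> norm (frechet_derivative G (at x) b) \<le> M b"
    by metis
  define K where "K = (\<Sum>b\<in>Basis. \<bar>M b\<bar>)"
  have "K \<ge> 0" unfolding K_def by (intro sum_nonneg) auto
  moreover have "norm (G x' - G x) \<le> K * norm (x' - x)" if "x \<in> cball c r" "x' \<in> cball c r" for x x'
  proof (rule differentiable_bound[OF convex_cball _ _ that(2) that(1)])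
    fix z assume z: "z \<in> cball c r"
    show "(G has_derivative frechet_derivative G (at z)) (at z within cball c r)"
      by (rule has_derivative_at_withinI[OF diff[of z, unfolded frechet_derivative_works]])
    show "onorm (frechet_derivative G (at z)) \<le> K"
    proof (rule onorm_bound[OF \<open>K \<ge> 0\<close>])
      fix h
      have "norm (frechet_derivative G (at z) h) \<le> (\<Sum>b\<in>Basis. norm ((h \<bullet> b) *\<^sub>R frechet_derivative G (at z) b))"
        unfolding frechet_derivative_basis_sum[OF diff, of z h] by (rule norm_sum)
      also have "\<dots> \<le> (\<Sum>b\<in>Basis. \<bar>M b\<bar> * norm h)"
      proof (rule sum_mono)
        fix b :: 'a assume "b \<in> Basis"
        then have "\<bar>h \<bullet> b\<bar> \<le> norm h" by (rule Basis_le_norm)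
        moreover have "norm (frechet_derivative G (at z) b) \<le> \<bar>M b\<bar>" using order_trans[OF M[OF z, of b] abs_ge_self] .
        ultimately have "\<bar>h \<bullet> b\<bar> * norm (frechet_derivative G (at z) b) \<le> norm h * \<bar>M b\<bar>"
          by (rule mult_mono) simp_all
        then show "norm ((h \<bullet> b) *\<^sub>R frechet_derivative G (at z) b) \<le> \<bar>M b\<bar> * norm h"
          by (simp add: mult.commute[of "norm h"])
      qed
      also have "\<dots> = K * norm h" by (simp add: K_def sum_distrib_right)
      finally show "norm (frechet_derivative G (at z) h) \<le> K * norm h" .
    qed
  qed
  ultimately show ?thesis by blast
qed

lemma tendsto_frechet_derivative:
  fixes G :: "'a::euclidean_space \<Rightarrow> 'b::real_normed_vector"
  assumes diff: "\<And>x. G differentiable (at x)"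
    and cont: "\<And>h. continuous_on UNIV (\<lambda>x. frechet_derivative G (at x) h)"
    and x: "xk \<longlonglongrightarrow> x" and v: "vk \<longlonglongrightarrow> v"
  shows "(\<lambda>k. frechet_derivative G (at (xk k)) (vk k)) \<longlonglongrightarrow> frechet_derivative G (at x) v"
proof -
  have "(\<lambda>k. frechet_derivative G (at (xk k)) b) \<longlonglongrightarrow> frechet_derivative G (at x) b" for b
    using continuous_on_tendsto_compose[OF cont x] by simp
  then show ?thesis
    unfolding frechet_derivative_basis_sum[OF diff, of _ "vk _"] frechet_derivative_basis_sum[OF diff, of x v]
    by (intro tendsto_intros v)
qed

text \<open>In the Taylor estimates below \<open>F' = P \<circ> G\<close> with a bilinear product \<open>P\<close>: this covers both
  gradients (inner product) and Jacobians (matrix-vector product).\<close>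
lemma taylor_first_order_cball:
  fixes G :: "'a::euclidean_space \<Rightarrow> 'c::real_normed_vector" and F :: "'a \<Rightarrow> 'b::real_normed_vector"
  assumes P: "bounded_bilinear P" and F: "\<And>z. (F has_derivative P (G z)) (at z)"
    and diff: "\<And>x. G differentiable (at x)"
    and cont: "\<And>h. continuous_on UNIV (\<lambda>x. frechet_derivative G (at x) h)"
  shows "\<exists>K\<ge>0. \<forall>x\<in>cball c r. \<forall>x'\<in>cball c r. norm (F x' - F x - P (G x) (x' - x)) \<le> K * (norm (x' - x))\<^sup>2"
proof -
  interpret bounded_bilinear P by fact
  obtain K where K: "K \<ge> 0" "\<And>x x'. x \<in> cball c r \<Longrightarrow> x' \<in> cball c r \<Longrightarrow> norm (G x' - G x) \<le> K * norm (x' - x)"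
    using lipschitz_on_cball_of_continuous_derivative[OF diff cont] by metis
  obtain M where M: "M > 0" "\<And>a b. norm (P a b) \<le> norm a * norm b * M" using pos_bounded by blast
  have "norm (F x' - F x - P (G x) (x' - x)) \<le> (K * M) * (norm (x' - x))\<^sup>2"
    if x: "x \<in> cball c r" and x': "x' \<in> cball c r" for x x'
  proof -
    have "norm ((F x' - P (G x) x') - (F x - P (G x) x)) \<le> (K * M * norm (x' - x)) * norm (x' - x)"
    proof (rule differentiable_bound[of "closed_segment x x'" "\<lambda>z. F z - P (G x) z" "\<lambda>z v. P (G z) v - P (G x) v"])
      fix z assume z: "z \<in> closed_segment x x'"
      have "((\<lambda>z. F z - P (G x) z) has_derivative (\<lambda>v. P (G z) v - P (G x) v)) (at z)"
        using has_derivative_diff[OF F bounded_linear_imp_has_derivative[OF bounded_linear_right[of "G x"]]] by simp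
      then show "((\<lambda>z. F z - P (G x) z) has_derivative (\<lambda>v. P (G z) v - P (G x) v)) (at z within closed_segment x x')"
        by (rule has_derivative_at_withinI)
      have zc: "z \<in> cball c r" using z closed_segment_subset[OF x x' convex_cball] by blast
      have nz: "norm (z - x) \<le> norm (x' - x)" using segment_bound1[OF z] by simp
      show "onorm (\<lambda>v. P (G z) v - P (G x) v) \<le> K * M * norm (x' - x)"
      proof (rule onorm_bound)
        show "0 \<le> K * M * norm (x' - x)" using K(1) M(1) by simp
        fix v
        have "norm (P (G z) v - P (G x) v) = norm (P (G z - G x) v)" by (simp add: diff_left)
        also have "\<dots> \<le> norm (G z - G x) * norm v * M" by (rule M)
        also have "\<dots> \<le> (K * norm (x' - x)) * norm v * M"
          using K(2)[OF x zc] mult_left_mono[OF nz K(1)] M(1) by (intro mult_right_mono) auto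
        finally show "norm (P (G z) v - P (G x) v) \<le> K * M * norm (x' - x) * norm v"
          by (simp add: ac_simps)
      qed
    qed auto
    moreover have "(F x' - P (G x) x') - (F x - P (G x) x) = F x' - F x - P (G x) (x' - x)"
      by (simp add: diff_right)
    ultimately show ?thesis by (simp add: power2_eq_square ac_simps)
  qed
  then show ?thesis using K(1) M(1) by (intro exI[of _ "K * M"]) auto
qed

text \<open>The path \<open>\<phi>\<close> subtracts the quadratic model along the segment. Its
  derivative is the first-order remainder of \<open>G\<close> paired with \<open>h\<close>, hence of
  order o(\<open>(norm h)\<^sup>2\<close>) uniformly on \<open>{0..1}\<close>, and the mean value
  inequality applies.\<close>

lemma taylor_second_order:
  fixes G :: "'a::euclidean_space \<Rightarrow> 'c::real_normed_vector" and F :: "'a \<Rightarrow> 'b::real_normed_vector"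
  assumes P: "bounded_bilinear P" and F: "\<And>z. (F has_derivative P (G z)) (at z)"
    and D: "(G has_derivative D) (at x)" and e: "e > 0"
  shows "\<exists>\<delta>>0. \<forall>h. norm h < \<delta> \<longrightarrow>
    norm (F (x + h) - F x - P (G x) h - (1/2) *\<^sub>R P (D h) h) \<le> e * (norm h)\<^sup>2"
proof -
  interpret bounded_bilinear P by fact
  interpret D: bounded_linear D using D by (rule has_derivative_bounded_linear)
  obtain M where M: "M > 0" "\<And>a b. norm (P a b) \<le> norm a * norm b * M" using pos_bounded by blast
  obtain \<delta> where \<delta>: "\<delta> > 0" "\<And>z. norm (z - x) < \<delta> \<Longrightarrow> norm (G z - G x - D (z - x)) \<le> e / M * norm (z - x)"
    using D e M(1) unfolding has_derivative_at_alt by (metis divide_pos_pos)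
  have "norm (F (x + h) - F x - P (G x) h - (1/2) *\<^sub>R P (D h) h) \<le> e * (norm h)\<^sup>2" if h: "norm h < \<delta>" for h
  proof -
    define \<phi> where "\<phi> s = F (x + s *\<^sub>R h) - s *\<^sub>R P (G x) h - (s\<^sup>2 / 2) *\<^sub>R P (D h) h" for s
    define \<phi>' where "\<phi>' s = P (G (x + s *\<^sub>R h) - G x - D (s *\<^sub>R h)) h" for s
    have "norm (\<phi> 1 - \<phi> 0) \<le> (e * (norm h)\<^sup>2) * norm (1 - 0 :: real)"
    proof (rule differentiable_bound[of "{0..1}" \<phi> "\<lambda>s v. v *\<^sub>R \<phi>' s"])
      fix s :: real assume s: "s \<in> {0..1}"
      have 1: "((\<lambda>s. x + s *\<^sub>R h) has_derivative (\<lambda>v. v *\<^sub>R h)) (at s)"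
        by (auto intro!: derivative_eq_intros)
      have "((\<lambda>s. F (x + s *\<^sub>R h)) has_derivative (\<lambda>v. P (G (x + s *\<^sub>R h)) (v *\<^sub>R h))) (at s)"
        using has_derivative_compose[OF 1 F] by simp
      then have "(\<phi> has_derivative (\<lambda>v. P (G (x + s *\<^sub>R h)) (v *\<^sub>R h) - v *\<^sub>R P (G x) h - (v * s) *\<^sub>R P (D h) h)) (at s)"
        unfolding \<phi>_def[abs_def] by (auto intro!: derivative_eq_intros simp: power2_eq_square)
      moreover have "(\<lambda>v. P (G (x + s *\<^sub>R h)) (v *\<^sub>R h) - v *\<^sub>R P (G x) h - (v * s) *\<^sub>R P (D h) h) = (\<lambda>v. v *\<^sub>R \<phi>' s)"
        unfolding \<phi>'_def by (simp add: fun_eq_iff diff_left scaleR_right scaleR_left D.scaleR scaleR_diff_right)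
      ultimately show "(\<phi> has_derivative (\<lambda>v. v *\<^sub>R \<phi>' s)) (at s within {0..1})"
        using has_derivative_at_withinI by fastforce
      have "norm (\<phi>' s) \<le> norm (G (x + s *\<^sub>R h) - G x - D (s *\<^sub>R h)) * norm h * M"
        unfolding \<phi>'_def by (rule M)
      also have "\<dots> \<le> (e / M * norm h) * norm h * M"
      proof (intro mult_right_mono)
        have sh: "norm (s *\<^sub>R h) \<le> norm h" using s by (simp add: mult_left_le_one_le)
        have "norm (G (x + s *\<^sub>R h) - G x - D (s *\<^sub>R h)) \<le> e / M * norm (s *\<^sub>R h)"
          using \<delta>(2)[of "x + s *\<^sub>R h"] sh h by simp
        also have "\<dots> \<le> e / M * norm h" using sh e M by (intro mult_left_mono) auto
        finally show "norm (G (x + s *\<^sub>R h) - G x - D (s *\<^sub>R h)) \<le> e / M * norm h" .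
      qed (use M in auto)
      finally have n: "norm (\<phi>' s) \<le> e * (norm h)\<^sup>2" using M by (simp add: power2_eq_square)
      show "onorm (\<lambda>v. v *\<^sub>R \<phi>' s) \<le> e * (norm h)\<^sup>2"
      proof (rule onorm_bound)
        fix v :: real
        show "norm (v *\<^sub>R \<phi>' s) \<le> e * (norm h)\<^sup>2 * norm v"
          using mult_left_mono[OF n, of "\<bar>v\<bar>"] by (simp add: ac_simps)
      qed (use e in simp)
    qed auto
    moreover have "\<phi> 1 - \<phi> 0 = F (x + h) - F x - P (G x) h - (1/2) *\<^sub>R P (D h) h"
      unfolding \<phi>_def by simp
    ultimately show ?thesis by simp
  qed
  then show ?thesis using \<delta>(1) by blast
qed

text \<open>The arc is the straight step \<open>t k *\<^sub>R dk k\<close> with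
  \<open>dk = d + (t k / 2) *\<^sub>R wk k\<close> tending to \<open>d\<close>, so the expansion
  along straight lines applies. \<open>R\<close> collects the Taylor remainder and the change of the
  quadratic term from \<open>d\<close> to \<open>dk k\<close>.\<close>

lemma taylor_along_parabola:
  fixes G :: "'a::euclidean_space \<Rightarrow> 'c::real_normed_vector" and F :: "'a \<Rightarrow> 'b::real_normed_vector"
  assumes P: "bounded_bilinear P" and F: "\<And>z. (F has_derivative P (G z)) (at z)"
    and D: "(G has_derivative D) (at x)"
    and t: "\<And>k. t k > 0" "t \<longlonglongrightarrow> 0" and w: "wk \<longlonglongrightarrow> w"
  shows "\<exists>R. R \<longlonglongrightarrow> 0 \<and> (\<forall>k. F (x + t k *\<^sub>R d + ((t k)\<^sup>2 / 2) *\<^sub>R wk k) =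
      F x + t k *\<^sub>R P (G x) d + ((t k)\<^sup>2 / 2) *\<^sub>R (P (G x) (wk k) + P (D d) d + R k))"
proof -
  interpret bounded_bilinear P by fact
  interpret D: bounded_linear D using D by (rule has_derivative_bounded_linear)
  define dk where "dk k = d + (t k / 2) *\<^sub>R wk k" for k
  have "dk \<longlonglongrightarrow> d + (0 / 2) *\<^sub>R w" unfolding dk_def by (intro tendsto_intros t w) simp
  then have dk: "dk \<longlonglongrightarrow> d" by simp
  define E where "E h = F (x + h) - F x - P (G x) h - (1/2) *\<^sub>R P (D h) h" for h
  define R where "R k = (2 / (t k)\<^sup>2) *\<^sub>R E (t k *\<^sub>R dk k) + (P (D (dk k)) (dk k) - P (D d) d)" for k
  have "(\<lambda>k. (2 / (t k)\<^sup>2) *\<^sub>R E (t k *\<^sub>R dk k)) \<longlonglongrightarrow> 0"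
  proof (rule tendstoI)
    fix e :: real assume "e > 0"
    have "bounded (range dk)" using dk by (rule convergent_imp_bounded)
    then obtain B where B: "B > 0" "\<And>k. norm (dk k) \<le> B" by (auto simp: bounded_pos)
    define e' where "e' = e / (4 * B\<^sup>2)"
    have "e' > 0" using \<open>e > 0\<close> B by (simp add: e'_def)
    obtain \<delta> where \<delta>: "\<delta> > 0" "\<And>h. norm h < \<delta> \<Longrightarrow> norm (E h) \<le> e' * (norm h)\<^sup>2"
      using taylor_second_order[OF P F D \<open>e' > 0\<close>] unfolding E_def by blast
    have "(\<lambda>k. norm (t k *\<^sub>R dk k)) \<longlonglongrightarrow> norm (0 *\<^sub>R d)" by (intro tendsto_intros t dk)
    then have "\<forall>\<^sub>F k in sequentially. norm (t k *\<^sub>R dk k) < \<delta>"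
      using order_tendstoD(2) \<delta>(1) by fastforce
    then show "\<forall>\<^sub>F k in sequentially. dist ((2 / (t k)\<^sup>2) *\<^sub>R E (t k *\<^sub>R dk k)) 0 < e"
    proof eventually_elim
      case (elim k)
      have "norm ((2 / (t k)\<^sup>2) *\<^sub>R E (t k *\<^sub>R dk k)) \<le> 2 / (t k)\<^sup>2 * (e' * (norm (t k *\<^sub>R dk k))\<^sup>2)"
        unfolding norm_scaleR using \<delta>(2)[OF elim] by (simp add: divide_right_mono)
      also have "\<dots> = 2 * e' * (norm (dk k))\<^sup>2" using t(1)[of k] by (simp add: power_mult_distrib)
      also have "\<dots> \<le> 2 * e' * B\<^sup>2" using B(2)[of k] \<open>e' > 0\<close> by (intro mult_left_mono power_mono) auto
      also have "\<dots> = e / 2" using B(1) by (simp add: e'_def)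
      finally show ?case using \<open>e > 0\<close> by simp
    qed
  qed
  moreover have "(\<lambda>k. P (D (dk k)) (dk k)) \<longlonglongrightarrow> P (D d) d"
    by (intro tendsto D.tendsto dk)
  ultimately have "R \<longlonglongrightarrow> 0 + (P (D d) d - P (D d) d)"
    unfolding R_def by (intro tendsto_add tendsto_diff tendsto_const)
  then have "R \<longlonglongrightarrow> 0" by simp
  moreover have "F (x + t k *\<^sub>R d + ((t k)\<^sup>2 / 2) *\<^sub>R wk k) =
      F x + t k *\<^sub>R P (G x) d + ((t k)\<^sup>2 / 2) *\<^sub>R (P (G x) (wk k) + P (D d) d + R k)" for k
  proof -
    have tk: "(t k)\<^sup>2 \<noteq> 0" using t(1)[of k] by simp
    have h: "x + t k *\<^sub>R d + ((t k)\<^sup>2 / 2) *\<^sub>R wk k = x + t k *\<^sub>R dk k"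
      by (simp add: dk_def algebra_simps power2_eq_square)
    have "((t k)\<^sup>2 / 2) *\<^sub>R (P (D d) d + R k) = E (t k *\<^sub>R dk k) + ((t k)\<^sup>2 / 2) *\<^sub>R P (D (dk k)) (dk k)"
      unfolding R_def using tk by (simp add: algebra_simps)
    also have "\<dots> = F (x + t k *\<^sub>R dk k) - F x - P (G x) (t k *\<^sub>R dk k)"
      unfolding E_def by (simp add: D.scaleR scaleR_left scaleR_right power2_eq_square)
    also have "P (G x) (t k *\<^sub>R dk k) = t k *\<^sub>R P (G x) d + ((t k)\<^sup>2 / 2) *\<^sub>R P (G x) (wk k)"
      unfolding dk_def by (simp add: scaleR_right add_right scaleR_add_right power2_eq_square)
    finally have "F (x + t k *\<^sub>R dk k) = F x + t k *\<^sub>R P (G x) d + ((t k)\<^sup>2 / 2) *\<^sub>R P (G x) (wk k)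
        + ((t k)\<^sup>2 / 2) *\<^sub>R (P (D d) d + R k)" by (simp add: algebra_simps)
    then show ?thesis unfolding h by (simp add: scaleR_add_right add.assoc)
  qed
  ultimately show ?thesis by blast
qed

section \<open>Derivatives of twice continuously differentiable data as bilinear products\<close>

lemma bounded_bilinear_matrix_vector_mult:
  "bounded_bilinear ((*v) :: real^'n^'m \<Rightarrow> real^'n \<Rightarrow> real^'m)"
  unfolding bilinear_conv_bounded_bilinear[symmetric] bilinear_def
  by (auto intro!: linearI simp: algebra_simps scaleR_matrix_vector_assoc)

lemma C2_map_has_derivative:
  assumes "C2_map F"
  shows "(F has_derivative (*v) (jac F z)) (at z)"
proof -
  have "F differentiable (at z)" using assms by (auto simp: C2_map_def)
  then have d: "(F has_derivative frechet_derivative F (at z)) (at z)"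
    using frechet_derivative_works by blast
  then have "linear (frechet_derivative F (at z))" by (rule has_derivative_linear)
  then have "(*v) (jac F z) = frechet_derivative F (at z)"
    unfolding jac_def by (rule matrix_vector_mul)
  then show ?thesis using d by simp
qed

lemma C2_fun_has_derivative:
  assumes "C2_fun f"
  shows "(f has_derivative (\<lambda>h. grad f z \<bullet> h)) (at z)"
proof -
  have "f differentiable (at z)" using assms by (auto simp: C2_fun_def)
  then have d: "(f has_derivative frechet_derivative f (at z)) (at z)"
    using frechet_derivative_works by blast
  then have lin: "linear (frechet_derivative f (at z))" by (rule has_derivative_linear)
  have "grad f z \<bullet> h = frechet_derivative f (at z) h" for h
  proof -
    have "frechet_derivative f (at z) h = frechet_derivative f (at z) (\<Sum>i\<in>UNIV. (h $ i) *\<^sub>R axis i 1)"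
      by (simp add: basis_expansion scalar_mult_eq_scaleR[symmetric])
    also have "\<dots> = (\<Sum>i\<in>UNIV. (h $ i) * frechet_derivative f (at z) (axis i 1))"
      by (simp add: linear_sum[OF lin] linear_scale[OF lin])
    finally show ?thesis by (simp add: grad_def inner_vec_def mult.commute)
  qed
  then show ?thesis using d by simp
qed

section \<open>Tilt stability and quadratic growth\<close>

text \<open>Stands in for integrating \<open>M\<close> along the segment. On each of
  \<open>N\<close> equal pieces the subgradient inequality at the far endpoint gives an upper bound
  for the increment. The Lipschitz errors form an arithmetic sum, which yields
  \<open>Q / 2 * (1 + 1 / real N)\<close> and the sharp constant as \<open>N\<close> grows.\<close>

lemma descent_of_lipschitz_subgradient:
  fixes e :: "'a::real_inner \<Rightarrow> real" and M :: "'a \<Rightarrow> 'a"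
  assumes C: "convex C" and sub: "\<And>u u'. u \<in> C \<Longrightarrow> u' \<in> C \<Longrightarrow> e u + M u \<bullet> (u' - u) \<le> e u'"
    and lip: "\<And>u u'. u \<in> C \<Longrightarrow> u' \<in> C \<Longrightarrow> norm (M u - M u') \<le> \<kappa> * norm (u - u')"
    and u: "u \<in> C" and u': "u' \<in> C"
  shows "e u' \<le> e u + M u \<bullet> (u' - u) + \<kappa> / 2 * (norm (u' - u))\<^sup>2"
proof -
  define \<Delta> where "\<Delta> = u' - u"
  define Q where "Q = \<kappa> * (norm \<Delta>)\<^sup>2"
  have part: "e u' \<le> e u + M u \<bullet> \<Delta> + Q / 2 * (1 + 1 / real N)" if N: "N > 0" for N :: nat
  proof -
    define p where "p i = u + (real i / real N) *\<^sub>R \<Delta>" for i :: nat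
    have pC: "p i \<in> C" if "i \<le> N" for i
    proof -
      have "(1 - real i / real N) *\<^sub>R u + (real i / real N) *\<^sub>R u' \<in> C"
        using that N by (intro convexD_alt[OF C u u']) auto
      then show ?thesis unfolding p_def \<Delta>_def by (simp add: algebra_simps)
    qed
    have "e (p i) \<le> e u + real i / real N * (M u \<bullet> \<Delta>) + Q * (real i * (real i + 1) / 2) / (real N)\<^sup>2" if "i \<le> N" for i
      using that
    proof (induction i)
      case 0
      then show ?case by (simp add: p_def)
    next
      case (Suc i)
      have C1: "p (Suc i) \<in> C" "p i \<in> C" using pC Suc.prems by auto
      have d: "p (Suc i) - p i = (1 / real N) *\<^sub>R \<Delta>"
        by (simp add: p_def algebra_simps add_divide_distrib)
      have "e (p (Suc i)) + M (p (Suc i)) \<bullet> (p i - p (Suc i)) \<le> e (p i)" by (rule sub[OF C1])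
      moreover have "p i - p (Suc i) = - ((1 / real N) *\<^sub>R \<Delta>)" using d by (simp add: algebra_simps)
      ultimately have "e (p (Suc i)) \<le> e (p i) + M (p (Suc i)) \<bullet> \<Delta> / real N" by simp
      also have "M (p (Suc i)) \<bullet> \<Delta> \<le> M u \<bullet> \<Delta> + (real i + 1) / real N * Q"
      proof -
        have "(M (p (Suc i)) - M u) \<bullet> \<Delta> \<le> norm (M (p (Suc i)) - M u) * norm \<Delta>"
          by (rule norm_cauchy_schwarz)
        also have "\<dots> \<le> (\<kappa> * norm (p (Suc i) - u)) * norm \<Delta>"
          by (intro mult_right_mono lip C1 u) auto
        also have "norm (p (Suc i) - u) = (real i + 1) / real N * norm \<Delta>"
          using N by (simp add: p_def)
        finally show ?thesis by (simp add: Q_def inner_diff_left power2_eq_square algebra_simps)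
      qed
      finally have "e (p (Suc i)) \<le> e (p i) + (M u \<bullet> \<Delta> + (real i + 1) / real N * Q) / real N"
        using N by (simp add: divide_right_mono)
      also have "\<dots> \<le> e u + real i / real N * (M u \<bullet> \<Delta>) + Q * (real i * (real i + 1) / 2) / (real N)\<^sup>2
          + (M u \<bullet> \<Delta> + (real i + 1) / real N * Q) / real N"
        using Suc by simp
      also have "\<dots> = e u + real (Suc i) / real N * (M u \<bullet> \<Delta>) + Q * (real (Suc i) * (real (Suc i) + 1) / 2) / (real N)\<^sup>2"
        using N by (simp add: field_simps power2_eq_square)
      finally show ?case .
    qed
    from this[of N] have "e (p N) \<le> e u + M u \<bullet> \<Delta> + Q * (real N * (real N + 1) / 2) / (real N)\<^sup>2"
      using N by simp
    moreover have "Q * (real N * (real N + 1) / 2) / (real N)\<^sup>2 = Q / 2 * (1 + 1 / real N)"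
      using N by (simp add: field_simps power2_eq_square)
    moreover have "p N = u'" using N by (simp add: p_def \<Delta>_def)
    ultimately show ?thesis by (simp only:)
  qed
  have lim: "(\<lambda>n. 1 / real (Suc n)) \<longlonglongrightarrow> 0"
    using LIMSEQ_inverse_real_of_nat by (simp add: inverse_eq_divide)
  have "(\<lambda>n. e u + M u \<bullet> \<Delta> + Q / 2 * (1 + 1 / real (Suc n))) \<longlonglongrightarrow> e u + M u \<bullet> \<Delta> + Q / 2 * (1 + 0)"
    by (intro tendsto_intros lim)
  then have "e u' \<le> e u + M u \<bullet> \<Delta> + Q / 2 * (1 + 0)"
    by (rule tendsto_lowerbound) (use part in \<open>auto simp del: of_nat_Suc\<close>)
  then show ?thesis by (simp add: Q_def \<Delta>_def)
qed

text \<open>The map \<open>T u = u + r *\<^sub>R M u - p\<close> is strongly monotone with constant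
  1 and Lipschitz with constant \<open>L\<close>. Hence \<open>u - s *\<^sub>R T u\<close> contracts
  squared distances by the factor \<open>1 - 2 * s + s\<^sup>2 * L\<^sup>2\<close>, which is least
  at \<open>s = 1 / L\<^sup>2\<close>. Since \<open>M\<close> is controlled only on a ball, the
  conclusion is local around \<open>r *\<^sub>R M 0\<close>.\<close>

lemma monotone_lipschitz_resolvent:
  fixes M :: "'a::euclidean_space \<Rightarrow> 'a"
  assumes mono: "\<And>u u'. u \<in> ball 0 \<epsilon> \<Longrightarrow> u' \<in> ball 0 \<epsilon> \<Longrightarrow> 0 \<le> (M u - M u') \<bullet> (u - u')"
    and lip: "\<And>u u'. u \<in> ball 0 \<epsilon> \<Longrightarrow> u' \<in> ball 0 \<epsilon> \<Longrightarrow> norm (M u - M u') \<le> \<kappa> * norm (u - u')"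
    and eps: "\<epsilon> > 0" and kap: "\<kappa> \<ge> 0" and r: "r \<ge> 0"
  shows "\<exists>\<eta>>0. \<forall>p. norm (p - r *\<^sub>R M 0) < \<eta> \<longrightarrow> (\<exists>u\<in>ball 0 \<epsilon>. u + r *\<^sub>R M u = p)"
proof -
  define L where "L = 1 + r * \<kappa>"
  define s where "s = 1 / L\<^sup>2"
  define c where "c = sqrt (1 - s)"
  have L: "L \<ge> 1" using r kap by (simp add: L_def)
  have L2: "L\<^sup>2 \<ge> 1" using L by (simp add: one_le_power)
  have s: "0 < s" "s \<le> 1" "s\<^sup>2 * L\<^sup>2 = s" using L2 by (auto simp: s_def power2_eq_square)
  have c: "0 \<le> c" "c < 1" "c\<^sup>2 = 1 - s" using s by (auto simp: c_def)
  \<comment> \<open>The centre moves by at most \<open>\<eta>\<close>, and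
    \<open>c * (\<epsilon> / 2) + \<eta> = \<epsilon> / 2\<close>, so the contraction maps the
    closed half-ball into itself.\<close>
  define \<eta> where "\<eta> = (1 - c) * (\<epsilon> / 2)"
  have "\<eta> > 0" using c eps by (simp add: \<eta>_def)
  moreover have "\<exists>u\<in>ball 0 \<epsilon>. u + r *\<^sub>R M u = p" if p: "norm (p - r *\<^sub>R M 0) < \<eta>" for p
  proof -
    define T where "T u = u + r *\<^sub>R M u - p" for u
    define G where "G u = u - s *\<^sub>R T u" for u
    have in_ball: "u \<in> ball 0 \<epsilon>" if "u \<in> cball 0 (\<epsilon> / 2)" for u :: 'a using that eps by auto
    have contr: "dist (G u) (G u') \<le> c * dist u u'" if "u \<in> cball 0 (\<epsilon> / 2)" "u' \<in> cball 0 (\<epsilon> / 2)" for u u'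
    proof -
      define d where "d = u - u'"
      define m where "m = r *\<^sub>R (M u - M u')"
      have T: "T u - T u' = d + m" by (simp add: T_def d_def m_def algebra_simps)
      have dm: "d \<bullet> m \<ge> 0" using mono[OF in_ball[OF that(1)] in_ball[OF that(2)]] r
        by (simp add: d_def m_def inner_commute)
      have "norm m \<le> r * (\<kappa> * norm d)"
        using lip[OF in_ball[OF that(1)] in_ball[OF that(2)]] r by (simp add: m_def d_def mult_left_mono)
      then have "norm (d + m) \<le> L * norm d"
        using norm_triangle_ineq[of d m] by (simp add: L_def algebra_simps)
      then have n2: "(norm (d + m))\<^sup>2 \<le> L\<^sup>2 * (norm d)\<^sup>2"
        using power_mono[of "norm (d + m)" "L * norm d" 2] by (simp add: power_mult_distrib)
      have "(norm (d - s *\<^sub>R (d + m)))\<^sup>2 = (norm d)\<^sup>2 - 2 * s * (d \<bullet> (d + m)) + s\<^sup>2 * (norm (d + m))\<^sup>2"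
        unfolding power2_norm_eq_inner
        by (simp only: inner_diff_left inner_diff_right inner_scaleR_left inner_scaleR_right
            inner_commute[of "d + m" d] power2_eq_square) (simp add: algebra_simps)
      also have "\<dots> \<le> (norm d)\<^sup>2 - 2 * s * (norm d)\<^sup>2 + s\<^sup>2 * (L\<^sup>2 * (norm d)\<^sup>2)"
      proof -
        have "s * (norm d)\<^sup>2 \<le> s * (d \<bullet> (d + m))"
          using dm s(1) by (intro mult_left_mono) (auto simp: inner_add_right power2_norm_eq_inner)
        moreover have "s\<^sup>2 * (norm (d + m))\<^sup>2 \<le> s\<^sup>2 * (L\<^sup>2 * (norm d)\<^sup>2)"
          using n2 by (intro mult_left_mono) auto
        ultimately show ?thesis by linarith
      qed
      also have "s\<^sup>2 * (L\<^sup>2 * (norm d)\<^sup>2) = s * (norm d)\<^sup>2" using s(3) by (metis mult.assoc)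
      finally have "(norm (d - s *\<^sub>R (d + m)))\<^sup>2 \<le> (c * norm d)\<^sup>2"
        by (simp add: power_mult_distrib c(3) algebra_simps)
      then have "norm (d - s *\<^sub>R (d + m)) \<le> c * norm d"
        using power2_le_imp_le c(1) by (metis mult_nonneg_nonneg norm_ge_zero)
      moreover have "G u - G u' = d - s *\<^sub>R (d + m)" unfolding T[symmetric] by (simp add: G_def d_def algebra_simps)
      ultimately show ?thesis by (simp add: dist_norm d_def)
    qed
    have "G ` cball 0 (\<epsilon> / 2) \<subseteq> cball 0 (\<epsilon> / 2)"
    proof safe
      fix u :: 'a assume u: "u \<in> cball 0 (\<epsilon> / 2)"
      have "norm (G u) \<le> dist (G u) (G 0) + norm (G 0)"
        by (metis dist_norm dist_triangle diff_zero)
      also have "dist (G u) (G 0) \<le> c * dist u 0" using eps by (intro contr u) auto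
      also have "c * dist u 0 \<le> c * (\<epsilon> / 2)" using u c by (intro mult_left_mono) (auto simp: dist_norm)
      also have "norm (G 0) \<le> \<eta>"
      proof -
        have "G 0 = s *\<^sub>R (p - r *\<^sub>R M 0)" by (simp add: G_def T_def algebra_simps)
        then have "norm (G 0) = s * norm (p - r *\<^sub>R M 0)" using s by simp
        also have "\<dots> \<le> 1 * norm (p - r *\<^sub>R M 0)" using s by (intro mult_right_mono) auto
        finally show ?thesis using p by simp
      qed
      also have "c * (\<epsilon> / 2) + \<eta> = \<epsilon> / 2" by (simp add: \<eta>_def field_simps)
      finally show "G u \<in> cball 0 (\<epsilon> / 2)" by simp
    qed
    moreover have "complete (cball (0::'a) (\<epsilon> / 2))" using closed_cball complete_eq_closed by blast
    ultimately obtain u where u: "u \<in> cball 0 (\<epsilon> / 2)" "G u = u"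
      using Banach_fix[of "cball 0 (\<epsilon> / 2)" c G] contr c eps by auto
    then have "T u = 0" using s by (simp add: G_def)
    then show ?thesis using in_ball[OF u(1)] by (auto simp: T_def)
  qed
  ultimately show ?thesis by blast
qed

text \<open>A tilted minimizer is compared with \<open>xb\<close>, where \<open>f\<close> is finite,
  so its own value is finite. This allows the inequality to be written without subtraction in
  \<open>ereal\<close>.\<close>

lemma tilt_M_eq:
  assumes nm: "\<And>z. f z \<noteq> -\<infinity>" and fb: "f xb = ereal fb" and del: "\<delta> \<ge> 0"
  shows "tilt_M f xb \<delta> u = {x \<in> cball xb \<delta>. \<exists>fx. f x = ereal fx \<and> (\<forall>x'\<in>cball xb \<delta>. ereal (fx + u \<bullet> (x' - x)) \<le> f x')}"
proof -
  have iff: "f x - f xb - ereal (u \<bullet> (x - xb)) \<le> f x' - f xb - ereal (u \<bullet> (x' - xb))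
      \<longleftrightarrow> ereal (fx + u \<bullet> (x' - x)) \<le> f x'" if "f x = ereal fx" for x x' fx
    using that fb nm[of x'] by (cases "f x'") (auto simp: inner_diff_right)
  have fin: "\<exists>fx. f x = ereal fx" if "f x - f xb - ereal (u \<bullet> (x - xb)) \<le> f xb - f xb - ereal (u \<bullet> (xb - xb))" for x
    using that fb nm[of x] by (cases "f x") auto
  have xb: "xb \<in> cball xb \<delta>" using del by simp
  show ?thesis
    unfolding tilt_M_def
  proof (intro Collect_cong conj_cong refl)
    fix x
    show "(\<forall>x'\<in>cball xb \<delta>. f x - f xb - ereal (u \<bullet> (x - xb)) \<le> f x' - f xb - ereal (u \<bullet> (x' - xb))) \<longleftrightarrow>
        (\<exists>fx. f x = ereal fx \<and> (\<forall>x'\<in>cball xb \<delta>. ereal (fx + u \<bullet> (x' - x)) \<le> f x'))" (is "?A \<longleftrightarrow> ?B")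
    proof
      assume A: ?A
      obtain fx where fx: "f x = ereal fx" using fin[OF A[rule_format, OF xb]] by blast
      then show ?B using A iff[OF fx] by blast
    next
      assume ?B then show ?A using iff by blast
    qed
  qed
qed

text \<open>Prox-regularity identifies \<open>x\<close> as the minimizer tilted by \<open>x\<^sup>*\<close>; the growth constant is dual to the Lipschitz modulus of the tilted
  minimizers, which are the gradients of the conjugate function.\<close>
lemma tilt_stable_growth:
  fixes f :: "real^'n \<Rightarrow> ereal"
  assumes tilt: "tilt_stable f xb \<kappa>" and kap: "\<kappa> > 0" and nm: "\<And>z. f z \<noteq> -\<infinity>" and fb: "f xb = ereal fb"
  shows "\<exists>\<delta>>0. \<forall>r\<ge>0. \<exists>\<eta>>0. \<forall>x xs fx. norm (x - xb) < \<eta> \<and> norm xs < \<eta> \<and> f x = ereal fx \<and>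
      (\<forall>x'\<in>cball xb \<delta>. ereal (fx + xs \<bullet> (x' - x) - r * (norm (x' - x))\<^sup>2) \<le> f x') \<longrightarrow>
      (\<exists>\<rho>>0. \<forall>x'. norm (x' - x) < \<rho> \<longrightarrow> ereal (fx + xs \<bullet> (x' - x) + (norm (x' - x))\<^sup>2 / (2 * \<kappa>)) \<le> f x')"
proof -
  obtain \<delta> \<epsilon> where del: "\<delta> > 0" and eps: "\<epsilon> > 0"
    and sing: "\<And>u. u \<in> ball 0 \<epsilon> \<Longrightarrow> \<exists>x. tilt_M f xb \<delta> u = {x}"
    and lip0: "\<And>u u' x x'. u \<in> ball 0 \<epsilon> \<Longrightarrow> u' \<in> ball 0 \<epsilon> \<Longrightarrow> tilt_M f xb \<delta> u = {x} \<Longrightarrow> tilt_M f xb \<delta> u' = {x'}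
          \<Longrightarrow> dist x x' \<le> \<kappa> * dist u u'"
    and M0': "tilt_M f xb \<delta> 0 = {xb}"
    using tilt unfolding tilt_stable_def by metis
  obtain M where M: "\<And>u. u \<in> ball 0 \<epsilon> \<Longrightarrow> tilt_M f xb \<delta> u = {M u}" using sing by metis
  note tM = tilt_M_eq[of f, OF nm fb less_imp_le[OF del]]
  have M0: "M 0 = xb" using M[of 0] M0' eps by simp
  have lip: "norm (M u - M u') \<le> \<kappa> * norm (u - u')" if "u \<in> ball 0 \<epsilon>" "u' \<in> ball 0 \<epsilon>" for u u'
    using lip0[OF that M[OF that(1)] M[OF that(2)]] by (simp add: dist_norm)
  have "\<forall>u\<in>ball 0 \<epsilon>. M u \<in> cball xb \<delta> \<and> (\<exists>fm. f (M u) = ereal fm \<and> (\<forall>x'\<in>cball xb \<delta>. ereal (fm + u \<bullet> (x' - M u)) \<le> f x'))"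
  proof
    fix u :: "real^'n" assume u: "u \<in> ball 0 \<epsilon>"
    have "M u \<in> tilt_M f xb \<delta> u" using M[OF u] by simp
    then show "M u \<in> cball xb \<delta> \<and> (\<exists>fm. f (M u) = ereal fm \<and> (\<forall>x'\<in>cball xb \<delta>. ereal (fm + u \<bullet> (x' - M u)) \<le> f x'))"
      unfolding tM by blast
  qed
  then obtain fm where Mc: "\<And>u. u \<in> ball 0 \<epsilon> \<Longrightarrow> M u \<in> cball xb \<delta>"
    and fm: "\<And>u. u \<in> ball 0 \<epsilon> \<Longrightarrow> f (M u) = ereal (fm u)"
    and opt: "\<And>u x'. u \<in> ball 0 \<epsilon> \<Longrightarrow> x' \<in> cball xb \<delta> \<Longrightarrow> ereal (fm u + u \<bullet> (x' - M u)) \<le> f x'"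
    by metis
  \<comment> \<open>This is the conjugate of \<open>f\<close> restricted to the ball around
    \<open>xb\<close>: the supremum of \<open>u \<bullet> x - f x\<close> is attained at
    \<open>M u\<close>. Therefore \<open>M u\<close> is a subgradient of \<open>e\<close> at
    \<open>u\<close>.\<close>
  define e where "e u = u \<bullet> M u - fm u" for u
  have sub: "e u + M u \<bullet> (u' - u) \<le> e u'" if u: "u \<in> ball 0 \<epsilon>" "u' \<in> ball 0 \<epsilon>" for u u'
  proof -
    have "fm u' + u' \<bullet> (M u - M u') \<le> fm u" using opt[OF u(2) Mc[OF u(1)]] fm[OF u(1)] by simp
    then show ?thesis by (simp add: e_def inner_diff_right inner_commute)
  qed
  have mono: "0 \<le> (M u - M u') \<bullet> (u - u')" if u: "u \<in> ball 0 \<epsilon>" "u' \<in> ball 0 \<epsilon>" for u u'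
    using sub[OF u] sub[OF u(2) u(1)] by (simp add: inner_diff_left inner_diff_right)
  have main: "\<exists>\<eta>>0. \<forall>x xs fx. norm (x - xb) < \<eta> \<and> norm xs < \<eta> \<and> f x = ereal fx \<and>
      (\<forall>x'\<in>cball xb \<delta>. ereal (fx + xs \<bullet> (x' - x) - r * (norm (x' - x))\<^sup>2) \<le> f x') \<longrightarrow>
      (\<exists>\<rho>>0. \<forall>x'. norm (x' - x) < \<rho> \<longrightarrow> ereal (fx + xs \<bullet> (x' - x) + (norm (x' - x))\<^sup>2 / (2 * \<kappa>)) \<le> f x')"
    if r: "r \<ge> 0" for r
  proof -
    \<comment> \<open>For \<open>u + R *\<^sub>R M u = xs + R *\<^sub>R x\<close>, optimality of
      \<open>M u\<close> and the prox inequality at \<open>x\<close> add up to \<open>R * (norm (M u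
      - x))\<^sup>2 \<le> r * (norm (M u - x))\<^sup>2\<close>. Exceeding \<open>r\<close> by 1
      forces \<open>M u = x\<close>, and then \<open>u = xs\<close>.\<close>
    define R where "R = r + 1"
    have R: "R \<ge> 0" "R \<ge> 1" using r by (auto simp: R_def)
    obtain \<eta>1 where \<eta>1: "\<eta>1 > 0" "\<And>p. norm (p - R *\<^sub>R M 0) < \<eta>1 \<Longrightarrow> \<exists>u\<in>ball 0 \<epsilon>. u + R *\<^sub>R M u = p"
      using monotone_lipschitz_resolvent[OF mono lip eps less_imp_le[OF kap] R(1)] by metis
    \<comment> \<open>The first entry brings \<open>xs + R *\<^sub>R x\<close> into the solvable
      range of the resolvent; the others leave room for the competitors \<open>x'\<close> in the
      ball around \<open>xb\<close> and for the perturbed tilts \<open>xs + h\<close>.\<close>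
    define \<eta> where "\<eta> = min (\<eta>1 / (2 * R)) (min (\<delta> / 2) (\<epsilon> / 2))"
    have \<eta>: "\<eta> > 0" "\<eta> \<le> \<eta>1 / (2 * R)" "\<eta> \<le> \<delta> / 2" "\<eta> \<le> \<epsilon> / 2"
      using \<eta>1 del eps R by (auto simp: \<eta>_def)
    have \<eta>R: "R * \<eta> \<le> \<eta>1 / 2" using mult_left_mono[OF \<eta>(2) R(1)] R by simp
    have "\<exists>\<rho>>0. \<forall>x'. norm (x' - x) < \<rho> \<longrightarrow> ereal (fx + xs \<bullet> (x' - x) + (norm (x' - x))\<^sup>2 / (2 * \<kappa>)) \<le> f x'"
      if x: "norm (x - xb) < \<eta>" and xs: "norm xs < \<eta>" and fx: "f x = ereal fx"
        and prox: "\<And>x'. x' \<in> cball xb \<delta> \<Longrightarrow> ereal (fx + xs \<bullet> (x' - x) - r * (norm (x' - x))\<^sup>2) \<le> f x'"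
      for x xs fx
    proof -
      have xc: "x \<in> cball xb \<delta>" using x \<eta> del by (simp add: dist_norm norm_minus_commute)
      have "norm (xs + R *\<^sub>R x - R *\<^sub>R M 0) \<le> norm xs + R * norm (x - xb)"
      proof -
        have eq: "xs + R *\<^sub>R x - R *\<^sub>R M 0 = xs + R *\<^sub>R (x - xb)" by (simp add: M0 algebra_simps)
        show ?thesis unfolding eq using norm_triangle_ineq[of xs "R *\<^sub>R (x - xb)"] R by simp
      qed
      also have "\<dots> < R * \<eta> + R * \<eta>"
      proof (rule add_less_le_mono)
        have "1 * \<eta> \<le> R * \<eta>" using R \<eta>(1) by (intro mult_right_mono) auto
        then show "norm xs < R * \<eta>" using xs by linarith
        show "R * norm (x - xb) \<le> R * \<eta>" using x R by (intro mult_left_mono) auto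
      qed
      finally have "norm (xs + R *\<^sub>R x - R *\<^sub>R M 0) < \<eta>1" using \<eta>R by linarith
      then obtain u where u: "u \<in> ball 0 \<epsilon>" "u + R *\<^sub>R M u = xs + R *\<^sub>R x" using \<eta>1(2) by blast
      have uxs: "u - xs = R *\<^sub>R (x - M u)" using u(2) by (simp add: algebra_simps)
      have 1: "fm u + u \<bullet> (x - M u) \<le> fx" using opt[OF u(1) xc] fx by simp
      have 2: "fx + xs \<bullet> (M u - x) - r * (norm (M u - x))\<^sup>2 \<le> fm u"
        using prox[OF Mc[OF u(1)]] fm[OF u(1)] by simp
      have "(u - xs) \<bullet> (x - M u) = R * (norm (M u - x))\<^sup>2"
        unfolding uxs by (simp add: power2_norm_eq_inner norm_minus_commute[of "M u"])
      then have "(norm (M u - x))\<^sup>2 \<le> 0"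
        using 1 2 unfolding R_def inner_diff_left inner_diff_right distrib_right by linarith
      then have Mu: "M u = x" by simp
      then have "u = xs" using uxs by simp
      then have xsb: "xs \<in> ball 0 \<epsilon>" and Mx: "M xs = x" using u(1) Mu by auto
      have fmx: "fm xs = fx" using fm[OF xsb] fx Mx by simp
      define \<rho> where "\<rho> = min (\<delta> / 2) (\<kappa> * (\<epsilon> / 2))"
      have "\<rho> > 0" using del kap eps by (simp add: \<rho>_def)
      moreover have "ereal (fx + xs \<bullet> (x' - x) + (norm (x' - x))\<^sup>2 / (2 * \<kappa>)) \<le> f x'" if x': "norm (x' - x) < \<rho>" for x'
      proof -
        \<comment> \<open>This \<open>h\<close> maximizes
          \<open>h \<bullet> (x' - x) - \<kappa> / 2 * (norm h)\<^sup>2\<close>; the maximum is the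
          desired growth term. Optimality of \<open>M (xs + h)\<close> against \<open>x'\<close>
          then gives the growth inequality.\<close>
        define h where "h = (1 / \<kappa>) *\<^sub>R (x' - x)"
        have x'd: "norm (x' - x) < \<delta> / 2" and "norm (x' - x) < \<kappa> * (\<epsilon> / 2)" using x' by (auto simp: \<rho>_def)
        from this(2) have "norm (x' - x) / \<kappa> < \<epsilon> / 2" using kap by (simp add: field_simps)
        then have "norm h < \<epsilon> / 2" using kap by (simp add: h_def)
        then have u': "xs + h \<in> ball 0 \<epsilon>" using xs \<eta>(4) norm_triangle_ineq[of xs h] by simp
        have "norm (x' - xb) \<le> norm (x' - x) + norm (x - xb)"
          using norm_triangle_ineq[of "x' - x" "x - xb"] by simp
        then have x'c: "x' \<in> cball xb \<delta>"
          using x'd x \<eta>(3) by (simp add: dist_norm norm_minus_commute)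
        have "e (xs + h) \<le> e xs + M xs \<bullet> (xs + h - xs) + \<kappa> / 2 * (norm (xs + h - xs))\<^sup>2"
          by (rule descent_of_lipschitz_subgradient[OF convex_ball sub lip xsb u'])
        then have e': "e (xs + h) \<le> xs \<bullet> x - fx + x \<bullet> h + \<kappa> / 2 * (norm h)\<^sup>2"
          by (simp add: Mx e_def[of xs] fmx)
        have "fx + xs \<bullet> (x' - x) + (norm (x' - x))\<^sup>2 / (2 * \<kappa>) \<le> fm (xs + h) + (xs + h) \<bullet> (x' - M (xs + h))"
        proof -
          have "\<kappa> / 2 * (norm h)\<^sup>2 = (norm (x' - x))\<^sup>2 / (2 * \<kappa>)"
            using kap by (simp add: h_def power_divide power2_eq_square)
          moreover have "h \<bullet> (x' - x) = (norm (x' - x))\<^sup>2 / \<kappa>"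
            by (simp add: h_def power2_norm_eq_inner)
          then have "h \<bullet> x' - h \<bullet> x = (norm (x' - x))\<^sup>2 / (2 * \<kappa>) + (norm (x' - x))\<^sup>2 / (2 * \<kappa>)"
            by (simp add: inner_diff_right)
          moreover have "fm (xs + h) + (xs + h) \<bullet> (x' - M (xs + h)) = xs \<bullet> x' + h \<bullet> x' - e (xs + h)"
            by (simp add: e_def inner_diff_right inner_add_left)
          ultimately show ?thesis using e' by (simp add: inner_diff_right inner_commute[of x h])
        qed
        then have "ereal (fx + xs \<bullet> (x' - x) + (norm (x' - x))\<^sup>2 / (2 * \<kappa>)) \<le> ereal (fm (xs + h) + (xs + h) \<bullet> (x' - M (xs + h)))"
          by simp
        from order_trans[OF this opt[OF u' x'c]] show ?thesis .
      qed
      ultimately show ?thesis by blast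
    qed
    then show ?thesis using \<eta>(1) by (intro exI[of _ \<eta>]) blast
  qed
  show ?thesis using del main by (intro exI[of _ \<delta>]) blast
qed

section \<open>Parabolic subderivatives\<close>

lemma parab_subderiv_less_seq:
  assumes gy: "g y = ereal gy" and D: "subderiv g y d = ereal D" and "parab_subderiv g y d s < ereal \<gamma>"
  shows "\<exists>t sk. (\<forall>k. t k > 0) \<and> t \<longlonglongrightarrow> 0 \<and> sk \<longlonglongrightarrow> s \<and>
    (\<forall>k. g (y + t k *\<^sub>R d + ((t k)\<^sup>2 / 2) *\<^sub>R sk k) < ereal (gy + t k * D + (t k)\<^sup>2 / 2 * \<gamma>))"
proof -
  obtain t sk where t: "\<And>k. t k > 0" "t \<longlonglongrightarrow> 0" "sk \<longlonglongrightarrow> s"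
    and lt: "\<And>k. parab_quot g y d (t k) (sk k) < ereal \<gamma>"
    using Liminf_less_seq[OF assms(3)[unfolded parab_subderiv_def]] by auto
  have "g (y + t k *\<^sub>R d + ((t k)\<^sup>2 / 2) *\<^sub>R sk k) < ereal (gy + t k * D + (t k)\<^sup>2 / 2 * \<gamma>)" for k
    using lt[of k] parab_quot_le_iff(2)[of g, OF gy D t(1)] by blast
  then show ?thesis using t by blast
qed

lemma parab_subderiv_le_seq:
  assumes gy: "g y = ereal gy" and D: "subderiv g y d = ereal D"
    and t: "\<And>k. t k > 0" "t \<longlonglongrightarrow> 0" and sk: "sk \<longlonglongrightarrow> s"
    and le: "\<forall>\<^sub>F k in sequentially. g (y + t k *\<^sub>R d + ((t k)\<^sup>2 / 2) *\<^sub>R sk k) \<le> ereal (gy + t k * D + (t k)\<^sup>2 / 2 * c k)"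
    and c: "c \<longlonglongrightarrow> c0"
  shows "parab_subderiv g y d s \<le> ereal c0"
  unfolding parab_subderiv_def
proof (rule Liminf_le_seq[OF t sk _ c])
  show "\<forall>\<^sub>F k in sequentially. (case (t k, sk k) of (t, w') \<Rightarrow> parab_quot g y d t w') \<le> ereal (c k)"
    using le
  proof eventually_elim
    case (elim k)
    then show ?case using parab_quot_le_iff(1)[of g, OF gy D t(1)[of k]] by simp
  qed
qed

text \<open>Epi-differentiability supplies recovery sequences for \<open>s1\<close> and
  \<open>s2\<close> along one common step sequence. The lower limits alone could be realized along
  different steps, and convexity of \<open>g\<close> could not combine them.\<close>

lemma parab_subderiv_convex:
  assumes conv: "econvex g" and gy: "g y = ereal gy" and D: "subderiv g y d = ereal D"
    and epi: "parab_epi_diff g y d"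
    and 1: "parab_subderiv g y d s1 < ereal \<gamma>1" and 2: "parab_subderiv g y d s2 < ereal \<gamma>2"
    and u: "0 \<le> u" "u \<le> 1"
  shows "parab_subderiv g y d ((1 - u) *\<^sub>R s1 + u *\<^sub>R s2) \<le> ereal ((1 - u) * \<gamma>1 + u * \<gamma>2)"
proof -
  define t where "t k = 1 / real (Suc k)" for k
  have t: "\<And>k. t k > 0" "t \<longlonglongrightarrow> 0"
    unfolding t_def using LIMSEQ_inverse_real_of_nat by (auto simp: inverse_eq_divide)
  obtain a where a: "a \<longlonglongrightarrow> s1" "(\<lambda>k. parab_quot g y d (t k) (a k)) \<longlonglongrightarrow> parab_subderiv g y d s1"
    using epi t unfolding parab_epi_diff_def by blast
  obtain b where b: "b \<longlonglongrightarrow> s2" "(\<lambda>k. parab_quot g y d (t k) (b k)) \<longlonglongrightarrow> parab_subderiv g y d s2"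
    using epi t unfolding parab_epi_diff_def by blast
  show ?thesis
  proof (rule parab_subderiv_le_seq[of g, OF gy D t])
    show "(\<lambda>k. (1 - u) *\<^sub>R a k + u *\<^sub>R b k) \<longlonglongrightarrow> (1 - u) *\<^sub>R s1 + u *\<^sub>R s2"
      by (intro tendsto_intros a b)
    show "(\<lambda>k. (1 - u) * \<gamma>1 + u * \<gamma>2) \<longlonglongrightarrow> (1 - u) * \<gamma>1 + u * \<gamma>2" by simp
    have "\<forall>\<^sub>F k in sequentially. parab_quot g y d (t k) (a k) < ereal \<gamma>1"
      using order_tendstoD(2)[OF a(2) 1] .
    moreover have "\<forall>\<^sub>F k in sequentially. parab_quot g y d (t k) (b k) < ereal \<gamma>2"
      using order_tendstoD(2)[OF b(2) 2] .
    ultimately show "\<forall>\<^sub>F k in sequentially. g (y + t k *\<^sub>R d + ((t k)\<^sup>2 / 2) *\<^sub>R ((1 - u) *\<^sub>R a k + u *\<^sub>R b k))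
        \<le> ereal (gy + t k * D + (t k)\<^sup>2 / 2 * ((1 - u) * \<gamma>1 + u * \<gamma>2))"
    proof eventually_elim
      case (elim k)
      note q = parab_quot_le_iff(1)[of g, OF gy D t(1)[of k]]
      have "g ((1 - u) *\<^sub>R (y + t k *\<^sub>R d + ((t k)\<^sup>2 / 2) *\<^sub>R a k) + u *\<^sub>R (y + t k *\<^sub>R d + ((t k)\<^sup>2 / 2) *\<^sub>R b k))
          \<le> ereal ((1 - u) * (gy + t k * D + (t k)\<^sup>2 / 2 * \<gamma>1) + u * (gy + t k * D + (t k)\<^sup>2 / 2 * \<gamma>2))"
        by (rule econvexD[OF conv _ _ u]) (use elim q less_imp_le in blast)+
      moreover have "(1 - u) *\<^sub>R (y + t k *\<^sub>R d + ((t k)\<^sup>2 / 2) *\<^sub>R a k) + u *\<^sub>R (y + t k *\<^sub>R d + ((t k)\<^sup>2 / 2) *\<^sub>R b k)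
          = y + t k *\<^sub>R d + ((t k)\<^sup>2 / 2) *\<^sub>R ((1 - u) *\<^sub>R a k + u *\<^sub>R b k)"
      proof -
        have "(1 - u) *\<^sub>R (P + h *\<^sub>R a k) + u *\<^sub>R (P + h *\<^sub>R b k) = P + h *\<^sub>R ((1 - u) *\<^sub>R a k + u *\<^sub>R b k)" for P h
          by (simp add: algebra_simps)
        then show ?thesis .
      qed
      moreover have "(1 - u) * (gy + t k * D + (t k)\<^sup>2 / 2 * \<gamma>1) + u * (gy + t k * D + (t k)\<^sup>2 / 2 * \<gamma>2)
          = gy + t k * D + (t k)\<^sup>2 / 2 * ((1 - u) * \<gamma>1 + u * \<gamma>2)"
        by (simp add: field_simps)
      ultimately show ?case by simp
    qed
  qed
qed

text \<open>Consequently every affine minorant of the parabolic subderivative has a subgradient of \<open>g\<close> at \<open>y\<close> as its slope.\<close>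
lemma parab_subderiv_recession:
  assumes conv: "econvex g" and gy: "g y = ereal gy" and D: "subderiv g y d = ereal D"
    and s: "parab_subderiv g y d s < ereal \<gamma>" and z: "g z \<le> ereal gz" and r: "r > 0"
  shows "parab_subderiv g y d (s + r *\<^sub>R (z - y)) \<le> ereal (\<gamma> + r * (gz - gy))"
proof -
  obtain t sk where t: "\<And>k. t k > 0" "t \<longlonglongrightarrow> 0" "sk \<longlonglongrightarrow> s"
    and lt: "\<And>k. g (y + t k *\<^sub>R d + ((t k)\<^sup>2 / 2) *\<^sub>R sk k) < ereal (gy + t k * D + (t k)\<^sup>2 / 2 * \<gamma>)"
    using parab_subderiv_less_seq[of g, OF gy D s] by blast
  \<comment> \<open>Weight given to \<open>z\<close> in a convex combination with the point on the
    parabola: of second order, so that it shifts only the parabolic direction. The cap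
    \<open>1/2\<close> keeps \<open>1 - \<theta> k\<close> positive for every \<open>k\<close> and
    is eventually inactive.\<close>
  define \<theta> where "\<theta> k = min (r * (t k)\<^sup>2 / 2) (1/2)" for k
  have "(\<lambda>k. r * (t k)\<^sup>2 / 2) \<longlonglongrightarrow> r * 0\<^sup>2 / 2" by (intro tendsto_intros t) simp
  then have lim: "(\<lambda>k. r * (t k)\<^sup>2 / 2) \<longlonglongrightarrow> 0" by simp
  have "\<theta> \<longlonglongrightarrow> min 0 (1/2)" unfolding \<theta>_def by (intro tendsto_min lim tendsto_const)
  then have th: "\<theta> \<longlonglongrightarrow> 0" by simp
  have th2: "\<theta> k \<le> 1/2" "\<theta> k \<ge> 0" for k unfolding \<theta>_def using r by auto
  have ev: "\<forall>\<^sub>F k in sequentially. \<theta> k = r * (t k)\<^sup>2 / 2"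
    using order_tendstoD(2)[OF lim, of "1/2"] by (simp add: \<theta>_def min_def eventually_mono)
  \<comment> \<open>The combination with \<open>z\<close> shrinks the first-order term, so it lies
    on a parabola with step \<open>t' k\<close>. Rewriting the second-order terms relative to
    \<open>(t' k)\<^sup>2 / 2\<close> creates the denominators in powers of
    \<open>1 - \<theta> k\<close>, which tend to 1.\<close>
  define t' where "t' k = (1 - \<theta> k) * t k" for k
  have "t' \<longlonglongrightarrow> (1 - 0) * 0" unfolding t'_def by (intro tendsto_intros th t)
  moreover have "t' k > 0" for k
    unfolding t'_def using t(1)[of k] th2(1)[of k] by (intro mult_pos_pos) auto
  ultimately have t': "\<And>k. t' k > 0" "t' \<longlonglongrightarrow> 0" by simp_all
  show ?thesis
  proof (rule parab_subderiv_le_seq[of g, OF gy D t'])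
    have "(\<lambda>k. (1 / (1 - \<theta> k)) *\<^sub>R sk k + (r / (1 - \<theta> k)\<^sup>2) *\<^sub>R (z - y)) \<longlonglongrightarrow> (1 / (1 - 0)) *\<^sub>R s + (r / (1 - 0)\<^sup>2) *\<^sub>R (z - y)"
      by (intro tendsto_intros th t) auto
    then show "(\<lambda>k. (1 / (1 - \<theta> k)) *\<^sub>R sk k + (r / (1 - \<theta> k)\<^sup>2) *\<^sub>R (z - y)) \<longlonglongrightarrow> s + r *\<^sub>R (z - y)"
      by simp
    have "(\<lambda>k. \<gamma> / (1 - \<theta> k) + r / (1 - \<theta> k)\<^sup>2 * (gz - gy)) \<longlonglongrightarrow> \<gamma> / (1 - 0) + r / (1 - 0)\<^sup>2 * (gz - gy)"
      by (intro tendsto_intros th) auto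
    then show "(\<lambda>k. \<gamma> / (1 - \<theta> k) + r / (1 - \<theta> k)\<^sup>2 * (gz - gy)) \<longlonglongrightarrow> \<gamma> + r * (gz - gy)" by simp
    show "\<forall>\<^sub>F k in sequentially. g (y + t' k *\<^sub>R d + ((t' k)\<^sup>2 / 2) *\<^sub>R ((1 / (1 - \<theta> k)) *\<^sub>R sk k + (r / (1 - \<theta> k)\<^sup>2) *\<^sub>R (z - y)))
       \<le> ereal (gy + t' k * D + (t' k)\<^sup>2 / 2 * (\<gamma> / (1 - \<theta> k) + r / (1 - \<theta> k)\<^sup>2 * (gz - gy)))"
      using ev
    proof eventually_elim
      case (elim k)
      define p where "p = 1 - \<theta> k"
      have p: "p > 0" using th2(1)[of k] by (simp add: p_def)
      have thp: "\<theta> k = 1 - p" by (simp add: p_def)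
      have t'p: "t' k = p * t k" by (simp add: t'_def p_def)
      have rt: "(t' k)\<^sup>2 / 2 * (r / p\<^sup>2) = \<theta> k" "(t' k)\<^sup>2 / 2 * (1 / p) = p * ((t k)\<^sup>2 / 2)"
        using p unfolding elim t'p by (simp_all add: power_mult_distrib power2_eq_square)
      have "g ((1 - \<theta> k) *\<^sub>R (y + t k *\<^sub>R d + ((t k)\<^sup>2 / 2) *\<^sub>R sk k) + \<theta> k *\<^sub>R z)
          \<le> ereal ((1 - \<theta> k) * (gy + t k * D + (t k)\<^sup>2 / 2 * \<gamma>) + \<theta> k * gz)"
        using th2[of k] by (intro econvexD[OF conv _ z] less_imp_le[OF lt]) auto
      moreover have "(1 - \<theta> k) *\<^sub>R (y + t k *\<^sub>R d + ((t k)\<^sup>2 / 2) *\<^sub>R sk k) + \<theta> k *\<^sub>R z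
          = y + t' k *\<^sub>R d + ((t' k)\<^sup>2 / 2) *\<^sub>R ((1 / p) *\<^sub>R sk k + (r / p\<^sup>2) *\<^sub>R (z - y))"
      proof -
        have "((t' k)\<^sup>2 / 2) *\<^sub>R ((1 / p) *\<^sub>R sk k + (r / p\<^sup>2) *\<^sub>R (z - y))
            = (p * ((t k)\<^sup>2 / 2)) *\<^sub>R sk k + \<theta> k *\<^sub>R (z - y)"
          unfolding scaleR_add_right scaleR_scaleR rt ..
        then show ?thesis unfolding t'_def thp by (simp add: algebra_simps)
      qed
      moreover have "(1 - \<theta> k) * (gy + t k * D + (t k)\<^sup>2 / 2 * \<gamma>) + \<theta> k * gz
          = gy + t' k * D + (t' k)\<^sup>2 / 2 * (\<gamma> / p + r / p\<^sup>2 * (gz - gy))"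
      proof -
        have "(t' k)\<^sup>2 / 2 * (\<gamma> / p + r / p\<^sup>2 * (gz - gy))
            = ((t' k)\<^sup>2 / 2 * (1 / p)) * \<gamma> + ((t' k)\<^sup>2 / 2 * (r / p\<^sup>2)) * (gz - gy)"
          by (simp add: algebra_simps)
        also have "\<dots> = p * ((t k)\<^sup>2 / 2) * \<gamma> + \<theta> k * (gz - gy)" unfolding rt ..
        finally show ?thesis unfolding t'_def thp by (simp add: algebra_simps)
      qed
      ultimately show ?case unfolding p_def by simp
    qed
  qed
qed

section \<open>Second-order growth\<close>

text \<open>The strict bound says that \<open>E\<close> misses the hypograph \<open>S\<close> of the
  concave function with value \<open>c - L * norm p\<close>. A separating hyperplane has
  \<open>\<theta> \<ge> 0\<close> because \<open>S\<close> is unbounded below, and is not vertical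
  because \<open>S\<close> projects onto the whole space; dividing by \<open>\<theta>\<close> gives
  the slope. The constant \<open>c\<close> survives since \<open>(0, c)\<close> lies in
  \<open>S\<close>.\<close>

lemma penalty_bound_imp_affine_bound:
  fixes E :: "('a::euclidean_space \<times> real) set"
  assumes E: "convex E" "E \<noteq> {}" and L: "L \<ge> 0"
    and pen: "\<And>p \<beta>. (p, \<beta>) \<in> E \<Longrightarrow> c < \<beta> + L * norm p"
  shows "\<exists>\<eta>. \<forall>(p, \<beta>)\<in>E. c + \<eta> \<bullet> p \<le> \<beta>"
proof -
  define S where "S = {(p::'a, \<beta>). \<beta> + L * norm p \<le> c}"
  have "convex S"
  proof (rule convexI)
    fix x y and u v :: real
    assume xy: "x \<in> S" "y \<in> S" and uv: "0 \<le> u" "0 \<le> v" "u + v = 1"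
    have x: "snd x + L * norm (fst x) \<le> c" and y: "snd y + L * norm (fst y) \<le> c"
      using xy by (auto simp: S_def)
    have "norm (u *\<^sub>R fst x + v *\<^sub>R fst y) \<le> u * norm (fst x) + v * norm (fst y)"
      using norm_triangle_ineq[of "u *\<^sub>R fst x" "v *\<^sub>R fst y"] uv by simp
    then have "L * norm (u *\<^sub>R fst x + v *\<^sub>R fst y) \<le> L * (u * norm (fst x) + v * norm (fst y))"
      using L by (rule mult_left_mono)
    then have "u * snd x + v * snd y + L * norm (u *\<^sub>R fst x + v *\<^sub>R fst y)
        \<le> u * (snd x + L * norm (fst x)) + v * (snd y + L * norm (fst y))"
      by (simp add: algebra_simps)
    also have "\<dots> \<le> u * c + v * c" using x y uv by (intro add_mono mult_left_mono) auto
    also have "\<dots> = c" using uv(3) by (simp add: distrib_right[symmetric])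
    finally show "u *\<^sub>R x + v *\<^sub>R y \<in> S" by (simp add: S_def case_prod_beta)
  qed
  moreover have "(0, c) \<in> S" by (simp add: S_def)
  moreover have "S \<inter> E = {}" using pen by (force simp: S_def)
  ultimately obtain a b where a: "a \<noteq> 0" "\<And>x. x \<in> S \<Longrightarrow> a \<bullet> x \<le> b" "\<And>x. x \<in> E \<Longrightarrow> b \<le> a \<bullet> x"
    using separating_hyperplane_sets[of S E] E by (metis empty_iff)
  obtain \<eta>0 \<theta> where a_eq: "a = (\<eta>0, \<theta>)" by (cases a)
  have Sb: "\<eta>0 \<bullet> p + \<theta> * \<beta> \<le> b" if "\<beta> + L * norm p \<le> c" for p \<beta>
    using a(2)[of "(p, \<beta>)"] that by (simp add: S_def a_eq)
  have Eb: "b \<le> \<eta>0 \<bullet> p + \<theta> * \<beta>" if "(p, \<beta>) \<in> E" for p \<beta>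
    using a(3)[OF that] by (simp add: a_eq)
  have "\<theta> \<ge> 0"
  proof (rule ccontr)
    assume "\<not> \<theta> \<ge> 0"
    then have th: "\<theta> < 0" by simp
    define n where "n = (\<bar>b - \<theta> * c\<bar> + 1) / (- \<theta>)"
    have "n \<ge> 0" unfolding n_def using th by (intro divide_nonneg_pos) auto
    then have "\<theta> * (c - n) \<le> b" using Sb[of "c - n" 0] by simp
    moreover have "\<theta> * n = - (\<bar>b - \<theta> * c\<bar> + 1)" using th by (simp add: n_def)
    ultimately show False by (simp add: right_diff_distrib)
  qed
  moreover have "\<theta> \<noteq> 0"
  proof
    assume th: "\<theta> = 0"
    have \<eta>0: "\<eta>0 \<noteq> 0" using a(1) a_eq th by (auto simp: zero_prod_def)
    define p where "p = ((\<bar>b\<bar> + 1) / (\<eta>0 \<bullet> \<eta>0)) *\<^sub>R \<eta>0"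
    have "\<eta>0 \<bullet> p \<le> b" using Sb[of "c - L * norm p" p] th by simp
    moreover have "\<eta>0 \<bullet> p = \<bar>b\<bar> + 1" using \<eta>0 by (simp add: p_def)
    ultimately show False by simp
  qed
  ultimately have th: "\<theta> > 0" by simp
  have "\<theta> * c \<le> b" using Sb[of c 0] by simp
  have "c + (- (1 / \<theta>) *\<^sub>R \<eta>0) \<bullet> p \<le> \<beta>" if "(p, \<beta>) \<in> E" for p \<beta>
  proof -
    have "\<theta> * c \<le> \<eta>0 \<bullet> p + \<theta> * \<beta>" using Eb[OF that] \<open>\<theta> * c \<le> b\<close> by linarith
    then show ?thesis using th by (simp add: field_simps)
  qed
  then show ?thesis by blast
qed

text \<open>The competitors are the points \<open>x + t d + \<onehalf> t\<^sup>2 w'\<close> of the domain of \<open>g \<circ> F\<close> that metric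
  subregularity provides near \<open>x + t d + \<onehalf> t\<^sup>2 w\<close>.\<close>
lemma parabolic_growth_estimate:
  fixes f0 :: "real^'n \<Rightarrow> real" and F :: "real^'n \<Rightarrow> real^'m" and g :: "real^'m \<Rightarrow> ereal"
  assumes f0: "C2_fun f0" and F: "C2_map F" and ppr: "proper g"
    and gy: "g (F x) = ereal gy"
    and sd: "subderiv g (F x) (jac F x *v d) = ereal (\<mu> \<bullet> (jac F x *v d))"
    and rho: "\<rho> > 0"
    and growth: "\<And>x'. norm (x' - x) < \<rho> \<Longrightarrow>
      ereal (f0 x + gy + (grad f0 x \<bullet> (x' - x) + \<mu> \<bullet> (jac F x *v (x' - x))) + (norm (x' - x))\<^sup>2 / (2 * \<kappa>))
        \<le> ereal (f0 x') + g (F x')"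
    and r1: "r1 > 0"
    and lip: "\<And>y y'. y \<in> ball (F x) r1 \<inter> edom g \<Longrightarrow> y' \<in> ball (F x) r1 \<inter> edom g \<Longrightarrow>
      \<bar>real_of_ereal (g y) - real_of_ereal (g y')\<bar> \<le> ell * dist y y'"
    and r2: "r2 > 0"
    and metric: "\<And>x'. x' \<in> ball x r2 \<Longrightarrow> infdist x' (edom (\<lambda>x. g (F x))) \<le> \<kappa>0 * infdist (F x') (edom g)"
    and kap: "\<kappa> > 0" and kap0: "\<kappa>0 > 0"
    and s: "parab_subderiv g (F x) (jac F x *v d) s < ereal \<gamma>"
  shows "\<exists>w'. norm (w' - w) \<le> \<kappa>0 * norm (jac F x *v w + d2F F x d - s) \<and>
    \<mu> \<bullet> (jac F x *v w') + (norm d)\<^sup>2 / \<kappa> \<le> hessq f0 x d + \<gamma> + ell * norm (jac F x *v w' + d2F F x d - s)"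
proof -
  define A where "A = jac F x"
  define y where "y = F x"
  define q where "q = d2F F x d"
  define n where "n = norm (A *v w + q - s)"
  note dF = C2_map_has_derivative[OF F]
  note bA = bounded_bilinear_matrix_vector_mult
  have DF: "(jac F has_derivative frechet_derivative (jac F) (at x)) (at x)"
    using F frechet_derivative_works unfolding C2_map_def by blast
  have Df0: "(grad f0 has_derivative frechet_derivative (grad f0) (at x)) (at x)"
    using f0 frechet_derivative_works unfolding C2_fun_def by blast
  have nm: "\<And>z. g z \<noteq> -\<infinity>" using ppr by (auto simp: proper_def)
  obtain t sk where t: "\<And>k. t k > 0" "t \<longlonglongrightarrow> 0" and sk: "sk \<longlonglongrightarrow> s"
    and lt: "\<And>k. g (y + t k *\<^sub>R (A *v d) + ((t k)\<^sup>2 / 2) *\<^sub>R sk k) < ereal (gy + t k * (\<mu> \<bullet> (A *v d)) + (t k)\<^sup>2 / 2 * \<gamma>)"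
    using parab_subderiv_less_seq[of g, OF gy sd s] unfolding A_def y_def by blast
  define yk where "yk k = y + t k *\<^sub>R (A *v d) + ((t k)\<^sup>2 / 2) *\<^sub>R sk k" for k
  have yk_dom: "yk k \<in> edom g" for k
    using less_trans[OF lt[of k], of \<infinity>] by (simp add: edom_def yk_def)
  obtain R where R: "R \<longlonglongrightarrow> 0" "\<And>k. F (x + t k *\<^sub>R d + ((t k)\<^sup>2 / 2) *\<^sub>R w) =
      y + t k *\<^sub>R (A *v d) + ((t k)\<^sup>2 / 2) *\<^sub>R (A *v w + q + R k)"
    using taylor_along_parabola[OF bA dF DF t tendsto_const, of d w] unfolding A_def y_def q_def d2F_def by blast
  define nk where "nk k = norm (A *v w + q + R k - sk k)" for k
  have "nk \<longlonglongrightarrow> norm (A *v w + q + 0 - s)" unfolding nk_def by (intro tendsto_intros R sk)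
  then have nk: "nk \<longlonglongrightarrow> n" by (simp add: n_def)
  \<comment> \<open>The infimal distance to the domain need not be attained; the slack
    \<open>t k\<close> allows an actual domain point to be chosen and disappears in the limit. The
    premise on \<open>ball x r2\<close> holds for all large \<open>k\<close>, and stating it lets
    \<open>w'\<close> be chosen for every \<open>k\<close>.\<close>
  have "\<exists>w'. norm (w' - w) \<le> \<kappa>0 * nk k + t k \<and> (x + t k *\<^sub>R d + ((t k)\<^sup>2 / 2) *\<^sub>R w \<in> ball x r2 \<longrightarrow>
      g (F (x + t k *\<^sub>R d + ((t k)\<^sup>2 / 2) *\<^sub>R w')) < \<infinity>)" for k
  proof (cases "x + t k *\<^sub>R d + ((t k)\<^sup>2 / 2) *\<^sub>R w \<in> ball x r2")
    case False
    have "0 \<le> \<kappa>0 * nk k + t k" using kap0 t(1)[of k] by (simp add: nk_def)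
    then show ?thesis using False by (intro exI[of _ w]) auto
  next
    case True
    define h where "h = (t k)\<^sup>2 / 2"
    have h: "h > 0" using t(1)[of k] by (simp add: h_def)
    define xk where "xk = x + t k *\<^sub>R d + h *\<^sub>R w"
    have "infdist (F xk) (edom g) \<le> dist (F xk) (yk k)" by (rule infdist_le[OF yk_dom])
    also have "\<dots> = h * nk k"
    proof -
      have "F xk - yk k = h *\<^sub>R (A *v w + q + R k - sk k)"
        unfolding xk_def yk_def h_def R(2) by (simp add: scaleR_diff_right)
      then show ?thesis using h by (simp add: dist_norm nk_def)
    qed
    finally have "\<kappa>0 * infdist (F xk) (edom g) \<le> \<kappa>0 * (h * nk k)" using kap0 by (intro mult_left_mono) auto
    moreover have "infdist xk (edom (\<lambda>x. g (F x))) \<le> \<kappa>0 * infdist (F xk) (edom g)"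
      using metric True unfolding xk_def h_def by blast
    moreover have "h * t k > 0" using h t(1)[of k] by simp
    ultimately have id: "infdist xk (edom (\<lambda>x. g (F x))) < h * (\<kappa>0 * nk k + t k)"
      by (simp add: algebra_simps)
    have "x \<in> edom (\<lambda>x. g (F x))" using gy by (simp add: edom_def)
    then have ne: "edom (\<lambda>x. g (F x)) \<noteq> {}" by blast
    obtain x' where x': "x' \<in> edom (\<lambda>x. g (F x))" "dist xk x' < h * (\<kappa>0 * nk k + t k)"
      using id ne by (auto simp: infdist_notempty cInf_less_iff)
    define w' where "w' = w + (1 / h) *\<^sub>R (x' - xk)"
    have x'eq: "x' = x + t k *\<^sub>R d + h *\<^sub>R w'" using h by (simp add: w'_def xk_def scaleR_add_right)
    have "norm (w' - w) = dist xk x' / h" using h by (simp add: w'_def dist_norm norm_minus_commute)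
    also have "\<dots> \<le> \<kappa>0 * nk k + t k" using x'(2) h by (simp add: divide_le_eq mult.commute)
    finally show ?thesis using x'(1) x'eq unfolding edom_def h_def by blast
  qed
  then obtain wk where wk: "\<And>k. norm (wk k - w) \<le> \<kappa>0 * nk k + t k"
      "\<And>k. x + t k *\<^sub>R d + ((t k)\<^sup>2 / 2) *\<^sub>R w \<in> ball x r2 \<Longrightarrow>
        g (F (x + t k *\<^sub>R d + ((t k)\<^sup>2 / 2) *\<^sub>R wk k)) < \<infinity>"
    by metis
  have lim_wk: "(\<lambda>k. \<kappa>0 * nk k + t k) \<longlonglongrightarrow> \<kappa>0 * n + 0" by (intro tendsto_intros nk t)
  obtain B where B: "\<And>k. norm (\<kappa>0 * nk k + t k) \<le> B"
    using convergent_imp_bounded[OF lim_wk] by (auto simp: bounded_iff)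
  have "bounded (range wk)"
  proof (rule boundedI[of _ "B + norm w"])
    fix z assume "z \<in> range wk"
    then obtain k where "z = wk k" by blast
    then show "norm z \<le> B + norm w"
      using norm_triangle_ineq[of "wk k - w" w] wk(1)[of k] B[of k] by simp
  qed
  then obtain w' \<phi> where \<phi>: "strict_mono (\<phi> :: nat \<Rightarrow> nat)" "(wk \<circ> \<phi>) \<longlonglongrightarrow> w'"
    using bounded_imp_convergent_subsequence by blast
  define T where "T = t \<circ> \<phi>"
  define W where "W = wk \<circ> \<phi>"
  define S where "S = sk \<circ> \<phi>"
  have T: "\<And>k. T k > 0" "T \<longlonglongrightarrow> 0" and W: "W \<longlonglongrightarrow> w'" and S: "S \<longlonglongrightarrow> s"
    using t(1) LIMSEQ_subseq_LIMSEQ[OF t(2) \<phi>(1)] \<phi>(2) LIMSEQ_subseq_LIMSEQ[OF sk \<phi>(1)]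
    by (auto simp: T_def W_def S_def)
  have w'n: "norm (w' - w) \<le> \<kappa>0 * n"
  proof (rule tendsto_le)
    show "(\<lambda>k. \<kappa>0 * nk (\<phi> k) + t (\<phi> k)) \<longlonglongrightarrow> \<kappa>0 * n"
      using LIMSEQ_subseq_LIMSEQ[OF lim_wk \<phi>(1)] by (simp add: o_def)
    show "(\<lambda>k. norm (W k - w)) \<longlonglongrightarrow> norm (w' - w)" by (intro tendsto_intros W)
    show "\<forall>\<^sub>F k in sequentially. norm (W k - w) \<le> \<kappa>0 * nk (\<phi> k) + t (\<phi> k)"
      using wk(1) by (simp add: W_def)
  qed simp
  obtain R1 where R1: "R1 \<longlonglongrightarrow> 0" "\<And>k. F (x + T k *\<^sub>R d + ((T k)\<^sup>2 / 2) *\<^sub>R W k) =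
      y + T k *\<^sub>R (A *v d) + ((T k)\<^sup>2 / 2) *\<^sub>R (A *v W k + q + R1 k)"
    using taylor_along_parabola[OF bA dF DF T W, of d] unfolding A_def y_def q_def d2F_def by blast
  obtain R2 where R2: "R2 \<longlonglongrightarrow> 0" "\<And>k. f0 (x + T k *\<^sub>R d + ((T k)\<^sup>2 / 2) *\<^sub>R W k) =
      f0 x + T k * (grad f0 x \<bullet> d) + ((T k)\<^sup>2 / 2) * (grad f0 x \<bullet> W k + hessq f0 x d + R2 k)"
    using taylor_along_parabola[OF bounded_bilinear_inner C2_fun_has_derivative[OF f0] Df0 T W, of d]
    unfolding hessq_def by auto
  define X where "X k = x + T k *\<^sub>R d + ((T k)\<^sup>2 / 2) *\<^sub>R W k" for k
  define Y where "Y k = y + T k *\<^sub>R (A *v d) + ((T k)\<^sup>2 / 2) *\<^sub>R S k" for k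
  have Ylt: "g (Y k) < ereal (gy + T k * (\<mu> \<bullet> (A *v d)) + (T k)\<^sup>2 / 2 * \<gamma>)" for k
    using lt[of "\<phi> k"] by (simp add: Y_def T_def S_def)
  have Y: "Y \<longlonglongrightarrow> y"
  proof -
    have "Y \<longlonglongrightarrow> y + 0 *\<^sub>R (A *v d) + (0\<^sup>2 / 2) *\<^sub>R s" unfolding Y_def by (intro tendsto_intros T S) simp
    then show ?thesis by simp
  qed
  have X: "X \<longlonglongrightarrow> x"
  proof -
    have "X \<longlonglongrightarrow> x + 0 *\<^sub>R d + (0\<^sup>2 / 2) *\<^sub>R w'" unfolding X_def by (intro tendsto_intros T W) simp
    then show ?thesis by simp
  qed
  have FX: "(\<lambda>k. F (X k)) \<longlonglongrightarrow> y"
  proof -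
    have "(\<lambda>k. A *v W k) \<longlonglongrightarrow> A *v w'" by (rule bounded_bilinear.tendsto[OF bA tendsto_const W])
    then have "(\<lambda>k. y + T k *\<^sub>R (A *v d) + ((T k)\<^sup>2 / 2) *\<^sub>R (A *v W k + q + R1 k))
        \<longlonglongrightarrow> y + 0 *\<^sub>R (A *v d) + (0\<^sup>2 / 2) *\<^sub>R (A *v w' + q + 0)"
      by (intro tendsto_intros T R1) simp_all
    then show ?thesis unfolding X_def R1 by simp
  qed
  have "(\<lambda>k. x + T k *\<^sub>R d + ((T k)\<^sup>2 / 2) *\<^sub>R w) \<longlonglongrightarrow> x + 0 *\<^sub>R d + (0\<^sup>2 / 2) *\<^sub>R w"
    by (intro tendsto_intros T) simp
  then have "(\<lambda>k. x + T k *\<^sub>R d + ((T k)\<^sup>2 / 2) *\<^sub>R w) \<longlonglongrightarrow> x" by simp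
  from tendstoD[OF this r2] have e1: "\<forall>\<^sub>F k in sequentially. g (F (X k)) < \<infinity>"
  proof eventually_elim
    case (elim k)
    then show ?case using wk(2)[of "\<phi> k"] by (simp add: X_def T_def W_def dist_commute)
  qed
  \<comment> \<open>\<open>Y k\<close> realizes the parabolic bound on \<open>g\<close>, and the
    Lipschitz property transfers it to \<open>F (X k)\<close>. In the growth inequality at
    \<open>X k\<close> the terms of order \<open>T k\<close> and the terms with
    \<open>grad f0 x\<close> cancel; dividing by \<open>(T k)\<^sup>2 / 2\<close> turns the growth
    constant 1/(2\<kappa>) into 1/\<kappa>.\<close>
  have step: "\<forall>\<^sub>F k in sequentially. \<mu> \<bullet> (A *v W k) + (norm (d + (T k / 2) *\<^sub>R W k))\<^sup>2 / \<kappa>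
      \<le> hessq f0 x d + R2 k + \<gamma> + ell * norm (A *v W k + q + R1 k - S k)"
    using e1 tendstoD[OF FX r1] tendstoD[OF Y r1] tendstoD[OF X rho]
  proof eventually_elim
    case (elim k)
    define h where "h = (T k)\<^sup>2 / 2"
    have h: "h > 0" using T(1)[of k] by (simp add: h_def)
    obtain gX where gX: "g (F (X k)) = ereal gX" using elim(1) nm[of "F (X k)"] by (cases "g (F (X k))") auto
    obtain gY where gY: "g (Y k) = ereal gY" using Ylt[of k] nm[of "Y k"] by (cases "g (Y k)") auto
    have gYlt: "gY < gy + T k * (\<mu> \<bullet> (A *v d)) + h * \<gamma>" using Ylt[of k] gY by (simp add: h_def)
    have "\<bar>real_of_ereal (g (F (X k))) - real_of_ereal (g (Y k))\<bar> \<le> ell * dist (F (X k)) (Y k)"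
      using elim gX gY by (intro lip) (auto simp: edom_def dist_commute y_def)
    then have "gX \<le> gY + ell * dist (F (X k)) (Y k)" by (simp add: gX gY)
    moreover have "dist (F (X k)) (Y k) = h * norm (A *v W k + q + R1 k - S k)"
    proof -
      have "F (X k) - Y k = h *\<^sub>R (A *v W k + q + R1 k - S k)"
        unfolding X_def Y_def R1 h_def by (simp add: scaleR_diff_right)
      then show ?thesis using h by (simp add: dist_norm)
    qed
    ultimately have gXle: "gX \<le> gy + T k * (\<mu> \<bullet> (A *v d)) + h * \<gamma> + h * (ell * norm (A *v W k + q + R1 k - S k))"
      using gYlt by (simp add: ac_simps)
    have Xx: "X k - x = T k *\<^sub>R d + h *\<^sub>R W k" by (simp add: X_def h_def)
    have "f0 x + gy + (grad f0 x \<bullet> (X k - x) + \<mu> \<bullet> (A *v (X k - x))) + (norm (X k - x))\<^sup>2 / (2 * \<kappa>) \<le> f0 (X k) + gX"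
      using growth[of "X k"] elim(4) gX by (simp add: A_def dist_norm)
    moreover have "(norm (X k - x))\<^sup>2 / (2 * \<kappa>) = h * ((norm (d + (T k / 2) *\<^sub>R W k))\<^sup>2 / \<kappa>)"
    proof -
      have "X k - x = T k *\<^sub>R (d + (T k / 2) *\<^sub>R W k)"
        unfolding Xx h_def by (simp add: scaleR_add_right power2_eq_square)
      then show ?thesis by (simp add: power_mult_distrib h_def)
    qed
    moreover have "grad f0 x \<bullet> (X k - x) = T k * (grad f0 x \<bullet> d) + h * (grad f0 x \<bullet> W k)"
      unfolding Xx by (simp add: inner_add_right)
    moreover have "\<mu> \<bullet> (A *v (X k - x)) = T k * (\<mu> \<bullet> (A *v d)) + h * (\<mu> \<bullet> (A *v W k))"
      unfolding Xx by (simp add: matrix_vector_right_distrib matrix_vector_mult_scaleR inner_add_right)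
    moreover have "f0 (X k) = f0 x + T k * (grad f0 x \<bullet> d) + (h * (grad f0 x \<bullet> W k) + h * (hessq f0 x d + R2 k))"
      unfolding X_def R2 h_def by (simp add: algebra_simps)
    ultimately have "h * (\<mu> \<bullet> (A *v W k)) + h * ((norm (d + (T k / 2) *\<^sub>R W k))\<^sup>2 / \<kappa>)
        \<le> h * (hessq f0 x d + R2 k) + h * \<gamma> + h * (ell * norm (A *v W k + q + R1 k - S k))"
      using gXle by linarith
    then have "h * (\<mu> \<bullet> (A *v W k) + (norm (d + (T k / 2) *\<^sub>R W k))\<^sup>2 / \<kappa>)
        \<le> h * (hessq f0 x d + R2 k + \<gamma> + ell * norm (A *v W k + q + R1 k - S k))"
      by (simp only: distrib_left)
    then show ?case using h by (simp only: mult_le_cancel_left_pos)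
  qed
  have AW: "(\<lambda>k. A *v W k) \<longlonglongrightarrow> A *v w'" by (rule bounded_bilinear.tendsto[OF bA tendsto_const W])
  have l1: "(\<lambda>k. \<mu> \<bullet> (A *v W k) + (norm (d + (T k / 2) *\<^sub>R W k))\<^sup>2 / \<kappa>)
      \<longlonglongrightarrow> \<mu> \<bullet> (A *v w') + (norm (d + (0 / 2) *\<^sub>R w'))\<^sup>2 / \<kappa>"
    using kap by (intro tendsto_intros AW T W) auto
  have l2: "(\<lambda>k. hessq f0 x d + R2 k + \<gamma> + ell * norm (A *v W k + q + R1 k - S k))
      \<longlonglongrightarrow> hessq f0 x d + 0 + \<gamma> + ell * norm (A *v w' + q + 0 - s)"
    by (intro tendsto_intros AW R2 R1 S)
  have "\<mu> \<bullet> (A *v w') + (norm d)\<^sup>2 / \<kappa> \<le> hessq f0 x d + \<gamma> + ell * norm (A *v w' + q - s)"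
    using tendsto_le[OF sequentially_bot l2 l1 step] by simp
  then show ?thesis using w'n unfolding n_def A_def q_def by blast
qed

text \<open>Parabolic growth is free of error only when \<open>jac F x *v w + d2F F x d = s\<close>.
  Penalizing this residual leaves \<open>s\<close> and \<open>w\<close> independent, and that
  freedom identifies the multiplier: varying \<open>w\<close> fixes its image under the transposed
  Jacobian, and moving \<open>s\<close> along recession directions makes it a subgradient.\<close>

lemma second_subderivative_growth:
  fixes f0 :: "real^'n \<Rightarrow> real" and F :: "real^'n \<Rightarrow> real^'m" and g :: "real^'m \<Rightarrow> ereal"
  assumes f0: "C2_fun f0" and F: "C2_map F" and ppr: "proper g" and conv: "econvex g"
    and mu: "\<mu> \<in> subdiff g (F x)" and gy: "g (F x) = ereal gy"
    and reg: "parab_regular g (F x) \<mu>"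
    and epi: "\<And>d. subderiv g (F x) d = ereal (\<mu> \<bullet> d) \<Longrightarrow> parab_epi_diff g (F x) d"
    and rho: "\<rho> > 0"
    and growth: "\<And>x'. norm (x' - x) < \<rho> \<Longrightarrow>
      ereal (f0 x + gy + (grad f0 x \<bullet> (x' - x) + \<mu> \<bullet> (jac F x *v (x' - x))) + (norm (x' - x))\<^sup>2 / (2 * \<kappa>))
        \<le> ereal (f0 x') + g (F x')"
    and r1: "r1 > 0"
    and lip: "\<And>y y'. y \<in> ball (F x) r1 \<inter> edom g \<Longrightarrow> y' \<in> ball (F x) r1 \<inter> edom g \<Longrightarrow>
      \<bar>real_of_ereal (g y) - real_of_ereal (g y')\<bar> \<le> ell * dist y y'"
    and r2: "r2 > 0"
    and metric: "\<And>x'. x' \<in> ball x r2 \<Longrightarrow> infdist x' (edom (\<lambda>x. g (F x))) \<le> \<kappa>0 * infdist (F x') (edom g)"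
    and ell: "ell \<ge> 0" and kap: "\<kappa> > 0" and kap0: "\<kappa>0 > 0"
    and sing: "Lambda g F x (transpose (jac F x) *v \<mu>) = {\<mu>0}"
    and fin: "subderiv2 g (F x) \<mu> (jac F x *v d) < \<infinity>"
  shows "ereal ((norm d)\<^sup>2 / \<kappa> - hessq f0 x d - \<mu> \<bullet> d2F F x d) \<le> subderiv2 g (F x) \<mu> (jac F x *v d)"
proof -
  define A where "A = jac F x"
  define q where "q = d2F F x d"
  define c where "c = (norm d)\<^sup>2 / \<kappa> - hessq f0 x d"
  define \<psi> where "\<psi> = parab_subderiv g (F x) (A *v d)"
  have sd: "subderiv g (F x) (jac F x *v d) = ereal (\<mu> \<bullet> (jac F x *v d))"
    by (rule subderiv2_finite_imp_subderiv[OF mu fin])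
  have pe: "parab_epi_diff g (F x) (A *v d)" unfolding A_def by (rule epi[OF sd])
  obtain B where B: "B > 0" "\<And>v. norm (A *v v) \<le> norm v * B"
    using bounded_linear.pos_bounded[OF matrix_vector_mul_bounded_linear[of A]] by blast
  \<comment> \<open>Correcting \<open>w\<close> to \<open>w'\<close> moves its image by at most
    \<open>\<kappa>0 * B * n\<close>. This enlarges the residual, which is charged at rate
    \<open>ell\<close>, and changes the linear term, which is charged at rate
    \<open>norm \<mu>\<close>.\<close>
  define L where "L = ell * (1 + \<kappa>0 * B) + norm \<mu> * (\<kappa>0 * B)"
  have L: "L \<ge> 0" using ell kap0 B by (simp add: L_def)
  have pen: "c \<le> \<gamma> - \<mu> \<bullet> (A *v w) + L * norm (s - q - A *v w)" if s: "\<psi> s < ereal \<gamma>" for s \<gamma> w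
  proof -
    define n where "n = norm (A *v w + q - s)"
    obtain w' where w': "norm (w' - w) \<le> \<kappa>0 * n"
      "\<mu> \<bullet> (A *v w') + (norm d)\<^sup>2 / \<kappa> \<le> hessq f0 x d + \<gamma> + ell * norm (A *v w' + q - s)"
      using parabolic_growth_estimate[OF f0 F ppr gy sd rho growth r1 lip r2 metric kap kap0 s[unfolded \<psi>_def A_def], of w]
      unfolding n_def A_def q_def by blast
    have Aw: "norm (A *v (w' - w)) \<le> \<kappa>0 * B * n"
      using order_trans[OF B(2) mult_right_mono[OF w'(1), of B]] B(1) by (simp add: ac_simps)
    have "norm (A *v w' + q - s) \<le> norm (A *v (w' - w)) + n"
    proof -
      have eq: "A *v w' + q - s = A *v (w' - w) + (A *v w + q - s)" by (simp add: algebra_simps)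
      show ?thesis unfolding eq n_def by (rule norm_triangle_ineq)
    qed
    then have "ell * norm (A *v w' + q - s) \<le> ell * (\<kappa>0 * B * n + n)"
      using Aw ell by (intro mult_left_mono) auto
    moreover have "\<mu> \<bullet> (A *v w) - \<mu> \<bullet> (A *v w') \<le> norm \<mu> * (\<kappa>0 * B * n)"
    proof -
      have "\<mu> \<bullet> (A *v w) - \<mu> \<bullet> (A *v w') = - (\<mu> \<bullet> (A *v (w' - w)))" by (simp add: algebra_simps inner_diff_right)
      also have "\<dots> \<le> norm \<mu> * norm (A *v (w' - w))" using Cauchy_Schwarz_ineq2[of \<mu> "A *v (w' - w)"] by linarith
      also have "\<dots> \<le> norm \<mu> * (\<kappa>0 * B * n)" using Aw by (intro mult_left_mono) auto
      finally show ?thesis .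
    qed
    moreover have nn: "norm (s - q - A *v w) = n"
      unfolding n_def by (subst norm_minus_cancel[symmetric]) (simp add: algebra_simps)
    moreover have "ell * (\<kappa>0 * B * n + n) + norm \<mu> * (\<kappa>0 * B * n) = L * n" by (simp add: L_def algebra_simps)
    ultimately show ?thesis using w'(2) unfolding c_def nn by linarith
  qed
  \<comment> \<open>Pairs of a residual and a value strictly above the objective
    \<open>\<psi> s - \<mu> \<bullet> (A *v w)\<close>. The room below \<gamma> makes the penalized
    bound strict on \<open>E\<close>, as disjointness in the separation argument demands.\<close>
  define E where "E = {(s - q - A *v w, \<gamma> - \<mu> \<bullet> (A *v w)) | s w \<gamma>. \<psi> s < ereal \<gamma>}"
  have "convex E"
    unfolding convex_alt
  proof (intro ballI allI impI)
    fix e1 e2 and u :: real assume e: "e1 \<in> E" "e2 \<in> E" and u: "0 \<le> u \<and> u \<le> 1"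
    obtain s1 w1 \<gamma>1 where 1: "e1 = (s1 - q - A *v w1, \<gamma>1 - \<mu> \<bullet> (A *v w1))" "\<psi> s1 < ereal \<gamma>1"
      using e(1) unfolding E_def by blast
    obtain s2 w2 \<gamma>2 where 2: "e2 = (s2 - q - A *v w2, \<gamma>2 - \<mu> \<bullet> (A *v w2))" "\<psi> s2 < ereal \<gamma>2"
      using e(2) unfolding E_def by blast
    obtain \<gamma>1' where 3: "\<psi> s1 < ereal \<gamma>1'" "\<gamma>1' < \<gamma>1" using ereal_dense2[OF 1(2)] by auto
    obtain \<gamma>2' where 4: "\<psi> s2 < ereal \<gamma>2'" "\<gamma>2' < \<gamma>2" using ereal_dense2[OF 2(2)] by auto
    have "\<psi> ((1 - u) *\<^sub>R s1 + u *\<^sub>R s2) \<le> ereal ((1 - u) * \<gamma>1' + u * \<gamma>2')"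
      using parab_subderiv_convex[of g, OF conv gy sd pe[unfolded A_def]] 3(1) 4(1) u unfolding \<psi>_def A_def by blast
    also have "\<dots> < ereal ((1 - u) * \<gamma>1 + u * \<gamma>2)"
    proof -
      have "(1 - u) * \<gamma>1' + u * \<gamma>2' < (1 - u) * \<gamma>1 + u * \<gamma>2"
      proof (cases "u = 0")
        case True then show ?thesis using 3 by simp
      next
        case False
        then show ?thesis using 3 4 u by (intro add_le_less_mono mult_left_mono mult_strict_left_mono) auto
      qed
      then show ?thesis by simp
    qed
    finally have lt: "\<psi> ((1 - u) *\<^sub>R s1 + u *\<^sub>R s2) < ereal ((1 - u) * \<gamma>1 + u * \<gamma>2)" .
    have "(1 - u) *\<^sub>R e1 + u *\<^sub>R e2 =
        (((1 - u) *\<^sub>R s1 + u *\<^sub>R s2) - q - A *v ((1 - u) *\<^sub>R w1 + u *\<^sub>R w2),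
         ((1 - u) * \<gamma>1 + u * \<gamma>2) - \<mu> \<bullet> (A *v ((1 - u) *\<^sub>R w1 + u *\<^sub>R w2)))"
      unfolding 1 2 by (simp add: algebra_simps inner_add_right inner_diff_right)
    then show "(1 - u) *\<^sub>R e1 + u *\<^sub>R e2 \<in> E" unfolding E_def using lt by blast
  qed
  moreover obtain s0 \<gamma>0 where s0: "\<psi> s0 < ereal \<gamma>0"
    using pe unfolding parab_epi_diff_def \<psi>_def using ereal_dense2 by blast
  then have "E \<noteq> {}" unfolding E_def by blast
  moreover have "c < \<beta> + L * norm p" if pE: "(p, \<beta>) \<in> E" for p \<beta>
  proof -
    obtain s w \<gamma> where e: "p = s - q - A *v w" "\<beta> = \<gamma> - \<mu> \<bullet> (A *v w)" "\<psi> s < ereal \<gamma>"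
      using pE unfolding E_def by blast
    obtain \<gamma>' where g': "\<psi> s < ereal \<gamma>'" "\<gamma>' < \<gamma>" using ereal_dense2[OF e(3)] by auto
    show ?thesis using pen[OF g'(1), of w] g'(2) unfolding e by linarith
  qed
  ultimately obtain \<eta> where "\<forall>(p, \<beta>)\<in>E. c + \<eta> \<bullet> p \<le> \<beta>"
    using penalty_bound_imp_affine_bound[OF _ _ L] by blast
  then have aff: "c + \<eta> \<bullet> (s - q - A *v w) \<le> \<gamma> - \<mu> \<bullet> (A *v w)" if "\<psi> s < ereal \<gamma>" for s w \<gamma>
    using that unfolding E_def by blast
  \<comment> \<open>The inequality \<open>aff\<close> is affine in \<open>w\<close>, which ranges
    over a whole space with \<open>s0\<close> and \<open>\<gamma>0\<close> fixed, so the coefficient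
    of \<open>w\<close> must vanish.\<close>
  have orth: "(\<eta> - \<mu>) \<bullet> (A *v w) = 0" for w
  proof (rule ccontr)
    assume ne: "(\<eta> - \<mu>) \<bullet> (A *v w) \<noteq> 0"
    define z where "z = (\<eta> - \<mu>) \<bullet> (A *v w)"
    define K where "K = c + \<eta> \<bullet> (s0 - q) - \<gamma>0"
    define m where "m = (K - 1) / z"
    have "c + \<eta> \<bullet> (s0 - q - A *v (m *\<^sub>R w)) \<le> \<gamma>0 - \<mu> \<bullet> (A *v (m *\<^sub>R w))" by (rule aff[OF s0])
    then have "K \<le> m * z"
      by (simp add: K_def z_def matrix_vector_mult_scaleR inner_diff_left inner_diff_right algebra_simps)
    moreover have "m * z = K - 1" using ne by (simp add: m_def z_def)
    ultimately show False by simp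
  qed
  have "transpose A *v \<eta> = transpose A *v \<mu>"
  proof -
    have "(transpose A *v \<eta> - transpose A *v \<mu>) \<bullet> w = 0" for w
      using orth[of w] by (simp add: transpose_matrix_vector dot_lmul_matrix inner_diff_left)
    then show ?thesis by (metis eq_iff_diff_eq_0 inner_eq_zero_iff)
  qed
  moreover have "\<eta> \<in> subdiff g (F x)"
  proof (rule subdiffI[of g, OF gy])
    show "\<And>z. g z \<noteq> -\<infinity>" using ppr by (auto simp: proper_def)
    fix z gz assume z: "g z \<le> ereal gz"
    define K where "K = c + \<eta> \<bullet> (s0 - q) - \<gamma>0 - 1"
    \<comment> \<open>\<open>s0\<close> is moved by \<open>r *\<^sub>R (z - F x)\<close> while the
      parabolic subderivative grows by at most \<open>r * (gz - gy)\<close>. As \<open>r\<close> is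
      arbitrary, a violated subgradient inequality at \<open>z\<close> would drive the right side
      below the constant \<open>K\<close>.\<close>
    have bound: "K \<le> r * (gz - gy - \<eta> \<bullet> (z - F x))" if r: "r > 0" for r
    proof -
      have "\<psi> (s0 + r *\<^sub>R (z - F x)) \<le> ereal (\<gamma>0 + r * (gz - gy))"
        using parab_subderiv_recession[of g, OF conv gy sd _ z r] s0 unfolding \<psi>_def A_def by blast
      also have "\<dots> < ereal (\<gamma>0 + r * (gz - gy) + 1)" by simp
      finally have "\<psi> (s0 + r *\<^sub>R (z - F x)) < ereal (\<gamma>0 + r * (gz - gy) + 1)" .
      from aff[OF this, of 0] show ?thesis
        by (simp add: K_def inner_diff_right inner_add_right algebra_simps)
    qed
    show "gy + \<eta> \<bullet> (z - F x) \<le> gz"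
    proof (rule ccontr)
      assume n: "\<not> ?thesis"
      define a where "a = gy + \<eta> \<bullet> (z - F x) - gz"
      have a: "a > 0" using n by (simp add: a_def)
      define r where "r = (\<bar>K\<bar> + 1) / a"
      have "r > 0" using a by (simp add: r_def)
      from bound[OF this] have "K \<le> - (r * a)" by (simp add: a_def algebra_simps)
      moreover have "r * a = \<bar>K\<bar> + 1" using a by (simp add: r_def)
      ultimately show False by simp
    qed
  qed
  ultimately have "\<eta> \<in> Lambda g F x (transpose (jac F x) *v \<mu>)" "\<mu> \<in> Lambda g F x (transpose (jac F x) *v \<mu>)"
    using mu by (auto simp: Lambda_def A_def)
  then have eta: "\<eta> = \<mu>" using sing by auto
  have "ereal (c - \<mu> \<bullet> q) \<le> (INF s. \<psi> s - ereal (\<mu> \<bullet> s))"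
  proof (rule INF_greatest)
    fix s
    show "ereal (c - \<mu> \<bullet> q) \<le> \<psi> s - ereal (\<mu> \<bullet> s)"
    proof (rule ccontr)
      assume "\<not> ?thesis"
      then have "\<psi> s < ereal (c - \<mu> \<bullet> q + \<mu> \<bullet> s)" by (cases "\<psi> s") auto
      then obtain \<gamma> where g: "\<psi> s < ereal \<gamma>" "\<gamma> < c - \<mu> \<bullet> q + \<mu> \<bullet> s" using ereal_dense2 by fastforce
      from aff[OF g(1), of 0] g(2) show False by (simp add: eta inner_diff_right)
    qed
  qed
  also have "\<dots> = subderiv2 g (F x) \<mu> (A *v d)"
    using reg fin unfolding parab_regular_def \<psi>_def A_def by blast
  finally show ?thesis unfolding c_def q_def A_def .
qed

section \<open>The second-order condition\<close>

lemma C2_funD: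
  assumes "C2_fun f"
  shows "grad f differentiable (at x)" "continuous_on UNIV (\<lambda>x. frechet_derivative (grad f) (at x) h)"
  using assms by (auto simp: C2_fun_def)

lemma C2_mapD:
  assumes "C2_map F"
  shows "jac F differentiable (at x)" "continuous_on UNIV (\<lambda>x. frechet_derivative (jac F) (at x) h)"
  using assms by (auto simp: C2_map_def)

text \<open>Assumption (4) supplies normals with second component \<open>- (jac F x *v v)\<close>,
  so the second subderivative is bounded in direction \<open>- v\<close>. Evenness, here and in
  \<open>d2F_minus\<close>, returns the second-order terms to \<open>v\<close>.\<close>

lemma hessq_minus:
  assumes "C2_fun f"
  shows "hessq f x (- v) = hessq f x v"
  unfolding hessq_def linear_neg[OF linear_frechet_derivative[OF C2_funD(1)[OF assms]]] by simp

lemma d2F_minus: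
  assumes "C2_map F"
  shows "d2F F x (- v) = d2F F x v"
  unfolding d2F_def linear_neg[OF linear_frechet_derivative[OF C2_mapD(1)[OF assms]]]
  by (simp add: bounded_bilinear.minus_left[OF bounded_bilinear_matrix_vector_mult]
      bounded_bilinear.minus_right[OF bounded_bilinear_matrix_vector_mult])

lemma transpose_mult_inner:
  fixes A :: "real^'n^'m"
  shows "(transpose A *v \<mu>) \<bullet> h = \<mu> \<bullet> (A *v h)"
  by (simp add: transpose_matrix_vector dot_lmul_matrix)

text \<open>Linearizing \<open>F\<close> inside the convex subgradient inequality costs a quadratic
  error weighted by the multiplier. The constant is therefore uniform only over multipliers bounded
  by \<open>B\<close>, which a convergent sequence of multipliers provides.\<close>

lemma composite_prox_regular:
  fixes f0 :: "real^'n \<Rightarrow> real" and F :: "real^'n \<Rightarrow> real^'m" and g :: "real^'m \<Rightarrow> ereal"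
  assumes f0: "C2_fun f0" and F: "C2_map F" and B: "B \<ge> 0"
  shows "\<exists>r\<ge>0. \<forall>x\<in>cball xb \<delta>. \<forall>\<mu>\<in>subdiff g (F x). \<forall>gy. norm \<mu> \<le> B \<and> g (F x) = ereal gy \<longrightarrow>
    (\<forall>x'\<in>cball xb \<delta>. ereal (f0 x + gy + (grad f0 x + transpose (jac F x) *v \<mu>) \<bullet> (x' - x) - r * (norm (x' - x))\<^sup>2)
      \<le> ereal (f0 x') + g (F x'))"
proof -
  obtain K0 where K0: "K0 \<ge> 0" "\<And>x x'. x \<in> cball xb \<delta> \<Longrightarrow> x' \<in> cball xb \<delta> \<Longrightarrow>
      norm (f0 x' - f0 x - grad f0 x \<bullet> (x' - x)) \<le> K0 * (norm (x' - x))\<^sup>2"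
    using taylor_first_order_cball[OF bounded_bilinear_inner C2_fun_has_derivative[OF f0] C2_funD[OF f0]] by metis
  obtain K1 where K1: "K1 \<ge> 0" "\<And>x x'. x \<in> cball xb \<delta> \<Longrightarrow> x' \<in> cball xb \<delta> \<Longrightarrow>
      norm (F x' - F x - jac F x *v (x' - x)) \<le> K1 * (norm (x' - x))\<^sup>2"
    using taylor_first_order_cball[OF bounded_bilinear_matrix_vector_mult C2_map_has_derivative[OF F] C2_mapD[OF F]] by metis
  have "ereal (f0 x + gy + (grad f0 x + transpose (jac F x) *v \<mu>) \<bullet> (x' - x) - (K0 + B * K1) * (norm (x' - x))\<^sup>2)
      \<le> ereal (f0 x') + g (F x')"
    if x: "x \<in> cball xb \<delta>" and mu: "\<mu> \<in> subdiff g (F x)" and n: "norm \<mu> \<le> B" and gy: "g (F x) = ereal gy"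
      and x': "x' \<in> cball xb \<delta>" for x \<mu> gy x'
  proof -
    define h where "h = x' - x"
    have 1: "grad f0 x \<bullet> h - K0 * (norm h)\<^sup>2 \<le> f0 x' - f0 x"
      using K0(2)[OF x x'] unfolding h_def real_norm_def by linarith
    have "- (\<mu> \<bullet> (F x' - F x - jac F x *v h)) \<le> norm \<mu> * norm (F x' - F x - jac F x *v h)"
      using Cauchy_Schwarz_ineq2[of \<mu> "F x' - F x - jac F x *v h"] by linarith
    also have "\<dots> \<le> B * (K1 * (norm h)\<^sup>2)"
      using K1(2)[OF x x'] n B unfolding h_def by (intro mult_mono) auto
    finally have 2: "\<mu> \<bullet> (jac F x *v h) - B * K1 * (norm h)\<^sup>2 \<le> \<mu> \<bullet> (F x' - F x)"
      by (simp add: inner_diff_right algebra_simps)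
    have "ereal (gy + \<mu> \<bullet> (F x' - F x)) \<le> g (F x')"
      by (rule subdiffE[OF mu]) (use gy in auto)
    moreover have "f0 x + gy + (grad f0 x + transpose (jac F x) *v \<mu>) \<bullet> h - (K0 + B * K1) * (norm h)\<^sup>2
        \<le> f0 x' + (gy + \<mu> \<bullet> (F x' - F x))"
      using 1 2 unfolding inner_add_left transpose_mult_inner distrib_right by linarith
    ultimately show ?thesis unfolding h_def[symmetric] by (cases "g (F x')") auto
  qed
  then show ?thesis using K0(1) K1(1) B by (intro exI[of _ "K0 + B * K1"]) auto
qed

theorem theorem4p6:
  fixes f0 :: "real^'n \<Rightarrow> real" and F :: "real^'n \<Rightarrow> real^'m" and g :: "real^'m \<Rightarrow> ereal"
    and xb :: "real^'n" and \<kappa> \<kappa>0 ell :: real and Wbar :: "real^'m \<Rightarrow> real^'m^'m"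
  assumes f0_C2: "C2_fun f0" and F_C2: "C2_map F"
    and g_lsc: "lsc g" and g_proper: "proper g" and g_convex: "econvex g"
    and xb_dom: "xb \<in> edom (\<lambda>x. g (F x))"
    and kappa_pos: "\<kappa> > 0"
    and tilt: "tilt_stable (\<lambda>x. ereal (f0 x) + g (F x)) xb \<kappa>"
    and KKT: "\<exists>\<mu>\<in>subdiff g (F xb). grad f0 xb + transpose (jac F xb) *v \<mu> = 0"
    and A1: "\<exists>\<epsilon>>0. \<forall>x\<in>ball xb \<epsilon>. \<forall>\<mu>\<in>subdiff g (F x).
               parab_regular g (F x) \<mu> \<and>
               (\<forall>d. subderiv g (F x) d = ereal (\<mu> \<bullet> d) \<longrightarrow> parab_epi_diff g (F x) d)"
    and ell_nonneg: "ell \<ge> 0"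
    and A2_lip: "\<exists>\<epsilon>>0. \<forall>y\<in>ball (F xb) \<epsilon> \<inter> edom g. \<forall>y'\<in>ball (F xb) \<epsilon> \<inter> edom g.
               \<bar>real_of_ereal (g y) - real_of_ereal (g y')\<bar> \<le> ell * dist y y'"
    and kappa0_pos: "\<kappa>0 > 0"
    and A2_metric: "\<exists>U. open U \<and> xb \<in> U \<and> (\<forall>x'\<in>U.
               infdist x' (edom (\<lambda>x. g (F x))) \<le> \<kappa>0 * infdist (F x') (edom g))"
    and A3: "\<forall>\<mu>\<in>subdiff g (F xb).
               Wbar \<mu> \<in> Bsubdiff (prox g) (F xb + \<mu>) \<and>
               (\<Union>V\<in>Clarke_jac (prox g) (F xb + \<mu>). rge V) = rge (Wbar \<mu>) \<and>
               (\<forall>y\<in>(\<Union>V\<in>Clarke_jac (prox g) (F xb + \<mu>). rge V). \<exists>zb. y = Wbar \<mu> *v zb \<and>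
                  (INF zV \<in> {(z, V). V \<in> Clarke_jac (prox g) (F xb + \<mu>) \<and> y = V *v z}.
                      ereal (y \<bullet> (fst zV - y))) = ereal (y \<bullet> (zb - y)) \<and>
                  y \<bullet> (zb - y) = y \<bullet> ((pinv (Wbar \<mu>) - mat 1) *v y))"
    and A4: "\<forall>w\<in>crit_cone g F xb (- grad f0 xb). w \<noteq> 0 \<longrightarrow>
               (\<forall>\<mu>\<in>Lambda_dir g F xb (- grad f0 xb) w \<inter> cball 0 (tau \<kappa>0 ell F xb (- grad f0 xb)).
                 \<forall>v. jac F xb *v v \<in> {u. SOVF g (F xb) \<mu> u < \<infinity>} \<longrightarrow>
                   (\<exists>xk \<mu>k zk vk. xk \<longlonglongrightarrow> xb \<and> \<mu>k \<longlonglongrightarrow> \<mu> \<and>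
                      (\<forall>k. \<mu>k k \<in> subdiff g (F (xk k))) \<and>
                      zk \<longlonglongrightarrow> (pinv (Wbar \<mu>) - mat 1) *v (jac F xb *v v) \<and>
                      vk \<longlonglongrightarrow> v \<and>
                      (\<forall>k. (zk k, - (jac F (xk k) *v vk k))
                             \<in> frechet_normal (gph_subdiff g) (F (xk k), \<mu>k k)) \<and>
                      (\<forall>k. \<exists>a. Lambda g F (xk k) (transpose (jac F (xk k)) *v \<mu>k k) = {a})))"
  shows "\<forall>\<mu>\<in>(\<Union>w\<in>crit_cone g F xb (- grad f0 xb) - {0}. Lambda_dir g F xb (- grad f0 xb) w)
              \<inter> cball 0 (tau \<kappa>0 ell F xb (- grad f0 xb)).
           \<forall>v. v \<noteq> 0 \<and> jac F xb *v v \<in> (\<Union>V\<in>Clarke_jac (prox g) (F xb + \<mu>). rge V) \<longrightarrow>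
             ereal (hessq f0 xb v + \<mu> \<bullet> d2F F xb v) + SOVF g (F xb) \<mu> (jac F xb *v v)
               \<ge> ereal ((1 / \<kappa>) * (norm v)\<^sup>2)"
proof (intro ballI allI impI)
  fix \<mu> v
  assume mu0: "\<mu> \<in> (\<Union>w\<in>crit_cone g F xb (- grad f0 xb) - {0}. Lambda_dir g F xb (- grad f0 xb) w)
              \<inter> cball 0 (tau \<kappa>0 ell F xb (- grad f0 xb))"
    and v0: "v \<noteq> 0 \<and> jac F xb *v v \<in> (\<Union>V\<in>Clarke_jac (prox g) (F xb + \<mu>). rge V)"
  obtain w where w: "w \<in> crit_cone g F xb (- grad f0 xb)" "w \<noteq> 0"
      "\<mu> \<in> Lambda_dir g F xb (- grad f0 xb) w \<inter> cball 0 (tau \<kappa>0 ell F xb (- grad f0 xb))"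
    using mu0 by blast
  have mu: "\<mu> \<in> subdiff g (F xb)" and stat: "- grad f0 xb = transpose (jac F xb) *v \<mu>"
    using w(3) by (auto simp: Lambda_dir_def Lambda_def)
  define y where "y = jac F xb *v v"
  define Z where "Z = (pinv (Wbar \<mu>) - mat 1) *v y"
  have yU: "y \<in> (\<Union>V\<in>Clarke_jac (prox g) (F xb + \<mu>). rge V)" using v0 by (simp add: y_def)
  \<comment> \<open>Assumption (3) evaluates the infimum defining \<open>SOVF\<close> as
    \<open>y \<bullet> Z\<close>. Its finiteness admits \<open>v\<close> in assumption (4), and the
    same \<open>Z\<close> is the limit of the normals' first components.\<close>
  obtain zb where "(INF zV \<in> {(z, V). V \<in> Clarke_jac (prox g) (F xb + \<mu>) \<and> y = V *v z}.
        ereal (y \<bullet> (fst zV - y))) = ereal (y \<bullet> (zb - y))" "y \<bullet> (zb - y) = y \<bullet> Z"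
    using bspec[OF conjunct2[OF conjunct2[OF bspec[OF A3 mu]]] yU] unfolding Z_def by auto
  then have sovf: "SOVF g (F xb) \<mu> y = ereal (y \<bullet> Z)" using yU by (simp add: SOVF_def)
  have "jac F xb *v v \<in> {u. SOVF g (F xb) \<mu> u < \<infinity>}" using sovf by (simp add: y_def)
  then obtain xk \<mu>k zk vk where xk: "xk \<longlonglongrightarrow> xb" and muk: "\<mu>k \<longlonglongrightarrow> \<mu>"
    and sub: "\<And>k. \<mu>k k \<in> subdiff g (F (xk k))" and zk: "zk \<longlonglongrightarrow> Z" and vk: "vk \<longlonglongrightarrow> v"
    and N: "\<And>k. (zk k, - (jac F (xk k) *v vk k)) \<in> frechet_normal (gph_subdiff g) (F (xk k), \<mu>k k)"
    and sing: "\<And>k. \<exists>a. Lambda g F (xk k) (transpose (jac F (xk k)) *v \<mu>k k) = {a}"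
    using A4[rule_format, OF w, of v] unfolding Z_def y_def by blast
  have nm: "\<And>z. g z \<noteq> -\<infinity>" using g_proper by (auto simp: proper_def)
  obtain gb where gb: "g (F xb) = ereal gb"
    using xb_dom nm[of "F xb"] by (cases "g (F xb)") (auto simp: edom_def)
  define f where "f x = ereal (f0 x) + g (F x)" for x
  have fnm: "\<And>z. f z \<noteq> -\<infinity>" unfolding f_def using nm by auto
  have fb: "f xb = ereal (f0 xb + gb)" by (simp add: f_def gb)
  have tilt': "tilt_stable f xb \<kappa>" using tilt unfolding f_def[abs_def] .
  \<comment> \<open>The radius comes first, then the prox-regularity constant \<open>r\<close> on
    that ball, and only then the neighbourhood \<open>\<eta>\<close> of admissible pairs. The
    quantifier order in \<open>tilt_stable_growth\<close> is made for this.\<close>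
  obtain \<delta> where del: "\<delta> > 0" and grow: "\<And>r. r \<ge> 0 \<Longrightarrow> \<exists>\<eta>>0. \<forall>x xs fx. norm (x - xb) < \<eta> \<and> norm xs < \<eta> \<and> f x = ereal fx \<and>
      (\<forall>x'\<in>cball xb \<delta>. ereal (fx + xs \<bullet> (x' - x) - r * (norm (x' - x))\<^sup>2) \<le> f x') \<longrightarrow>
      (\<exists>\<rho>>0. \<forall>x'. norm (x' - x) < \<rho> \<longrightarrow> ereal (fx + xs \<bullet> (x' - x) + (norm (x' - x))\<^sup>2 / (2 * \<kappa>)) \<le> f x')"
    using tilt_stable_growth[of f, OF tilt' kappa_pos fnm fb] by blast
  obtain B where B: "B > 0" "\<And>k. norm (\<mu>k k) \<le> B"
    using convergent_imp_bounded[OF muk] by (auto simp: bounded_pos)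
  obtain r where r: "r \<ge> 0" and prx: "\<And>x \<nu> gy x'. x \<in> cball xb \<delta> \<Longrightarrow> \<nu> \<in> subdiff g (F x) \<Longrightarrow> norm \<nu> \<le> B \<Longrightarrow>
      g (F x) = ereal gy \<Longrightarrow> x' \<in> cball xb \<delta> \<Longrightarrow>
      ereal (f0 x + gy + (grad f0 x + transpose (jac F x) *v \<nu>) \<bullet> (x' - x) - r * (norm (x' - x))\<^sup>2) \<le> f x'"
    using composite_prox_regular[OF f0_C2 F_C2 less_imp_le[OF B(1)], of xb \<delta> g] unfolding f_def by blast
  obtain \<eta> where eta: "\<eta> > 0" and grow': "\<And>x xs fx. norm (x - xb) < \<eta> \<Longrightarrow> norm xs < \<eta> \<Longrightarrow> f x = ereal fx \<Longrightarrow>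
      (\<And>x'. x' \<in> cball xb \<delta> \<Longrightarrow> ereal (fx + xs \<bullet> (x' - x) - r * (norm (x' - x))\<^sup>2) \<le> f x') \<Longrightarrow>
      \<exists>\<rho>>0. \<forall>x'. norm (x' - x) < \<rho> \<longrightarrow> ereal (fx + xs \<bullet> (x' - x) + (norm (x' - x))\<^sup>2 / (2 * \<kappa>)) \<le> f x'"
    using grow[OF r] by metis
  obtain \<epsilon>1 where e1: "\<epsilon>1 > 0" and reg: "\<And>x \<nu>. x \<in> ball xb \<epsilon>1 \<Longrightarrow> \<nu> \<in> subdiff g (F x) \<Longrightarrow> parab_regular g (F x) \<nu>"
    and epi: "\<And>x \<nu> d. x \<in> ball xb \<epsilon>1 \<Longrightarrow> \<nu> \<in> subdiff g (F x) \<Longrightarrow> subderiv g (F x) d = ereal (\<nu> \<bullet> d) \<Longrightarrow> parab_epi_diff g (F x) d"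
    using A1 by blast
  obtain \<epsilon>2 where e2: "\<epsilon>2 > 0" and lip: "\<And>y y'. y \<in> ball (F xb) \<epsilon>2 \<inter> edom g \<Longrightarrow> y' \<in> ball (F xb) \<epsilon>2 \<inter> edom g \<Longrightarrow>
      \<bar>real_of_ereal (g y) - real_of_ereal (g y')\<bar> \<le> ell * dist y y'"
    using A2_lip by blast
  obtain U where U: "open U" "xb \<in> U" and metric: "\<And>x'. x' \<in> U \<Longrightarrow>
      infdist x' (edom (\<lambda>x. g (F x))) \<le> \<kappa>0 * infdist (F x') (edom g)"
    using A2_metric by blast
  note bA = bounded_bilinear_matrix_vector_mult
  have "isCont (jac F) xb" "isCont (grad f0) xb"
    using C2_mapD(1)[OF F_C2] C2_funD(1)[OF f0_C2] differentiable_imp_continuous_within by blast+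
  then have jk: "(\<lambda>k. jac F (xk k)) \<longlonglongrightarrow> jac F xb" and gk: "(\<lambda>k. grad f0 (xk k)) \<longlonglongrightarrow> grad f0 xb"
    using xk isCont_tendsto_compose by blast+
  have Fk: "(\<lambda>k. F (xk k)) \<longlonglongrightarrow> F xb"
    using has_derivative_continuous[OF C2_map_has_derivative[OF F_C2]] xk isCont_tendsto_compose by blast
  \<comment> \<open>The gradient of the Lagrangian is the tilt at \<open>xk k\<close>. Its limit is
    0 by stationarity of \<open>\<mu>\<close>, so the pairs eventually enter the neighbourhood where
    growth holds.\<close>
  define xs where "xs k = grad f0 (xk k) + transpose (jac F (xk k)) *v \<mu>k k" for k
  have "(\<lambda>k. transpose (jac F (xk k))) \<longlonglongrightarrow> transpose (jac F xb)"
    unfolding transpose_def by (intro tendsto_intros jk)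
  then have "xs \<longlonglongrightarrow> grad f0 xb + transpose (jac F xb) *v \<mu>"
    unfolding xs_def by (intro tendsto_add gk bounded_bilinear.tendsto[OF bA] muk)
  then have xs: "xs \<longlonglongrightarrow> 0" unfolding stat[symmetric] by simp
  have ev: "\<forall>\<^sub>F k in sequentially. (norm (vk k))\<^sup>2 / \<kappa>
      \<le> hessq f0 (xk k) (vk k) + \<mu>k k \<bullet> d2F F (xk k) (vk k) + zk k \<bullet> (jac F (xk k) *v vk k)"
    using tendstoD[OF xk e1] tendstoD[OF xk eta] tendstoD[OF xk del] tendstoD[OF xs eta] tendstoD[OF Fk e2]
      topological_tendstoD[OF xk U]
  proof eventually_elim
    case (elim k)
    obtain gy where gy: "g (F (xk k)) = ereal gy" by (rule subdiffE[OF sub[of k]]) blast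
    have xe: "xk k \<in> ball xb \<epsilon>1" and xd: "xk k \<in> cball xb \<delta>" using elim by (auto simp: dist_commute)
    note regk = reg[OF xe sub] and epik = epi[OF xe sub]
    have "f (xk k) = ereal (f0 (xk k) + gy)" by (simp add: f_def gy)
    then obtain \<rho> where rho: "\<rho> > 0" and gr: "\<And>x'. norm (x' - xk k) < \<rho> \<Longrightarrow>
        ereal (f0 (xk k) + gy + xs k \<bullet> (x' - xk k) + (norm (x' - xk k))\<^sup>2 / (2 * \<kappa>)) \<le> f x'"
      using grow'[of "xk k" "xs k" "f0 (xk k) + gy"] prx[OF xd sub B(2) gy] elim unfolding xs_def dist_norm by auto
    define r1 where "r1 = \<epsilon>2 - dist (F xb) (F (xk k))"
    have r1: "r1 > 0" using elim by (simp add: r1_def dist_commute)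
    have b1: "ball (F (xk k)) r1 \<subseteq> ball (F xb) \<epsilon>2"
    proof
      fix y' assume "y' \<in> ball (F (xk k)) r1"
      then show "y' \<in> ball (F xb) \<epsilon>2"
        using dist_triangle[of "F xb" y' "F (xk k)"] by (simp add: r1_def)
    qed
    obtain r2 where r2: "r2 > 0" "ball (xk k) r2 \<subseteq> U"
      using U(1) elim open_contains_ball by blast
    obtain \<mu>0 where mu0: "Lambda g F (xk k) (transpose (jac F (xk k)) *v \<mu>k k) = {\<mu>0}" using sing by blast
    have neg: "jac F (xk k) *v (- vk k) = - (jac F (xk k) *v vk k)"
      by (rule bounded_bilinear.minus_right[OF bA])
    have up: "subderiv2 g (F (xk k)) (\<mu>k k) (jac F (xk k) *v (- vk k)) \<le> ereal (zk k \<bullet> (jac F (xk k) *v vk k))"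
      unfolding neg by (rule frechet_normal_subderiv2_le[OF g_lsc g_proper g_convex sub regk epik N])
    \<comment> \<open>The upper bound has a second use: finiteness makes the direction critical, so
      the lower estimate applies to it.\<close>
    then have fin: "subderiv2 g (F (xk k)) (\<mu>k k) (jac F (xk k) *v (- vk k)) < \<infinity>"
      by (rule le_less_trans) simp
    have "ereal ((norm (- vk k))\<^sup>2 / \<kappa> - hessq f0 (xk k) (- vk k) - \<mu>k k \<bullet> d2F F (xk k) (- vk k))
        \<le> subderiv2 g (F (xk k)) (\<mu>k k) (jac F (xk k) *v (- vk k))"
    proof (rule second_subderivative_growth[OF f0_C2 F_C2 g_proper g_convex sub gy regk epik rho _ r1 _ r2(1) _
          ell_nonneg kappa_pos kappa0_pos mu0 fin])
      fix x' assume "norm (x' - xk k) < \<rho>"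
      from gr[OF this] show "ereal (f0 (xk k) + gy + (grad f0 (xk k) \<bullet> (x' - xk k) + \<mu>k k \<bullet> (jac F (xk k) *v (x' - xk k)))
          + (norm (x' - xk k))\<^sup>2 / (2 * \<kappa>)) \<le> ereal (f0 x') + g (F x')"
        unfolding xs_def f_def inner_add_left transpose_mult_inner .
    next
      fix y' y'' assume "y' \<in> ball (F (xk k)) r1 \<inter> edom g" "y'' \<in> ball (F (xk k)) r1 \<inter> edom g"
      then show "\<bar>real_of_ereal (g y') - real_of_ereal (g y'')\<bar> \<le> ell * dist y' y''"
        using b1 by (intro lip) auto
    next
      fix x' assume "x' \<in> ball (xk k) r2"
      then show "infdist x' (edom (\<lambda>x. g (F x))) \<le> \<kappa>0 * infdist (F x') (edom g)"
        using r2(2) by (intro metric) auto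
    qed
    from order_trans[OF this up] show ?case
      by (simp add: hessq_minus[OF f0_C2] d2F_minus[OF F_C2])
  qed
  have h1: "(\<lambda>k. hessq f0 (xk k) (vk k)) \<longlonglongrightarrow> hessq f0 xb v"
    unfolding hessq_def by (intro tendsto_inner tendsto_frechet_derivative C2_funD[OF f0_C2] xk vk)
  have h2: "(\<lambda>k. d2F F (xk k) (vk k)) \<longlonglongrightarrow> d2F F xb v"
    unfolding d2F_def
    by (intro bounded_bilinear.tendsto[OF bA] tendsto_frechet_derivative C2_mapD[OF F_C2] xk vk)
  have h3: "(\<lambda>k. jac F (xk k) *v vk k) \<longlonglongrightarrow> y"
    unfolding y_def by (intro bounded_bilinear.tendsto[OF bA] jk vk)
  have "(norm v)\<^sup>2 / \<kappa> \<le> hessq f0 xb v + \<mu> \<bullet> d2F F xb v + Z \<bullet> y"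
  proof (rule tendsto_le[OF sequentially_bot _ _ ev])
    show "(\<lambda>k. (norm (vk k))\<^sup>2 / \<kappa>) \<longlonglongrightarrow> (norm v)\<^sup>2 / \<kappa>"
      using kappa_pos by (intro tendsto_intros vk) auto
    show "(\<lambda>k. hessq f0 (xk k) (vk k) + \<mu>k k \<bullet> d2F F (xk k) (vk k) + zk k \<bullet> (jac F (xk k) *v vk k))
        \<longlonglongrightarrow> hessq f0 xb v + \<mu> \<bullet> d2F F xb v + Z \<bullet> y"
      by (intro tendsto_intros h1 h2 h3 muk zk)
  qed
  then show "ereal (hessq f0 xb v + \<mu> \<bullet> d2F F xb v) + SOVF g (F xb) \<mu> (jac F xb *v v) \<ge> ereal ((1 / \<kappa>) * (norm v)\<^sup>2)"
    unfolding y_def[symmetric] sovf by (simp add: inner_commute)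
qed

end
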